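(* Let $T>0$, $I:=[0,T]$, and let $\Omega\subset\mathbb{R}^d$ be closed. Let $b\in L^\infty_{\mathrm{loc}}(I\times\Omega;\mathbb{R}^d)$ be a velocity field such that: (i) there exists a function $c\in L^1(I)$ with $|b(t,x)|\le c(t)(1+|x|)$ for all $(t,x)\in I\times\Omega$; (ii) for all $(t,x)\in[0,T)\times\partial\Omega$ we have $F(t,x)\cap \mathrm{T}_x\Omega\neq\varnothing$, where $F$ is the Filippov set-valued map of $b$ and $\mathrm{T}_x\Omega$ is the tangent cone to $\Omega$ at $x$. Then there exists a map $X\colon I\times I\times\Omega\to\Omega$ such that: 1. For all $0\le s\le t\le T$, the map $x\mapsto X(t,s,x)$ is Borel measurable. 2. For all $(s,x)\in I\times\Omega$, the map $t\mapsto X(t,s,x)$, $t\in[s,T]$, is a Filippov solution of $$\dot\gamma(t)=b(t,\gamma(t))\quad\text{for } s\le t\le T,\qquad \gamma(s)=x.$$ 3. The flow has the semigroup property: for all $x\in\Omega$, $$X(t,r,x)=X\big(t,s,X(s,r,x)\big)\quad\text{for } 0\le r\le s\le t\le T.$$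
   Context: The velocity field $b$ is a concrete (everywhere defined) measurable function, not an equivalence class modulo null sets. $\mathcal{L}^d$ denotes $d$-dimensional Lebesgue measure, $\mathcal{S}^{d-1}$ the unit sphere in $\mathbb{R}^d$, and $B_\delta(x)$ the ball of radius $\delta$ centered at $x$. Filippov set-valued map: for $(t,x)\in I\times\Omega$, $$F(t,x):=\bigcap_{\xi\in\mathcal{S}^{d-1}}\{v\in\mathbb{R}^d:\ \xi\cdot v\le h(t,x,\xi)\},\qquad h(t,x,\xi):=\lim_{\delta\to0}h_\delta(t,x,\xi),$$ $$h_\delta(t,x,\xi):=\operatorname*{ess\,sup}_{y\in B_\delta(x)\cap\Omega}\big(\xi\cdot b(t,y)\big)=\inf_{\mathcal{L}^d(N)=0}\ \sup_{y\in (B_\delta(x)\cap\Omega)\setminus N}\big(\xi\cdot b(t,y)\big).$$ Filippov solution of $\dot\gamma(t)=b(t,\gamma(t))$ for $s\le t\le T$, $\gamma(s)=x$: an absolutely continuous map $\gamma\colon[s,T]\to\Omega$ with $\gamma(s)=x$ and $\dot\gamma(t)\in F(t,\gamma(t))$ for a.e. $t\in[s,T]$. Tangent cone: for $x\in\Omega$, $\mathrm{T}_x\Omega:=\{v\in\mathbb{R}^d:\ \liminf_{\lambda\to0+}\lambda^{-1}d(x+\lambda v,\Omega)=0\}$, where $d$ is the Euclidean distance. *)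

theory Defs
  imports "HOL-Analysis.Analysis"
begin

text \<open>The dimension \<open>d\<close> is \<open>DIM('a)\<close> for a type \<open>'a\<close> of class \<open>euclidean_space\<close>.\<close>

definition Linf_loc_on :: "'b::euclidean_space set \<Rightarrow> ('b \<Rightarrow> 'c::euclidean_space) \<Rightarrow> bool" where
  "Linf_loc_on S f \<longleftrightarrow>
     f \<in> borel_measurable (lebesgue_on S) \<and>
     (\<forall>K. compact K \<longrightarrow> K \<subseteq> S \<longrightarrow> (\<exists>C. AE z in lebesgue_on K. norm (f z) \<le> C))"

text \<open>
  The essential supremum is taken in the extended reals: if \<open>ball x \<delta> \<inter> \<Omega>\<close> is a null set, its
  value is \<open>-\<infinity>\<close>. It is written out as an infimum over null sets because \<open>esssup\<close> from
  \<open>HOL-Probability\<close> is \<open>\<infinity>\<close> on non-measurable functions, and \<open>b t\<close> may fail to be measurable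
  for \<open>t\<close> in a null set.
\<close>
definition filippov_h_delta ::
    "(real \<Rightarrow> 'a \<Rightarrow> 'a) \<Rightarrow> 'a::euclidean_space set \<Rightarrow> real \<Rightarrow> real \<Rightarrow> 'a \<Rightarrow> 'a \<Rightarrow> ereal" where
  "filippov_h_delta b \<Omega> \<delta> t x \<xi> =
     (INF N \<in> null_sets lebesgue. SUP y \<in> (ball x \<delta> \<inter> \<Omega>) - N. ereal (\<xi> \<bullet> b t y))"

definition filippov_h ::
    "(real \<Rightarrow> 'a \<Rightarrow> 'a) \<Rightarrow> 'a::euclidean_space set \<Rightarrow> real \<Rightarrow> 'a \<Rightarrow> 'a \<Rightarrow> ereal" where
  "filippov_h b \<Omega> t x \<xi> = Lim (at_right 0) (\<lambda>\<delta>. filippov_h_delta b \<Omega> \<delta> t x \<xi>)"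

lemma filippov_h_delta_mono:
  assumes "\<delta> \<le> \<epsilon>"
  shows "filippov_h_delta b \<Omega> \<delta> t x \<xi> \<le> filippov_h_delta b \<Omega> \<epsilon> t x \<xi>"
  unfolding filippov_h_delta_def using assms
  by (intro INF_mono' SUP_subset_mono) (auto simp: subset_ball)

text \<open>The limit defining \<open>filippov_h\<close> always exists, by monotonicity in \<open>\<delta>\<close>.\<close>

lemma filippov_h_delta_tendsto:
  "((\<lambda>\<delta>. filippov_h_delta b \<Omega> \<delta> t x \<xi>) \<longlongrightarrow> filippov_h b \<Omega> t x \<xi>) (at_right 0)"
proof -
  let ?f = "\<lambda>\<delta>. filippov_h_delta b \<Omega> \<delta> t x \<xi>"
  have "(?f \<longlongrightarrow> (INF \<delta>\<in>{0<..}. ?f \<delta>)) (at_right 0)"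
  proof (rule order_tendstoI)
    fix a assume "a < (INF \<delta>\<in>{0<..}. ?f \<delta>)"
    then show "\<forall>\<^sub>F \<delta> in at_right 0. a < ?f \<delta>"
      unfolding eventually_at_right_field
      by (meson INF_lower greaterThan_iff less_le_trans zero_less_one)
  next
    fix a assume "(INF \<delta>\<in>{0<..}. ?f \<delta>) < a"
    then obtain e where "e > 0" "?f e < a"
      by (auto simp: INF_less_iff)
    then show "\<forall>\<^sub>F \<delta> in at_right 0. ?f \<delta> < a"
      unfolding eventually_at_right_field
      by (meson filippov_h_delta_mono le_less_trans less_imp_le)
  qed
  then show ?thesis
    unfolding filippov_h_def
    by (metis tendsto_Lim trivial_limit_at_right_real)
qed

definition filippov_map ::
    "(real \<Rightarrow> 'a \<Rightarrow> 'a) \<Rightarrow> 'a::euclidean_space set \<Rightarrow> real \<Rightarrow> 'a \<Rightarrow> 'a set" where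
  "filippov_map b \<Omega> t x = (\<Inter>\<xi> \<in> sphere 0 1. {v. ereal (\<xi> \<bullet> v) \<le> filippov_h b \<Omega> t x \<xi>})"

definition tangent_cone :: "'a::euclidean_space set \<Rightarrow> 'a \<Rightarrow> 'a set" where
  "tangent_cone \<Omega> x =
     {v. Liminf (at_right 0) (\<lambda>r. ereal (inverse r * infdist (x + r *\<^sub>R v) \<Omega>)) = 0}"

text \<open>
  The \<open>\<epsilon>\<close>-\<open>\<delta>\<close> definition of absolute continuity. The members \<open>k\<close> of \<open>D\<close> are finitely many
  nonoverlapping closed intervals \<open>{Inf k..Sup k}\<close>.
\<close>
definition abs_continuous_on_interval ::
    "real \<Rightarrow> real \<Rightarrow> (real \<Rightarrow> 'a::real_normed_vector) \<Rightarrow> bool" where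
  "abs_continuous_on_interval p q f \<longleftrightarrow>
     (\<forall>\<epsilon>>0. \<exists>\<delta>>0. \<forall>D. D division_of \<Union>D \<longrightarrow> \<Union>D \<subseteq> {p..q} \<longrightarrow> (\<Sum>k\<in>D. Sup k - Inf k) < \<delta> \<longrightarrow>
        (\<Sum>k\<in>D. norm (f (Sup k) - f (Inf k))) < \<epsilon>)"

definition filippov_solution ::
    "(real \<Rightarrow> 'a \<Rightarrow> 'a) \<Rightarrow> 'a::euclidean_space set \<Rightarrow> real \<Rightarrow> real \<Rightarrow> 'a \<Rightarrow> (real \<Rightarrow> 'a) \<Rightarrow> bool" where
  "filippov_solution b \<Omega> s T x \<gamma> \<longleftrightarrow>
     \<gamma> ` {s..T} \<subseteq> \<Omega> \<and>
     abs_continuous_on_interval s T \<gamma> \<and>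
     \<gamma> s = x \<and>
     (AE t in lebesgue_on {s..T}.
        \<exists>v \<in> filippov_map b \<Omega> t (\<gamma> t). (\<gamma> has_vector_derivative v) (at t within {s..T}))"

end

theory Submission
  imports Defs "HOL-Complex_Analysis.Great_Picard"
begin

text \<open>
  Write \<open>h\<^sub>\<delta>(t, x, \<xi>)\<close> for the essential supremum of \<open>\<xi> \<bullet> b t\<close> over the part of \<open>\<Omega>\<close> in the \<open>\<delta>\<close>-ball
  at \<open>x\<close>. A vector \<open>v\<close> belongs to the Filippov set at \<open>(t, x)\<close> iff \<open>\<xi> \<bullet> v \<le> h\<^sub>\<delta>(t, x, \<xi>)\<close> for all
  \<open>\<delta> > 0\<close> and all unit vectors \<open>\<xi>\<close>. Integrating this in time leads to the notion of solution on which
  the whole proof rests (\<open>sol\<close>): a path \<open>\<gamma>\<close> in \<open>\<Omega>\<close> whose increments are dominated by an integrable function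
  and which satisfies
  \<open>\<xi> \<bullet> (\<gamma> q - \<gamma> p) \<le> \<integral>\<^sub>p\<^sup>q h\<^sub>\<delta>(t, \<gamma> t, \<xi>) dt\<close> for all \<open>p \<le> q\<close>, all \<open>\<delta> > 0\<close> and all \<open>\<xi>\<close> in a countable
  dense set of directions. Differentiating at the common Lebesgue points of countably many functions
  shows that such a path is a Filippov solution (\<open>sol_derivative\<close>). The gain is that the integral form
  survives pointwise limits: if \<open>\<gamma>\<^sub>n t\<close> tends to \<open>\<gamma> t\<close> and \<open>\<delta>\<^sub>n\<close> to \<open>0\<close>, then the \<open>\<delta>\<^sub>n\<close>-ball at \<open>\<gamma>\<^sub>n t\<close> is
  eventually contained in the \<open>\<delta>\<close>-ball at \<open>\<gamma> t\<close>, so \<open>h\<close> is upper semicontinuous along the sequence, and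
  dominated convergence does the rest (\<open>approx_compactness\<close>). Thus solution sets are compact, depend upper
  semicontinuously on the initial point, and contain all limits of approximate solutions.

  Existence (\<open>sol_nonempty\<close>) comes from Euler polygons. Call a time good if the tangency condition
  holds there and if it is a Lebesgue point of \<open>c\<close> and of the functions \<open>h\<^sub>\<delta>(\<cdot>, z, \<xi>)\<close> for countably many
  \<open>\<delta>\<close>, \<open>z\<close>, \<open>\<xi>\<close>. At a good time a tangent velocity in the Filippov set predicts the admissible displacement over a
  short time interval up to a relatively small error, and tangency provides a point of \<open>\<Omega>\<close> near the
  predicted one. The remaining times form a null set, hence lie in an open set on which \<open>c\<close> has small integral;
  there the polygon simply does not move. Either kind of step works from a whole
  neighbourhood of its starting point, so compactness bounds the step lengths from below
  (\<open>uniform_step\<close>) and finitely many steps reach the final time.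

  To select one solution from each starting point, maximize successively the countably many
  evaluations \<open>\<gamma> q \<bullet> i\<close> with rational \<open>q\<close> and basis vectors \<open>i\<close>. By compactness a lexicographic maximizer
  exists, and it is unique since its values at rational times are determined. It depends measurably on
  the starting point, because each maximal value is a limit of differences of upper semicontinuous
  functions (\<open>penalized_maximum_tendsto\<close>). The semigroup property holds because restricting the
  maximizer to \<open>[s, T]\<close> gives the maximizer from its position at time \<open>s\<close>: all competitors glued on at
  time \<open>s\<close> share the evaluations before \<open>s\<close>, and the later ones are compared in the same order
  (\<open>flow_restrict_lex\<close>).

  A final reduction replaces the given field by a Borel field that agrees with it almost everywhere, since the Filippov
  map does not see null sets.
\<close>

section \<open>Lebesgue points on the line\<close>

lemma integral_small_on_small_sets:
  fixes f :: "'b \<Rightarrow> real"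
  assumes f: "integrable M f" and e: "e > 0"
  obtains d where "d > 0"
    "\<And>A. A \<in> sets M \<Longrightarrow> emeasure M A \<le> ennreal d \<Longrightarrow> (LINT x:A|M. \<bar>f x\<bar>) < e"
proof -
  have [measurable]: "f \<in> borel_measurable M" using f by auto
  have "(\<lambda>n. LINT x|M. \<bar>f x\<bar> - min \<bar>f x\<bar> (real n)) \<longlonglongrightarrow> (LINT x|M. 0)"
  proof (rule integral_dominated_convergence[where w = "\<lambda>x. \<bar>f x\<bar>"])
    have "(\<lambda>n. \<bar>f x\<bar> - min \<bar>f x\<bar> (real n)) \<longlonglongrightarrow> 0" for x
    proof (rule tendsto_eventually)
      show "\<forall>\<^sub>F n in sequentially. \<bar>f x\<bar> - min \<bar>f x\<bar> (real n) = 0"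
        using eventually_ge_at_top[of "nat \<lceil>\<bar>f x\<bar>\<rceil>"] by eventually_elim linarith
    qed
    then show "AE x in M. (\<lambda>n. \<bar>f x\<bar> - min \<bar>f x\<bar> (real n)) \<longlonglongrightarrow> 0" by simp
  qed (use f in auto)
  then have "\<forall>\<^sub>F n in sequentially. (LINT x|M. \<bar>f x\<bar> - min \<bar>f x\<bar> (real n)) < e / 2"
    using e by (intro order_tendstoD(2)) auto
  then obtain n where n: "(LINT x|M. \<bar>f x\<bar> - min \<bar>f x\<bar> (real n)) < e / 2"
    using eventually_happens'[OF sequentially_bot] by blast
  have fI: "integrable M (\<lambda>x. \<bar>f x\<bar> - min \<bar>f x\<bar> (real n))"
    by (rule Bochner_Integration.integrable_bound[OF f]) auto
  show thesis
  proof
    show "e / (2 * (real n + 1)) > 0" using e by simp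
  next
    fix A assume A[measurable]: "A \<in> sets M"
      and small: "emeasure M A \<le> ennreal (e / (2 * (real n + 1)))"
    have fin: "emeasure M A < \<infinity>" using small by (auto simp: less_top[symmetric] top_unique)
    have mA: "measure M A \<le> e / (2 * (real n + 1))"
      using small e by (simp add: measure_def enn2real_leI)
    have "(LINT x:A|M. \<bar>f x\<bar>)
        \<le> (LINT x|M. (\<bar>f x\<bar> - min \<bar>f x\<bar> (real n)) + real n * indicator A x)"
      unfolding set_lebesgue_integral_def
    proof (rule integral_mono)
      show "integrable M (\<lambda>x. indicat_real A x *\<^sub>R \<bar>f x\<bar>)"
        using f A by (intro integrable_mult_indicator) auto
      show "integrable M (\<lambda>x. (\<bar>f x\<bar> - min \<bar>f x\<bar> (real n)) + real n * indicator A x)"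
        using fI A fin by (intro Bochner_Integration.integrable_add) auto
    qed (auto simp: indicator_def)
    also have "\<dots> = (LINT x|M. (\<bar>f x\<bar> - min \<bar>f x\<bar> (real n))) + real n * measure M A"
      using fI A fin by (subst Bochner_Integration.integral_add) auto
    also have "\<dots> < e / 2 + e / 2"
    proof (rule add_less_le_mono[OF n])
      have "real n * measure M A \<le> real n * (e / (2 * (real n + 1)))"
        using mA by (intro mult_left_mono) auto
      also have "\<dots> \<le> e / 2" using e by (simp add: field_simps)
      finally show "real n * measure M A \<le> e / 2" .
    qed
    finally show "(LINT x:A|M. \<bar>f x\<bar>) < e" by simp
  qed
qed

lemma
  fixes f :: "real \<Rightarrow> real"
  assumes "integrable lborel f"
  shows integrable_on_Icc: "f integrable_on {a..b}"
    and LINT_Icc_eq_integral: "(LINT x:{a..b}|lborel. f x) = integral {a..b} f"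
proof -
  have "set_integrable lborel {a..b} f"
    unfolding set_integrable_def using assms by (intro integrable_mult_indicator) auto
  from set_borel_integral_eq_integral[OF this]
  show "f integrable_on {a..b}" "(LINT x:{a..b}|lborel. f x) = integral {a..b} f" .
qed

text \<open>
  Let \<open>A\<close> be the part of \<open>{f < p}\<close> in a bounded interval and \<open>U\<close> an open set that exceeds \<open>A\<close> by very
  little. By Vitali's theorem almost all of the exceptional set is covered by disjoint intervals inside \<open>U\<close> on
  which \<open>f\<close> has average above \<open>q\<close>. Over their union \<open>V\<close> the integral of \<open>f\<close> is at least \<open>q |V|\<close>, but
  at most \<open>p |V|\<close> plus the small contribution of \<open>U - A\<close>. Hence \<open>|V|\<close> is small.
\<close>

lemma negligible_large_averages:
  fixes f :: "real \<Rightarrow> real"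
  assumes f: "integrable lborel f" and pq: "p < q"
  shows "negligible {t. f t < p \<and> (\<forall>d>0. \<exists>u v. u \<le> t \<and> t \<le> v \<and> 0 < v - u \<and> v - u < d \<and>
                          q * (v - u) < integral {u..v} f)}" (is "negligible ?E")
  unfolding negligible_on_intervals[of ?E]
proof (intro allI)
  fix l r :: real
  have [measurable]: "f \<in> borel_measurable borel" using f by auto
  define A where "A = {t. f t < p} \<inter> {l..r}"
  have A[measurable]: "A \<in> sets borel" unfolding A_def by measurable
  show "negligible (?E \<inter> cbox l r)"
    unfolding negligible_outer_le
  proof (intro allI impI)
    fix e0 :: real assume "e0 > 0"
    define e where "e = e0 * (q - p)"
    have e: "e > 0" using \<open>e0 > 0\<close> pq by (simp add: e_def)
    obtain d where d: "d > 0"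
      "\<And>B. B \<in> sets lborel \<Longrightarrow> emeasure lborel B \<le> ennreal d \<Longrightarrow> (LINT x:B|lborel. \<bar>f x\<bar>) < e / 2"
      using integral_small_on_small_sets[OF f, of "e / 2"] e by auto
    define d' where "d' = min d (e / (2 * (\<bar>p\<bar> + 1)))"
    have d': "d' > 0" using d e by (simp add: d'_def)
    obtain U where U: "open U" "A \<subseteq> U" "emeasure lborel (U - A) < ennreal d'"
      using outer_regular_lborel[of A d'] d' A by auto
    have [measurable]: "U \<in> sets borel" using U by auto
    have UAfin: "emeasure lborel (U - A) < \<infinity>" using U(3) by (simp add: order_less_trans)
    have U1: "(LINT x:(U - A)|lborel. \<bar>f x\<bar>) < e / 2"
      using order.trans[OF less_imp_le[OF U(3)] ennreal_leI, of d] by (intro d(2)) (auto simp: d'_def)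
    have U2: "\<bar>p\<bar> * measure lborel (U - A) \<le> e / 2"
    proof -
      have "measure lborel (U - A) \<le> e / (2 * (\<bar>p\<bar> + 1))"
        unfolding measure_def using order.trans[OF less_imp_le[OF U(3)] ennreal_leI, of "e / (2 * (\<bar>p\<bar> + 1))"] e
        by (intro enn2real_leI) (auto simp: d'_def)
      then have "\<bar>p\<bar> * measure lborel (U - A) \<le> \<bar>p\<bar> * (e / (2 * (\<bar>p\<bar> + 1)))"
        by (intro mult_left_mono) auto
      also have "\<dots> \<le> e / 2" using e by (simp add: field_simps)
      finally show ?thesis .
    qed
    define K where "K = {(a::real, s). 0 < s \<and> cball a s \<subseteq> U \<and> q * (2 * s) < integral (cball a s) f}"
    have Vit: "\<exists>i. i \<in> K \<and> x \<in> cball (fst i) (snd i) \<and> snd i < \<delta>"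
      if x: "x \<in> ?E \<inter> cbox l r" and "\<delta> > 0" for x \<delta>
    proof -
      have "x \<in> U" using x U(2) by (auto simp: A_def)
      then obtain \<rho> where \<rho>: "\<rho> > 0" "cball x \<rho> \<subseteq> U" using U(1) open_contains_cball by blast
      have "min \<rho> \<delta> > 0" using \<rho> \<open>\<delta> > 0\<close> by simp
      then obtain u v where uv: "u \<le> x" "x \<le> v" "0 < v - u" "v - u < min \<rho> \<delta>"
          "q * (v - u) < integral {u..v} f"
        using x by blast
      have eq: "cball ((u + v) / 2) ((v - u) / 2) = {u..v}"
        by (auto simp: cball_eq_atLeastAtMost field_simps)
      have "{u..v} \<subseteq> U" using uv \<rho>(2) by (force simp: cball_eq_atLeastAtMost)
      then show ?thesis using uv eq
        by (intro exI[of _ "((u + v) / 2, (v - u) / 2)"]) (auto simp: K_def field_simps)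
    qed
    have Kpos: "0 < snd i" if "i \<in> K" for i using that by (auto simp: K_def)
    obtain C where C: "countable C" "C \<subseteq> K"
       "pairwise (\<lambda>i j. disjnt (cball (fst i) (snd i)) (cball (fst j) (snd j))) C"
       "negligible (?E \<inter> cbox l r - (\<Union>i \<in> C. cball (fst i) (snd i)))"
      by (rule Vitali_covering_theorem_cballs[of K snd "?E \<inter> cbox l r" fst, OF Kpos Vit])
    let ?B = "\<lambda>i::real\<times>real. cball (fst i) (snd i)"
    have Bm: "?B i \<in> lmeasurable" for i by (rule lmeasurable_cball)
    have fin_bd: "measure lebesgue (\<Union>i\<in>C'. ?B i) \<le> e0" if C': "C' \<subseteq> C" "finite C'" for C'
    proof -
      define V where "V = (\<Union>i\<in>C'. ?B i)"
      have dj: "disjoint_family_on ?B C'"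
        using C(3) C'(1) unfolding disjoint_family_on_def pairwise_def disjnt_def by blast
      have KD: "0 < snd i" "?B i \<subseteq> U" "q * (2 * snd i) < integral (?B i) f" if "i \<in> C'" for i
      proof -
        have "i \<in> K" using that C(2) C'(1) by blast
        then show "0 < snd i" "?B i \<subseteq> U" "q * (2 * snd i) < integral (?B i) f"
          unfolding K_def by (auto simp: split_beta)
      qed
      have VU: "V \<subseteq> U" unfolding V_def using KD(2) by blast
      have [measurable]: "V \<in> sets borel" unfolding V_def using C' by (intro sets.finite_UN) auto
      have si: "set_integrable lborel (?B i) f" for i
        unfolding set_integrable_def using f by (intro integrable_mult_indicator) auto
      have Bf: "emeasure lborel (?B i) < top" for i
        using emeasure_lborel_cball_finite[of "fst i" "snd i"] by simp
      have mV: "measure lborel V = (\<Sum>i\<in>C'. measure lborel (?B i))"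
        unfolding V_def using dj C'
        using Bf less_imp_neq[OF Bf] by (intro measure_finite_Union) auto
      have mB: "measure lborel (?B i) = 2 * snd i" if "i \<in> C'" for i
        using KD(1)[OF that] by (simp add: cball_eq_atLeastAtMost)
      have Vfin: "emeasure lborel V < \<infinity>"
        unfolding V_def
        by (rule le_less_trans[OF emeasure_subadditive_finite])
          (use C' Bf in auto)
      have "q * measure lborel V = (\<Sum>i\<in>C'. q * (2 * snd i))"
        unfolding mV sum_distrib_left using mB by (intro sum.cong) auto
      also have "\<dots> \<le> (\<Sum>i\<in>C'. LINT x:?B i|lborel. f x)"
      proof (rule sum_mono)
        fix i assume "i \<in> C'"
        then show "q * (2 * snd i) \<le> (LINT x:?B i|lborel. f x)"
          using set_borel_integral_eq_integral(2)[OF si[of i]] KD(3)[of i] by simp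
      qed
      also have "\<dots> = (LINT x:V|lborel. f x)"
        unfolding V_def using C' dj si by (subst set_integral_finite_Union) auto
      also have "\<dots> \<le> (LINT x|lborel. p * indicator V x + indicator (U - A) x * \<bar>f x\<bar>
                         + \<bar>p\<bar> * indicator (U - A) x)"
        unfolding set_lebesgue_integral_def
      proof (rule integral_mono)
        show "integrable lborel (\<lambda>x. indicat_real V x *\<^sub>R f x)"
          using f by (intro integrable_mult_indicator) auto
        show "integrable lborel (\<lambda>x. p * indicator V x + indicator (U - A) x * \<bar>f x\<bar>
                         + \<bar>p\<bar> * indicator (U - A) x)"
          using f Vfin UAfin integrable_mult_indicator[of "U - A" lborel "\<lambda>x. \<bar>f x\<bar>"] by auto
        show "indicat_real V x *\<^sub>R f x \<le> p * indicator V x + indicator (U - A) x * \<bar>f x\<bar>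
                         + \<bar>p\<bar> * indicator (U - A) x" for x
          using VU by (auto simp: indicator_def A_def)
      qed
      also have "\<dots> = p * measure lborel V + (LINT x:(U - A)|lborel. \<bar>f x\<bar>) + \<bar>p\<bar> * measure lborel (U - A)"
        using f Vfin UAfin integrable_mult_indicator[of "U - A" lborel "\<lambda>x. \<bar>f x\<bar>"]
        by (simp add: set_lebesgue_integral_def)
      also have "\<dots> \<le> p * measure lborel V + e" using U1 U2 by simp
      finally have "(q - p) * measure lborel V \<le> e" by (simp add: algebra_simps)
      then have "measure lborel V \<le> e0" using pq by (simp add: e_def mult.commute)
      then show ?thesis unfolding V_def[symmetric] by simp
    qed
    define W where "W = (\<Union>i\<in>C. ?B i)"
    have W: "W \<in> lmeasurable" "measure lebesgue W \<le> e0"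
      unfolding W_def
      using fmeasurable_UN_bound[of C ?B lebesgue e0] measure_UN_bound[of C ?B lebesgue e0]
      C(1) Bm fin_bd by auto
    define Z where "Z = ?E \<inter> cbox l r - W"
    have Z: "negligible Z" using C(4) by (simp add: Z_def W_def)
    have ZL: "Z \<in> lmeasurable" "measure lebesgue Z = 0"
      using Z by (auto simp: negligible_imp_measurable negligible_imp_measure0)
    have "measure lebesgue (W \<union> Z) \<le> e0"
      using measure_Un_le[OF fmeasurableD[OF W(1)] fmeasurableD[OF ZL(1)]] W(2) ZL(2) by linarith
    moreover have "?E \<inter> cbox l r \<subseteq> W \<union> Z" unfolding Z_def by blast
    ultimately show "\<exists>T. ?E \<inter> cbox l r \<subseteq> T \<and> T \<in> lmeasurable \<and> measure lebesgue T \<le> e0"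
      using fmeasurable.Un[OF W(1) ZL(1)] by blast
  qed
qed

lemma AE_average_upper:
  fixes f :: "real \<Rightarrow> real"
  assumes f: "integrable lborel f"
  shows "AE t in lborel. \<forall>e>0. \<exists>d>0. \<forall>u v. u \<le> t \<longrightarrow> t \<le> v \<longrightarrow> v - u < d \<longrightarrow>
           integral {u..v} f \<le> (f t + e) * (v - u)"
proof -
  define E where "E p q = {t. f t < p \<and> (\<forall>d>0. \<exists>u v. u \<le> t \<and> t \<le> v \<and> 0 < v - u \<and> v - u < d \<and>
                          q * (v - u) < integral {u..v} f)}" for p q
  have "AE t in lebesgue. \<forall>p\<in>\<rat>. \<forall>q\<in>\<rat>. p < q \<longrightarrow> t \<notin> E p q"
  proof (intro AE_ball_countable' countable_rat)
    fix p q :: real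
    show "AE t in lebesgue. p < q \<longrightarrow> t \<notin> E p q"
    proof (cases "p < q")
      case True
      then have "E p q \<in> null_sets lebesgue"
        using negligible_large_averages[OF f True] unfolding E_def by (simp add: negligible_iff_null_sets)
      then show ?thesis using True by (auto intro: AE_not_in)
    qed auto
  qed
  then have "AE t in lborel. \<forall>p\<in>\<rat>. \<forall>q\<in>\<rat>. p < q \<longrightarrow> t \<notin> E p q"
    by (simp add: AE_completion_iff)
  then show ?thesis
  proof (rule AE_mp, intro AE_I2 impI allI)
    fix t e :: real assume H: "\<forall>p\<in>\<rat>. \<forall>q\<in>\<rat>. p < q \<longrightarrow> t \<notin> E p q" and e: "e > 0"
    obtain p where p: "p \<in> \<rat>" "f t < p" "p < f t + e" using Rats_dense_in_real[of "f t" "f t + e"] e by auto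
    obtain q where q: "q \<in> \<rat>" "p < q" "q < f t + e" using Rats_dense_in_real[of p "f t + e"] p by auto
    have "t \<notin> E p q" using H p q by auto
    then obtain d where d: "d > 0" "\<And>u v. u \<le> t \<Longrightarrow> t \<le> v \<Longrightarrow> 0 < v - u \<Longrightarrow> v - u < d \<Longrightarrow>
                          integral {u..v} f \<le> q * (v - u)"
      unfolding E_def using p(2) by (auto simp: not_less) (meson not_less)
    show "\<exists>d>0. \<forall>u v. u \<le> t \<longrightarrow> t \<le> v \<longrightarrow> v - u < d \<longrightarrow> integral {u..v} f \<le> (f t + e) * (v - u)"
    proof (intro exI[of _ d] conjI allI impI d(1))
      fix u v assume uv: "u \<le> t" "t \<le> v" "v - u < d"
      show "integral {u..v} f \<le> (f t + e) * (v - u)"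
      proof (cases "u = v")
        case False
        with uv have "integral {u..v} f \<le> q * (v - u)" by (intro d(2)) auto
        also have "\<dots> \<le> (f t + e) * (v - u)" using uv q by (intro mult_right_mono) auto
        finally show ?thesis .
      qed auto
    qed
  qed
qed

text \<open>
  The intervals need not be centred at \<open>t\<close>; this strong form gives two-sided derivatives of the
  primitive and allows windows that start at \<open>t\<close>.
\<close>

definition Lebesgue_point :: "(real \<Rightarrow> real) \<Rightarrow> real \<Rightarrow> bool" where
  "Lebesgue_point f t \<longleftrightarrow> (\<forall>e>0. \<exists>d>0. \<forall>u v. u \<le> t \<longrightarrow> t \<le> v \<longrightarrow> v - u < d \<longrightarrow>
           \<bar>integral {u..v} f - f t * (v - u)\<bar> \<le> e * (v - u))"

theorem Lebesgue_differentiation: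
  fixes f :: "real \<Rightarrow> real"
  assumes f: "integrable lborel f"
  shows "AE t in lborel. Lebesgue_point f t"
proof -
  have m: "integrable lborel (\<lambda>t. - f t)" using f by simp
  show ?thesis
    using AE_average_upper[OF f] AE_average_upper[OF m]
  proof eventually_elim
    case (elim t)
    show ?case
      unfolding Lebesgue_point_def
    proof (intro allI impI)
      fix e :: real assume "e > 0"
      obtain d1 where d1: "d1 > 0"
        "\<And>u v. u \<le> t \<Longrightarrow> t \<le> v \<Longrightarrow> v - u < d1 \<Longrightarrow> integral {u..v} f \<le> (f t + e) * (v - u)"
        using elim(1) \<open>e > 0\<close> by blast
      obtain d2 where d2: "d2 > 0"
        "\<And>u v. u \<le> t \<Longrightarrow> t \<le> v \<Longrightarrow> v - u < d2 \<Longrightarrow> integral {u..v} (\<lambda>t. - f t) \<le> (- f t + e) * (v - u)"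
        using elim(2) \<open>e > 0\<close> by blast
      show "\<exists>d>0. \<forall>u v. u \<le> t \<longrightarrow> t \<le> v \<longrightarrow> v - u < d \<longrightarrow>
           \<bar>integral {u..v} f - f t * (v - u)\<bar> \<le> e * (v - u)"
      proof (intro exI[of _ "min d1 d2"] conjI allI impI)
        fix u v assume "u \<le> t" "t \<le> v" "v - u < min d1 d2"
        then show "\<bar>integral {u..v} f - f t * (v - u)\<bar> \<le> e * (v - u)"
          using d1(2)[of u v] d2(2)[of u v] by (simp add: algebra_simps abs_le_iff)
      qed (use d1 d2 in auto)
    qed
  qed
qed

lemma Lebesgue_point_window:
  assumes "Lebesgue_point f t" "e > 0"
  shows "\<forall>\<^sub>F \<kappa> in at_right 0. \<bar>integral {t..t + \<kappa>} f - f t * \<kappa>\<bar> \<le> e * \<kappa>"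
proof -
  obtain d where d: "d > 0" "\<And>u v. u \<le> t \<Longrightarrow> t \<le> v \<Longrightarrow> v - u < d \<Longrightarrow>
           \<bar>integral {u..v} f - f t * (v - u)\<bar> \<le> e * (v - u)"
    using assms unfolding Lebesgue_point_def by blast
  show ?thesis
    unfolding eventually_at_right_field
  proof (intro exI[of _ d] conjI allI impI d(1))
    fix y assume "0 < y" "y < d"
    then show "\<bar>integral {t..t + y} f - f t * y\<bar> \<le> e * y" using d(2)[of t "t + y"] by simp
  qed
qed

lemma increments_integral_imp_derivative_AE:
  fixes F f :: "real \<Rightarrow> real"
  assumes f: "integrable lborel f" and F: "\<And>a b. a \<le> b \<Longrightarrow> F b - F a = integral {a..b} f"
  shows "AE t in lborel. (F has_real_derivative f t) (at t)"
  using Lebesgue_differentiation[OF f]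
proof eventually_elim
  case (elim t)
  show ?case
    unfolding has_field_derivative_def has_derivative_at_alt
  proof (intro conjI allI impI bounded_linear_mult_right)
    fix e :: real assume "e > 0"
    then obtain d where d: "d > 0"
      "\<And>u v. u \<le> t \<Longrightarrow> t \<le> v \<Longrightarrow> v - u < d \<Longrightarrow> \<bar>integral {u..v} f - f t * (v - u)\<bar> \<le> e * (v - u)"
      using elim unfolding Lebesgue_point_def by blast
    show "\<exists>d>0. \<forall>y. norm (y - t) < d \<longrightarrow> norm (F y - F t - f t * (y - t)) \<le> e * norm (y - t)"
    proof (intro exI[of _ d] conjI allI impI d(1))
      fix y assume y: "norm (y - t) < d"
      show "norm (F y - F t - f t * (y - t)) \<le> e * norm (y - t)"
      proof (cases "t \<le> y")
        case True
        then show ?thesis using d(2)[of t y] F[of t y] y by simp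
      next
        case False
        then have "\<bar>(F t - F y) - f t * (t - y)\<bar> \<le> e * (t - y)" using d(2)[of y t] F[of y t] y by simp
        moreover have "F y - F t - f t * (y - t) = - ((F t - F y) - f t * (t - y))"
          by (simp add: algebra_simps)
        ultimately show ?thesis using False by (simp only: real_norm_def abs_minus_cancel) simp
      qed
    qed
  qed
qed

section \<open>Paths with integrably dominated increments\<close>

lemma upper_derivative_bound:
  fixes F f :: "real \<Rightarrow> real"
  assumes F: "(F has_real_derivative v) (at t)" and "t < q"
    and inc: "\<And>u. t \<le> u \<Longrightarrow> u \<le> q \<Longrightarrow> F u - F t \<le> integral {t..u} f"
    and leb: "Lebesgue_point f t"
  shows "v \<le> f t"
proof (rule ccontr)
  assume "\<not> v \<le> f t"
  define e where "e = (v - f t) / 3"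
  have e: "e > 0" using \<open>\<not> v \<le> f t\<close> by (simp add: e_def)
  obtain d1 where d1: "d1 > 0" "\<And>y. norm (y - t) < d1 \<Longrightarrow> norm (F y - F t - v * (y - t)) \<le> e * norm (y - t)"
    using F e unfolding has_field_derivative_def has_derivative_at_alt by blast
  obtain d2 where d2: "d2 > 0" "\<And>u w. u \<le> t \<Longrightarrow> t \<le> w \<Longrightarrow> w - u < d2 \<Longrightarrow>
           \<bar>integral {u..w} f - f t * (w - u)\<bar> \<le> e * (w - u)"
    using leb e unfolding Lebesgue_point_def by blast
  define h where "h = min (min d1 d2 / 2) (q - t)"
  have h: "h > 0" "h < d1" "h < d2" "t + h \<le> q" using d1 d2 \<open>t < q\<close> by (auto simp: h_def)
  have "F (t + h) - F t \<ge> v * h - e * h" using d1(2)[of "t + h"] h by (auto simp: abs_le_iff)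
  moreover have "F (t + h) - F t \<le> integral {t..t + h} f" using h by (intro inc) auto
  moreover have "integral {t..t + h} f \<le> f t * h + e * h" using d2(2)[of t "t + h"] h by (auto simp: abs_le_iff)
  ultimately have "v * h - e * h \<le> f t * h + e * h" by linarith
  then have "(v - f t - 2 * e) * h \<le> 0" by (simp add: algebra_simps)
  moreover have "(v - f t - 2 * e) * h > 0" using e h by (intro mult_pos_pos) (auto simp: e_def)
  ultimately show False by linarith
qed

lemma continuous_of_dominated_increments:
  fixes \<gamma> :: "real \<Rightarrow> 'b::real_normed_vector" and m :: "real \<Rightarrow> real"
  assumes m: "integrable lborel m" and
    dom: "\<And>a b. a \<le> b \<Longrightarrow> norm (\<gamma> b - \<gamma> a) \<le> integral {a..b} m"
  shows "continuous_on UNIV \<gamma>"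
  unfolding continuous_on_eq_continuous_at[OF open_UNIV]
proof
  fix t
  let ?I = "\<lambda>x. integral {t - 1..x} m"
  have "continuous_on {t - 1..t + 1} ?I"
    using indefinite_integral_continuous_1[OF integrable_on_Icc[OF m]] .
  then have "isCont ?I t" by (rule continuous_on_interior) (auto simp: interior_atLeastAtMost_real)
  then have lim: "((\<lambda>x. \<bar>?I x - ?I t\<bar>) \<longlongrightarrow> 0) (at t)"
    unfolding isCont_def by (metis LIM_zero tendsto_rabs_zero)
  have "((\<lambda>x. \<gamma> x - \<gamma> t) \<longlongrightarrow> 0) (at t)"
  proof (rule Lim_null_comparison[OF _ lim])
    have "\<forall>\<^sub>F x in at t. x > t - 1" by (rule order_tendstoD(1)[OF tendsto_ident_at]) simp
    then show "\<forall>\<^sub>F x in at t. norm (\<gamma> x - \<gamma> t) \<le> \<bar>?I x - ?I t\<bar>"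
    proof eventually_elim
      case (elim x)
      show ?case
      proof (cases "x \<le> t")
        case True
        have "?I x + integral {x..t} m = ?I t"
          using elim True by (intro Henstock_Kurzweil_Integration.integral_combine integrable_on_Icc[OF m]) auto
        then show ?thesis using dom[OF True] by (simp add: norm_minus_commute)
      next
        case False
        have "?I t + integral {t..x} m = ?I x"
          using elim False by (intro Henstock_Kurzweil_Integration.integral_combine integrable_on_Icc[OF m]) auto
        then show ?thesis using dom[of t x] False by simp
      qed
    qed
  qed
  then show "isCont \<gamma> t" unfolding isCont_def by (simp add: LIM_zero_iff)
qed

lemma integral_eq_primitive_diff:
  fixes f :: "real \<Rightarrow> real"
  assumes f: "integrable lborel f" and pq: "p \<le> q"
  shows "integral {p..q} f = (LINT x:{..q}|lborel. f x) - (LINT x:{..p}|lborel. f x)"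
proof -
  have si: "set_integrable lborel S f" if "S \<in> sets borel" for S
    unfolding set_integrable_def using f that by (intro integrable_mult_indicator) auto
  have "(LINT x:{..q}|lborel. f x) = (LINT x:({..p} \<union> {p<..q})|lborel. f x)"
    using pq by (simp add: ivl_disj_un)
  also have "\<dots> = (LINT x:{..p}|lborel. f x) + (LINT x:{p<..q}|lborel. f x)"
    by (intro set_integral_Un si) auto
  also have "(LINT x:{p<..q}|lborel. f x) = (LINT x:{p..q}|lborel. f x)"
    by (rule set_integral_discrete_difference[where X="{p}"]) auto
  finally show ?thesis using LINT_Icc_eq_integral[OF f] by simp
qed

lemma continuous_primitive:
  fixes f :: "real \<Rightarrow> real"
  assumes f: "integrable lborel f"
  shows "continuous_on UNIV (\<lambda>t. LINT x:{..t}|lborel. f x)"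
proof (rule continuous_of_dominated_increments[where m = "\<lambda>x. \<bar>f x\<bar>"])
  show "integrable lborel (\<lambda>x. \<bar>f x\<bar>)" using f by simp
  show "norm ((LINT x:{..q}|lborel. f x) - (LINT x:{..p}|lborel. f x)) \<le> integral {p..q} (\<lambda>x. \<bar>f x\<bar>)"
    if "p \<le> q" for p q
    unfolding integral_eq_primitive_diff[OF f that, symmetric]
    by (rule integral_norm_bound_integral) (use f in \<open>auto intro!: integrable_on_Icc\<close>)
qed

lemma window_integral_continuous:
  fixes f :: "real \<Rightarrow> real"
  assumes f: "integrable lborel f" and \<kappa>: "0 \<le> \<kappa>"
  shows "continuous_on UNIV (\<lambda>t. integral {t..t + \<kappa>} f)"
proof -
  let ?F = "\<lambda>t. LINT x:{..t}|lborel. f x"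
  have "continuous_on UNIV (\<lambda>t. ?F (t + \<kappa>) - ?F t)"
    by (intro continuous_intros continuous_primitive f continuous_on_compose2[OF continuous_primitive[OF f]]) auto
  then show ?thesis using integral_eq_primitive_diff[OF f] \<kappa> by simp
qed

text \<open>
  With \<open>M\<close> a primitive of \<open>m\<close>, both \<open>M + g\<close> and \<open>M - g\<close> are nondecreasing and continuous. Their
  Stieltjes measures add up to the measure with density \<open>2 m\<close>, so that of \<open>M + g\<close> is absolutely continuous.
  By Radon-Nikodym \<open>M + g\<close> is the primitive of an integrable function, and primitives are differentiable almost
  everywhere.
\<close>

lemma differentiable_AE_of_dominated_increments_real:
  fixes g m :: "real \<Rightarrow> real"
  assumes m: "integrable lborel m" and
    dom: "\<And>a b. a \<le> b \<Longrightarrow> \<bar>g b - g a\<bar> \<le> integral {a..b} m"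
  shows "AE t in lborel. \<exists>v. (g has_real_derivative v) (at t)"
proof -
  define M where "M t = (LINT x:{..t}|lborel. m x)" for t
  have mset: "set_integrable lborel A m" if "A \<in> sets borel" for A
    unfolding set_integrable_def using m that by (intro integrable_mult_indicator) auto
  have Minc: "M b - M a = integral {a..b} m" if "a \<le> b" for a b
    unfolding M_def using integral_eq_primitive_diff[OF m that] by simp
  have Mnn: "0 \<le> integral {a..b} m" if "a \<le> b" for a b using dom[OF that] by linarith
  define F1 where "F1 t = M t + g t" for t
  define F2 where "F2 t = M t - g t" for t
  have F1m: "F1 a \<le> F1 b" and F2m: "F2 a \<le> F2 b" if "a \<le> b" for a b
    using dom[OF that] Minc[OF that] by (auto simp: F1_def F2_def)
  have cM: "continuous_on UNIV M"
    unfolding M_def by (rule continuous_primitive[OF m])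
  have cg: "continuous_on UNIV g"
    by (rule continuous_of_dominated_increments[OF m]) (use dom in auto)
  have "continuous_on UNIV F1" "continuous_on UNIV F2"
    unfolding F1_def F2_def by (intro continuous_intros cM cg)+
  then have F1c: "continuous (at_right a) F1" and F2c: "continuous (at_right a) F2" for a
    by (auto simp: continuous_on_eq_continuous_at continuous_at_imp_continuous_within)
  define n1 where "n1 = interval_measure F1"
  define n2 where "n2 = interval_measure F2"
  (* The sum of the two Stieltjes measures is identified with a density on half-open intervals. *)
  define n where "n = measure_of UNIV (sets borel) (\<lambda>A. emeasure n1 A + emeasure n2 A)"
  have sn: "sets n1 = sets borel" "sets n2 = sets borel" by (auto simp: n1_def n2_def)
  have setsn: "sets n = sets borel" unfolding n_def
    by (metis sets.sets_measure_of_eq space_borel)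
  have emn: "emeasure n A = emeasure n1 A + emeasure n2 A" if "A \<in> sets borel" for A
  proof (rule emeasure_measure_of[OF n_def])
    show "positive (sets n) (\<lambda>A. emeasure n1 A + emeasure n2 A)" by (auto simp: positive_def)
    show "countably_additive (sets n) (\<lambda>A. emeasure n1 A + emeasure n2 A)"
      unfolding countably_additive_def setsn
      using sn by (auto simp: suminf_add[symmetric] suminf_emeasure)
  qed (use that setsn in auto)
  define h where "h t = ennreal (2 * m t)" for t
  have hm[measurable]: "h \<in> borel_measurable borel" unfolding h_def using m by measurable
  (* Only the integrals of m over intervals are known to be nonnegative. *)
  have mAE: "AE t in lborel. 0 \<le> m t"
    using Lebesgue_differentiation[OF m]
  proof eventually_elim
    case (elim t)
    show ?case
    proof (rule ccontr)
      assume "\<not> 0 \<le> m t"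
      then obtain d where d: "d > 0" "\<And>u v. u \<le> t \<Longrightarrow> t \<le> v \<Longrightarrow> v - u < d \<Longrightarrow>
          \<bar>integral {u..v} m - m t * (v - u)\<bar> \<le> (- m t / 2) * (v - u)"
        using elim[unfolded Lebesgue_point_def, rule_format, of "- m t / 2"] by auto
      have "integral {t..t + d/2} m < 0"
        using d(2)[of t "t + d/2"] d(1) \<open>\<not> 0 \<le> m t\<close> mult_neg_pos[of "m t" d] by (auto simp: abs_le_iff)
      then show False using Mnn[of t "t + d/2"] d(1) by simp
    qed
  qed
  have emh: "emeasure (density lborel h) {a<..b} = ennreal (2 * integral {a..b} m)" if "a \<le> b" for a b
  proof -
    have "emeasure (density lborel h) {a<..b} = (\<integral>\<^sup>+x. ennreal (indicator {a<..b} x * (2 * m x)) \<partial>lborel)"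
      by (auto simp: emeasure_density h_def indicator_def intro!: nn_integral_cong)
    also have "\<dots> = ennreal (LINT x|lborel. indicator {a<..b} x * (2 * m x))"
      using mset[of "{a<..b}"] mAE unfolding set_integrable_def
      by (intro nn_integral_eq_integral) (auto simp: indicator_def mult.left_commute intro!: AE_mp[OF mAE AE_I2])
    also have "(LINT x|lborel. indicator {a<..b} x * (2 * m x)) = 2 * (LINT x:{a<..b}|lborel. m x)"
      unfolding set_lebesgue_integral_def by (simp add: mult.left_commute)
    also have "(LINT x:{a<..b}|lborel. m x) = (LINT x:{a..b}|lborel. m x)"
      by (rule set_integral_discrete_difference[where X="{a}"]) auto
    finally show ?thesis using LINT_Icc_eq_integral[OF m] by simp
  qed
  have n_eq: "n = density lborel h"
  proof (rule measure_eqI_generator_eq[where \<Omega>=UNIV and E="range (\<lambda>(a, b). {a<..b::real})"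
        and A="\<lambda>i. {- real i<..real i}"])
    show "Int_stable (range (\<lambda>(a, b). {a<..b::real}))"
      by (auto simp: Int_stable_def Int_greaterThanAtMost)
    show "sets n = sigma_sets UNIV (range (\<lambda>(a, b). {a<..b::real}))"
      unfolding setsn borel_sigma_sets_Ioc by simp
    show "sets (density lborel h) = sigma_sets UNIV (range (\<lambda>(a, b). {a<..b::real}))"
      unfolding sets_density sets_lborel borel_sigma_sets_Ioc by simp
    show "emeasure n X = emeasure (density lborel h) X" if XE: "X \<in> range (\<lambda>(a, b). {a<..b::real})" for X
    proof -
      obtain r where "X = (case r of (a, b) \<Rightarrow> {a<..b})" using XE by (rule rangeE)
      then obtain a b where X: "X = {a<..b}" by (cases r) simp
      show ?thesis
      proof (cases "a \<le> b")
        case True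
        have "emeasure n X = ennreal (F1 b - F1 a) + ennreal (F2 b - F2 a)"
          unfolding X n1_def n2_def
          by (subst emn) (auto simp: n1_def n2_def emeasure_interval_measure_Ioc True F1m F2m F1c F2c)
        also have "\<dots> = ennreal (2 * (M b - M a))"
          using F1m[OF True] F2m[OF True] by (subst ennreal_plus[symmetric]) (auto simp: F1_def F2_def)
        finally show ?thesis unfolding X emh[OF True] Minc[OF True] .
      qed (simp add: X)
    qed
    show "(\<Union>i. {- real i<..real i}) = UNIV"
    proof (safe; simp)
      fix x :: real
      obtain i where "\<bar>x\<bar> < real i" using reals_Archimedean2 by blast
      then show "\<exists>i. - real i < x \<and> x \<le> real i" by (intro exI[of _ i]) auto
    qed
    show "emeasure n {- real i<..real i} \<noteq> \<infinity>" for i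
      by (subst emn) (auto simp: n1_def n2_def emeasure_interval_measure_Ioc F1m F2m F1c F2c)
  qed auto
  have le: "emeasure n1 A \<le> emeasure (density lborel h) A" if "A \<in> sets borel" for A
    unfolding n_eq[symmetric] emn[OF that] by (simp add: le_iff_add)
  have ac: "absolutely_continuous lborel n1"
    unfolding absolutely_continuous_def
  proof
    fix N :: "real set" assume N: "N \<in> null_sets lborel"
    then have "N \<in> null_sets (density lborel h)" by (auto simp: null_sets_density_iff AE_not_in AE_I2 intro: AE_mp[OF AE_not_in])
    then have "emeasure n1 N = 0" using le[of N] N by (auto simp: null_sets_def)
    then show "N \<in> null_sets n1" using N sn by (auto simp: null_sets_def)
  qed
  obtain f where f[measurable]: "f \<in> borel_measurable lborel" and fn: "density lborel f = n1"
    using sigma_finite_measure.Radon_Nikodym[OF sigma_finite_lborel ac] sn by auto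
  have "(\<integral>\<^sup>+x. f x \<partial>lborel) = emeasure n1 UNIV"
    unfolding fn[symmetric] by (simp add: emeasure_density)
  also have "\<dots> \<le> emeasure (density lborel h) UNIV" by (rule le) simp
  also have "\<dots> = (\<integral>\<^sup>+x. ennreal (2 * m x) \<partial>lborel)" by (simp add: emeasure_density h_def)
  also have "\<dots> < \<infinity>"
    using m mAE by (subst nn_integral_eq_integral) auto
  finally have ffin: "(\<integral>\<^sup>+x. f x \<partial>lborel) < \<infinity>" .
  then have fAE: "AE x in lborel. f x = ennreal (enn2real (f x))"
    using nn_integral_noteq_infinite[OF f] by (auto simp: less_top top.not_eq_extremum)
  have fi: "integrable lborel (\<lambda>x. enn2real (f x))"
    using ffin fAE by (intro integrableI_nonneg) (auto simp: nn_integral_cong_AE[OF fAE, symmetric])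
  have F1i: "F1 b - F1 a = integral {a..b} (\<lambda>x. enn2real (f x))" if "a \<le> b" for a b
  proof -
    have si: "integrable lborel (\<lambda>x. indicat_real {a<..b} x *\<^sub>R enn2real (f x))"
      using fi by (intro integrable_mult_indicator) auto
    have "ennreal (F1 b - F1 a) = emeasure n1 {a<..b}"
      by (simp add: n1_def emeasure_interval_measure_Ioc that F1m F1c)
    also have "\<dots> = (\<integral>\<^sup>+x. f x * indicator {a<..b} x \<partial>lborel)"
      unfolding fn[symmetric] by (simp add: emeasure_density)
    also have "\<dots> = (\<integral>\<^sup>+x. ennreal (indicator {a<..b} x *\<^sub>R enn2real (f x)) \<partial>lborel)"
      by (intro nn_integral_cong_AE AE_mp[OF fAE AE_I2]) (auto simp: indicator_def)
    also have "\<dots> = ennreal (LINT x:{a<..b}|lborel. enn2real (f x))"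
      unfolding set_lebesgue_integral_def using si by (intro nn_integral_eq_integral) auto
    also have "(LINT x:{a<..b}|lborel. enn2real (f x)) = (LINT x:{a..b}|lborel. enn2real (f x))"
      by (rule set_integral_discrete_difference[where X="{a}"]) auto
    also have "\<dots> = integral {a..b} (\<lambda>x. enn2real (f x))"
      using LINT_Icc_eq_integral[OF fi] .
    finally show ?thesis
      using F1m[OF that] integral_nonneg[OF integrable_on_Icc[OF fi], of a b]
      by (subst (asm) ennreal_inj) auto
  qed
  have D1: "AE t in lborel. (F1 has_real_derivative enn2real (f t)) (at t)"
    by (rule increments_integral_imp_derivative_AE[OF fi]) (rule F1i)
  have D2: "AE t in lborel. (M has_real_derivative m t) (at t)"
    by (rule increments_integral_imp_derivative_AE[OF m]) (rule Minc)
  show ?thesis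
    using D1 D2
  proof eventually_elim
    case (elim t)
    have "((\<lambda>t. F1 t - M t) has_real_derivative enn2real (f t) - m t) (at t)"
      by (intro derivative_intros elim)
    then show ?case by (auto simp: F1_def)
  qed
qed

lemma differentiable_AE_of_dominated_increments:
  fixes \<gamma> :: "real \<Rightarrow> 'a::euclidean_space" and m :: "real \<Rightarrow> real"
  assumes m: "integrable lborel m" and
    dom: "\<And>a b. a \<le> b \<Longrightarrow> norm (\<gamma> b - \<gamma> a) \<le> integral {a..b} m"
  shows "AE t in lborel. \<exists>v. (\<gamma> has_vector_derivative v) (at t)"
proof -
  have "AE t in lborel. \<exists>v. ((\<lambda>t. \<gamma> t \<bullet> i) has_real_derivative v) (at t)" if "i \<in> Basis" for i
  proof (rule differentiable_AE_of_dominated_increments_real[OF m])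
    fix a b :: real assume "a \<le> b"
    have "\<bar>\<gamma> b \<bullet> i - \<gamma> a \<bullet> i\<bar> \<le> norm (\<gamma> b - \<gamma> a)"
      using Basis_le_norm[OF that, of "\<gamma> b - \<gamma> a"] by (simp add: inner_diff_left)
    then show "\<bar>\<gamma> b \<bullet> i - \<gamma> a \<bullet> i\<bar> \<le> integral {a..b} m" using dom[OF \<open>a \<le> b\<close>] by simp
  qed
  then have "AE t in lborel. \<forall>i\<in>Basis. \<exists>v. ((\<lambda>t. \<gamma> t \<bullet> i) has_real_derivative v) (at t)"
    by (intro AE_finite_allI) auto
  then show ?thesis
  proof eventually_elim
    case (elim t)
    then obtain v where v: "\<And>i. i \<in> Basis \<Longrightarrow> ((\<lambda>t. \<gamma> t \<bullet> i) has_real_derivative v i) (at t)"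
      by metis
    have "((\<lambda>t. \<Sum>i\<in>Basis. (\<gamma> t \<bullet> i) *\<^sub>R i) has_vector_derivative (\<Sum>i\<in>Basis. v i *\<^sub>R i)) (at t)"
      by (rule has_vector_derivative_sum)
        (auto intro!: derivative_eq_intros v simp: has_real_derivative_iff_has_vector_derivative[symmetric])
    then show ?case by (auto simp: euclidean_representation)
  qed
qed

lemma abs_continuous_of_dominated_increments:
  fixes \<gamma> :: "real \<Rightarrow> 'a::real_normed_vector" and m :: "real \<Rightarrow> real"
  assumes m: "integrable lborel m" and
    dom: "\<And>a b. a \<le> b \<Longrightarrow> norm (\<gamma> b - \<gamma> a) \<le> integral {a..b} m"
  shows "abs_continuous_on_interval p q \<gamma>"
  unfolding abs_continuous_on_interval_def
proof (intro allI impI)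
  fix e :: real assume "e > 0"
  obtain d where d: "d > 0"
      "\<And>B. B \<in> sets lborel \<Longrightarrow> emeasure lborel B \<le> ennreal d \<Longrightarrow> (LINT x:B|lborel. \<bar>m x\<bar>) < e"
    using integral_small_on_small_sets[OF m \<open>e > 0\<close>] by auto
  show "\<exists>\<delta>>0. \<forall>D. D division_of \<Union>D \<longrightarrow> \<Union>D \<subseteq> {p..q} \<longrightarrow> (\<Sum>k\<in>D. Sup k - Inf k) < \<delta> \<longrightarrow>
        (\<Sum>k\<in>D. norm (\<gamma> (Sup k) - \<gamma> (Inf k))) < e"
  proof (intro exI[of _ d] conjI allI impI d(1))
    fix D :: "real set set" assume D: "D division_of \<Union>D" and s: "(\<Sum>k\<in>D. Sup k - Inf k) < d"
    have fD: "finite D" using D by auto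
    have k: "\<exists>a b. a \<le> b \<and> k = {a..b}" if "k \<in> D" for k
      using division_ofD(3,4)[OF D that] by fastforce
    have [measurable]: "\<Union>D \<in> sets borel"
    proof (intro sets.finite_Union fD subsetI)
      fix S assume "S \<in> D"
      then show "S \<in> sets borel" using k[of S] by auto
    qed
    have sm: "set_integrable lborel (\<Union>D) (\<lambda>x. \<bar>m x\<bar>)"
      unfolding set_integrable_def using m by (intro integrable_mult_indicator) auto
    have "emeasure lborel (\<Union>D) \<le> (\<Sum>k\<in>D. emeasure lborel k)"
      using emeasure_subadditive_finite[OF fD, of "\<lambda>k. k" lborel] k by fastforce
    also have "\<dots> = (\<Sum>k\<in>D. ennreal (Sup k - Inf k))"
    proof (rule sum.cong)
      fix S assume "S \<in> D"
      then show "emeasure lborel S = ennreal (Sup S - Inf S)" using k[of S] by auto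
    qed simp
    also have "\<dots> = ennreal (\<Sum>k\<in>D. Sup k - Inf k)" using k by (intro sum_ennreal) fastforce
    also have "\<dots> \<le> ennreal d" using s by (intro ennreal_leI) simp
    finally have small: "(LINT x:(\<Union>D)|lborel. \<bar>m x\<bar>) < e" by (intro d(2)) auto
    have "(\<Sum>k\<in>D. norm (\<gamma> (Sup k) - \<gamma> (Inf k))) \<le> (\<Sum>k\<in>D. integral k (\<lambda>x. \<bar>m x\<bar>))"
    proof (rule sum_mono)
      fix S assume "S \<in> D"
      then obtain a b where S: "a \<le> b" "S = {a..b}" using k by blast
      have "norm (\<gamma> b - \<gamma> a) \<le> integral {a..b} m" by (rule dom[OF S(1)])
      also have "\<dots> \<le> integral {a..b} (\<lambda>x. \<bar>m x\<bar>)"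
        using integrable_on_Icc[of m] integrable_on_Icc[of "\<lambda>x. \<bar>m x\<bar>"] m
        by (intro integral_le) auto
      finally show "norm (\<gamma> (Sup S) - \<gamma> (Inf S)) \<le> integral S (\<lambda>x. \<bar>m x\<bar>)" using S by simp
    qed
    also have "\<dots> = integral (\<Union>D) (\<lambda>x. \<bar>m x\<bar>)"
      using set_borel_integral_eq_integral(1)[OF sm] D by (intro integral_combine_division_topdown[symmetric]) auto
    also have "\<dots> < e" using small set_borel_integral_eq_integral(2)[OF sm] by simp
    finally show "(\<Sum>k\<in>D. norm (\<gamma> (Sup k) - \<gamma> (Inf k))) < e" .
  qed
qed

section \<open>Essential suprema of the velocity field\<close>

definition ess_le :: "'a::euclidean_space set \<Rightarrow> ('a \<Rightarrow> real) \<Rightarrow> real \<Rightarrow> bool" where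
  "ess_le S f a \<longleftrightarrow> (AE y in lborel. y \<in> S \<longrightarrow> f y \<le> a)"

text \<open>
  Only used for functions that are bounded on a set of positive measure, where the infimum is over a
  nonempty set that is bounded below.
\<close>

definition ess_sup :: "'a::euclidean_space set \<Rightarrow> ('a \<Rightarrow> real) \<Rightarrow> real" where
  "ess_sup S f = Inf {a. ess_le S f a}"

lemma ess_le_mono: "ess_le S f a \<Longrightarrow> a \<le> a' \<Longrightarrow> ess_le S f a'"
  unfolding ess_le_def by (auto elim!: eventually_mono)

lemma not_AE_notin:
  assumes "S \<in> sets borel" "emeasure lborel S \<noteq> 0"
  shows "\<not> (AE y in lborel. y \<notin> S)"
proof
  assume "AE y in lborel. y \<notin> S"
  then have "emeasure lborel {y \<in> space lborel. \<not> y \<notin> S} = 0"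
    using assms(1) by (intro AE_E2) auto
  then show False using assms(2) by simp
qed

lemma ess_sup_le_iff:
  assumes S: "S \<in> sets borel" "emeasure lborel S \<noteq> 0" and B: "\<And>y. y \<in> S \<Longrightarrow> \<bar>f y\<bar> \<le> B"
  shows "ess_sup S f \<le> a \<longleftrightarrow> ess_le S f a"
proof -
  have ne: "B \<in> {a. ess_le S f a}" using B unfolding ess_le_def by (auto simp: abs_le_iff)
  have low: "- B \<le> a" if "ess_le S f a" for a
  proof (rule ccontr)
    assume "\<not> - B \<le> a"
    then have "AE y in lborel. y \<notin> S"
      using that B unfolding ess_le_def by (auto elim!: eventually_mono simp: abs_le_iff) force
    then show False using not_AE_notin[OF S] by blast
  qed
  have bdd: "bdd_below {a. ess_le S f a}" using low by (intro bdd_belowI[of _ "- B"]) auto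
  show ?thesis
  proof
    assume "ess_sup S f \<le> a"
    have "ess_le S f (a + 1 / real (Suc n))" for n
    proof -
      have "Inf {a. ess_le S f a} < a + 1 / real (Suc n)"
        using \<open>ess_sup S f \<le> a\<close> unfolding ess_sup_def by (rule le_less_trans) simp
      then obtain a' where "ess_le S f a'" "a' < a + 1 / real (Suc n)"
        using cInf_lessD[of "{a. ess_le S f a}"] ne by blast
      then show ?thesis by (auto intro: ess_le_mono)
    qed
    then have "AE y in lborel. \<forall>n. y \<in> S \<longrightarrow> f y \<le> a + 1 / real (Suc n)"
      unfolding ess_le_def AE_all_countable by blast
    then show "ess_le S f a"
      unfolding ess_le_def
    proof eventually_elim
      case (elim y)
      show ?case
      proof
        assume "y \<in> S"
        have "(\<lambda>n. a + 1 / real (Suc n)) \<longlonglongrightarrow> a + 0"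
          using LIMSEQ_inverse_real_of_nat by (intro tendsto_intros) (simp add: inverse_eq_divide)
        then show "f y \<le> a"
          using elim \<open>y \<in> S\<close> by (intro LIMSEQ_le_const[of _ a]) auto
      qed
    qed
  next
    assume "ess_le S f a"
    then show "ess_sup S f \<le> a" unfolding ess_sup_def using bdd by (intro cInf_lower) auto
  qed
qed

text \<open>
  The bound \<open>|y - x| \<le> (2 + |x|) (E - 1)\<close> is a Gronwall estimate in integrated form: it
  composes along a path, with the factors \<open>E\<close> being multiplied. It implies \<open>2 + |y| \<le> (2 + |x|) E\<close>.
\<close>

lemma growth_compose:
  fixes x y z :: "'b::real_normed_vector"
  assumes 1: "norm (y - x) \<le> (2 + norm x) * (E1 - 1)" and 2: "norm (z - y) \<le> (2 + norm y) * (E2 - 1)"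
    and E: "1 \<le> E2"
  shows "norm (z - x) \<le> (2 + norm x) * (E1 * E2 - 1)"
proof -
  have "norm y \<le> norm x + (2 + norm x) * (E1 - 1)"
    using 1 norm_triangle_sub[of y x] by linarith
  then have "2 + norm y \<le> (2 + norm x) * E1" by (simp add: algebra_simps)
  then have "(2 + norm y) * (E2 - 1) \<le> (2 + norm x) * E1 * (E2 - 1)"
    using E by (intro mult_right_mono) auto
  moreover have "norm (z - x) \<le> norm (z - y) + norm (y - x)"
    using norm_triangle_ineq[of "z - y" "y - x"] by simp
  ultimately have "norm (z - x) \<le> (2 + norm x) * E1 * (E2 - 1) + (2 + norm x) * (E1 - 1)"
    using 1 2 by linarith
  also have "\<dots> = (2 + norm x) * (E1 * E2 - 1)" by (simp add: algebra_simps)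
  finally show ?thesis .
qed

definition mesh :: "nat \<Rightarrow> real" where
  "mesh n = 1 / real (Suc n)"

lemma mesh_pos: "mesh n > 0"
  by (simp add: mesh_def)

lemma mesh_less:
  assumes "\<delta> > 0"
  obtains n where "mesh n < \<delta>"
  using reals_Archimedean[OF assms] by (auto simp: mesh_def inverse_eq_divide)

lemma mesh_tendsto: "mesh \<longlonglongrightarrow> 0"
  unfolding mesh_def using LIMSEQ_inverse_real_of_nat by (simp add: inverse_eq_divide)

text \<open>
  The assumption \<open>thick\<close> makes essential suprema over small balls finite. The set \<open>D\<close> consists of the
  directions in which paths are tested; it is countable, so that the exceptional null sets of times
  belonging to single directions can be united.
\<close>

locale viability_problem =
  fixes T :: real and \<Omega> :: "'a::euclidean_space set" and b :: "real \<Rightarrow> 'a \<Rightarrow> 'a" and c :: "real \<Rightarrow> real"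
    and D :: "'a set"
  assumes closed: "closed \<Omega>"
    and b_measurable: "(\<lambda>p. b (fst p) (snd p)) \<in> borel_measurable (borel \<Otimes>\<^sub>M borel)"
    and c_integrable: "integrable lborel c"
    and c_nonneg: "\<And>t. 0 \<le> c t"
    and growth: "\<And>t y. norm (b t y) \<le> c t * (1 + norm y)"
    and thick: "\<And>x \<delta>. x \<in> \<Omega> \<Longrightarrow> \<delta> > 0 \<Longrightarrow> emeasure lborel (ball x \<delta> \<inter> \<Omega>) \<noteq> 0"
    and D: "countable D" "D \<subseteq> sphere 0 1" "sphere 0 1 \<subseteq> closure D"
begin

text \<open>
  The real-valued counterpart of \<^const>\<open>filippov_h_delta\<close>; see \<open>filippov_h_delta_eq_H\<close> below.
\<close>

definition H :: "real \<Rightarrow> real \<Rightarrow> 'a \<Rightarrow> 'a \<Rightarrow> real" where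
  "H \<delta> t x \<xi> = ess_sup (ball x \<delta> \<inter> \<Omega>) (\<lambda>y. \<xi> \<bullet> b t y)"

lemma ball_borel: "ball x \<delta> \<inter> \<Omega> \<in> sets borel"
  using closed by auto

lemma norm_b_on_ball:
  assumes "y \<in> ball x \<delta> \<inter> \<Omega>"
  shows "norm (b t y) \<le> c t * (1 + norm x + \<delta>)"
proof -
  have "norm y \<le> norm x + \<delta>"
    using assms norm_triangle_sub[of y x] by (auto simp: dist_norm norm_minus_commute)
  then show ?thesis
    using growth[of t y] mult_left_mono[OF _ c_nonneg[of t], of "1 + norm y" "1 + norm x + \<delta>"] by linarith
qed

lemma b_bound_on_ball:
  assumes "y \<in> ball x \<delta> \<inter> \<Omega>"
  shows "\<bar>\<xi> \<bullet> b t y\<bar> \<le> norm \<xi> * (c t * (1 + norm x + \<delta>))"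
  using Cauchy_Schwarz_ineq2[of \<xi> "b t y"] mult_left_mono[OF norm_b_on_ball[OF assms] norm_ge_zero[of \<xi>]]
  by (meson order_trans)

lemma H_le_iff:
  assumes "x \<in> \<Omega>" "\<delta> > 0"
  shows "H \<delta> t x \<xi> \<le> a \<longleftrightarrow> ess_le (ball x \<delta> \<inter> \<Omega>) (\<lambda>y. \<xi> \<bullet> b t y) a"
  unfolding H_def
proof (rule ess_sup_le_iff[where B = "norm \<xi> * (c t * (1 + norm x + \<delta>))"])
  show "ball x \<delta> \<inter> \<Omega> \<in> sets borel" by (rule ball_borel)
  show "emeasure lborel (ball x \<delta> \<inter> \<Omega>) \<noteq> 0" by (rule thick[OF assms])
qed (rule b_bound_on_ball)

lemma H_ess_le:
  assumes "x \<in> \<Omega>" "\<delta> > 0"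
  shows "AE y in lborel. y \<in> ball x \<delta> \<inter> \<Omega> \<longrightarrow> \<xi> \<bullet> b t y \<le> H \<delta> t x \<xi>"
  using H_le_iff[OF assms, of t \<xi> "H \<delta> t x \<xi>"] unfolding ess_le_def by blast

text \<open>
  This is the source of upper semicontinuity in \<open>x\<close>: enlarging the radius absorbs a
  displacement of the centre.
\<close>

lemma H_mono:
  assumes "x \<in> \<Omega>" "z \<in> \<Omega>" "\<delta>' > 0" "\<delta> > 0" "dist z x + \<delta>' \<le> \<delta>"
  shows "H \<delta>' t z \<xi> \<le> H \<delta> t x \<xi>"
proof -
  have "ball z \<delta>' \<subseteq> ball x \<delta>"
  proof
    fix y assume "y \<in> ball z \<delta>'"
    then show "y \<in> ball x \<delta>" using assms(5) dist_triangle[of x y z] by (simp add: dist_commute)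
  qed
  then show ?thesis
    using H_ess_le[OF assms(1,4), of \<xi> t] unfolding H_le_iff[OF assms(2,3)] ess_le_def
    by (auto elim!: eventually_mono)
qed

lemma H_abs_le:
  assumes "x \<in> \<Omega>" "\<delta> > 0"
  shows "\<bar>H \<delta> t x \<xi>\<bar> \<le> norm \<xi> * (c t * (1 + norm x + \<delta>))"
proof -
  let ?B = "norm \<xi> * (c t * (1 + norm x + \<delta>))"
  have "H \<delta> t x \<xi> \<le> ?B"
    unfolding H_le_iff[OF assms] ess_le_def using b_bound_on_ball[of _ x \<delta> \<xi> t] by (auto simp: abs_le_iff)
  moreover have "- ?B \<le> H \<delta> t x \<xi>"
  proof (rule ccontr)
    assume less: "\<not> - ?B \<le> H \<delta> t x \<xi>"
    have "AE y in lborel. y \<notin> ball x \<delta> \<inter> \<Omega>"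
      using H_ess_le[OF assms, of \<xi> t]
    proof eventually_elim
      case (elim y) then show ?case using b_bound_on_ball[of y x \<delta> \<xi> t] less by linarith
    qed
    then show False using not_AE_notin[OF ball_borel thick[OF assms]] by blast
  qed
  ultimately show ?thesis by (simp add: abs_le_iff)
qed

lemma H_Lipschitz:
  assumes "x \<in> \<Omega>" "\<delta> > 0"
  shows "H \<delta> t x \<xi>' \<le> H \<delta> t x \<xi> + norm (\<xi>' - \<xi>) * (c t * (1 + norm x + \<delta>))"
  unfolding H_le_iff[OF assms] ess_le_def using H_ess_le[OF assms, of \<xi> t]
proof eventually_elim
  case (elim y)
  then show ?case using b_bound_on_ball[of y x \<delta> "\<xi>' - \<xi>" t] by (auto simp: inner_diff_left abs_le_iff)
qed

text \<open>
  A bound \<open>H \<le> a\<close> says that a section of a measurable subset of the product is null, and the measure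
  of a section depends measurably on the base point.
\<close>

lemma H_measurable:
  assumes [measurable]: "\<gamma> \<in> borel_measurable borel" and \<gamma>: "\<And>t. \<gamma> t \<in> \<Omega>" and \<delta>: "\<delta> > 0"
  shows "(\<lambda>t. H \<delta> t (\<gamma> t) \<xi>) \<in> borel_measurable borel"
  unfolding borel_measurable_iff_le
proof
  fix a
  define S where "S = {p \<in> space (borel \<Otimes>\<^sub>M borel :: (real \<times> 'a) measure).
      dist (\<gamma> (fst p)) (snd p) < \<delta> \<and> snd p \<in> \<Omega> \<and> a < \<xi> \<bullet> b (fst p) (snd p)}"
  have [measurable]: "\<Omega> \<in> sets borel" using closed by auto
  note b_measurable[measurable]
  have S: "S \<in> sets (borel \<Otimes>\<^sub>M lborel)"
    unfolding S_def by measurable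
  have m: "(\<lambda>t. emeasure lborel (Pair t -` S)) \<in> borel_measurable borel"
    by (rule lborel.measurable_emeasure_Pair[OF S])
  have eq: "H \<delta> t (\<gamma> t) \<xi> \<le> a \<longleftrightarrow> emeasure lborel (Pair t -` S) = 0" for t
  proof -
    have Sm: "Pair t -` S \<in> sets lborel" using S by (rule sets_Pair1)
    have "H \<delta> t (\<gamma> t) \<xi> \<le> a \<longleftrightarrow> (AE y in lborel. y \<notin> Pair t -` S)"
      unfolding H_le_iff[OF \<gamma> \<delta>] ess_le_def
      by (intro AE_cong) (auto simp: S_def space_pair_measure)
    also have "\<dots> \<longleftrightarrow> emeasure lborel (Pair t -` S) = 0"
      using Sm by (intro AE_iff_measurable) auto
    finally show ?thesis .
  qed
  show "{t \<in> space borel. H \<delta> t (\<gamma> t) \<xi> \<le> a} \<in> sets borel"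
    unfolding eq using m by measurable
qed

lemma H_integrable:
  assumes "\<gamma> \<in> borel_measurable borel" "\<And>t. \<gamma> t \<in> \<Omega>" "\<delta> > 0" "\<And>t. norm (\<gamma> t) \<le> R"
  shows "integrable lborel (\<lambda>t. H \<delta> t (\<gamma> t) \<xi>)"
proof (rule Bochner_Integration.integrable_bound)
  show "integrable lborel (\<lambda>t. norm \<xi> * (c t * (1 + R + \<delta>)))" using c_integrable by simp
  show "(\<lambda>t. H \<delta> t (\<gamma> t) \<xi>) \<in> borel_measurable lborel" using H_measurable[OF assms(1-3)] by simp
  show "AE t in lborel. norm (H \<delta> t (\<gamma> t) \<xi>) \<le> norm (norm \<xi> * (c t * (1 + R + \<delta>)))"
  proof (intro AE_I2)
    fix t
    have R: "0 \<le> R" using assms(4)[of t] norm_ge_zero by (rule order_trans[rotated])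
    have "norm (H \<delta> t (\<gamma> t) \<xi>) \<le> norm \<xi> * (c t * (1 + norm (\<gamma> t) + \<delta>))" using H_abs_le[OF assms(2,3)] by simp
    also have "\<dots> \<le> norm \<xi> * (c t * (1 + R + \<delta>))"
      using assms(4)[of t] c_nonneg by (intro mult_left_mono) auto
    finally show "norm (H \<delta> t (\<gamma> t) \<xi>) \<le> norm (norm \<xi> * (c t * (1 + R + \<delta>)))" by simp
  qed
qed

lemma H_const_integrable:
  assumes "x \<in> \<Omega>" "\<delta> > 0" shows "integrable lborel (\<lambda>\<tau>. H \<delta> \<tau> x \<xi>)"
  by (rule H_integrable[where \<gamma> = "\<lambda>_. x" and R = "norm x"]) (use assms in auto)

section \<open>Approximate solutions and their compactness\<close>

text \<open>
  The clock of the growth estimate: \<open>exp (A q - A p)\<close> bounds the factor by which \<open>2 + |\<gamma>|\<close> can grow from time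
  \<open>p\<close> to time \<open>q\<close>. The summand \<open>t\<close> leaves room for the errors of the Euler scheme.
\<close>

definition A :: "real \<Rightarrow> real" where
  "A t = t + (LINT \<tau>:{..t}|lborel. c \<tau>)"

lemma A_diff:
  assumes "p \<le> q"
  shows "A q - A p = integral {p..q} (\<lambda>t. c t + 1)"
  using assms integral_eq_primitive_diff[OF c_integrable assms]
    integral_add[OF integrable_on_Icc[OF c_integrable, of p q], of "\<lambda>_. 1"]
  by (simp add: A_def integrable_const_ivl)

lemma c1_integrable_on: "(\<lambda>t. c t + 1) integrable_on {p..q}"
  by (intro Henstock_Kurzweil_Integration.integrable_add integrable_on_Icc[OF c_integrable]) auto

lemma A_mono: "p \<le> q \<Longrightarrow> A p \<le> A q"
  using A_diff[of p q] integral_nonneg[OF c1_integrable_on, of p q] c_nonneg by (simp add: add_nonneg_nonneg)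

lemma A_continuous: "continuous_on UNIV A"
  unfolding A_def by (intro continuous_intros continuous_primitive c_integrable)

text \<open>
  Paths are constant outside \<open>[s, T]\<close>, so that all of them live on the real line and the growth bound
  holds for all pairs of times. They may jump: the error \<open>e\<close> sits inside the exponential and does not vanish with \<open>q - p\<close>.
\<close>

definition approx :: "real \<Rightarrow> real \<Rightarrow> 'a set \<Rightarrow> real \<Rightarrow> 'a \<Rightarrow> (real \<Rightarrow> 'a) set" where
  "approx e \<delta> \<Xi> s x = {\<gamma>. \<gamma> \<in> borel_measurable borel \<and> (\<forall>t\<le>s. \<gamma> t = x) \<and> (\<forall>t\<ge>T. \<gamma> t = \<gamma> T) \<and> (\<forall>t. \<gamma> t \<in> \<Omega>) \<and>
     (\<forall>p q. p \<le> q \<longrightarrow> norm (\<gamma> q - \<gamma> p) \<le> (2 + norm (\<gamma> p)) * (exp (A q - A p + e) - 1)) \<and>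
     (\<forall>\<xi>\<in>\<Xi>. \<forall>p q. s \<le> p \<longrightarrow> p \<le> q \<longrightarrow> q \<le> T \<longrightarrow>
        \<xi> \<bullet> (\<gamma> q - \<gamma> p) \<le> integral {p..q} (\<lambda>t. H \<delta> t (\<gamma> t) \<xi>) + e)}"

definition sol :: "real \<Rightarrow> 'a \<Rightarrow> (real \<Rightarrow> 'a) set" where
  "sol s x = (\<Inter>\<delta>\<in>{0<..}. approx 0 \<delta> D s x)"

lemma approxD:
  assumes "\<gamma> \<in> approx e \<delta> \<Xi> s x"
  shows "\<gamma> \<in> borel_measurable borel" "\<And>t. t \<le> s \<Longrightarrow> \<gamma> t = x" "\<And>t. T \<le> t \<Longrightarrow> \<gamma> t = \<gamma> T" "\<And>t. \<gamma> t \<in> \<Omega>"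
    "\<And>p q. p \<le> q \<Longrightarrow> norm (\<gamma> q - \<gamma> p) \<le> (2 + norm (\<gamma> p)) * (exp (A q - A p + e) - 1)"
    "\<And>\<xi> p q. \<xi> \<in> \<Xi> \<Longrightarrow> s \<le> p \<Longrightarrow> p \<le> q \<Longrightarrow> q \<le> T \<Longrightarrow>
        \<xi> \<bullet> (\<gamma> q - \<gamma> p) \<le> integral {p..q} (\<lambda>t. H \<delta> t (\<gamma> t) \<xi>) + e"
  using assms unfolding approx_def by blast+

lemma approx_bounded:
  assumes \<gamma>: "\<gamma> \<in> approx e \<delta> \<Xi> s x" and "s \<le> T" "norm x \<le> X" "e \<le> E"
  shows "norm (\<gamma> t) \<le> X + (2 + X) * (exp (A T - A s + E) - 1)"
proof -
  define t' where "t' = max s (min t T)"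
  have X: "0 \<le> X" using assms(3) norm_ge_zero order_trans by blast
  have t': "s \<le> t'" "t' \<le> T" using assms(2) by (auto simp: t'_def)
  have eq: "\<gamma> t = \<gamma> t'"
  proof -
    show ?thesis using assms(2) approxD(2)[OF \<gamma>, of t] approxD(2)[OF \<gamma>, of s] approxD(3)[OF \<gamma>, of t]
      unfolding t'_def by (auto simp: max_def min_def)
  qed
  have sx: "\<gamma> s = x" using approxD(2)[OF \<gamma>] by simp
  have "norm (\<gamma> t' - \<gamma> s) \<le> (2 + norm (\<gamma> s)) * (exp (A t' - A s + e) - 1)"
    by (rule approxD(5)[OF \<gamma> t'(1)])
  also have "\<dots> \<le> (2 + norm (\<gamma> s)) * (exp (A T - A s + E) - 1)"
    using A_mono[OF t'(2)] assms(4) by (intro mult_left_mono) auto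
  finally have *: "norm (\<gamma> t' - \<gamma> s) \<le> (2 + norm x) * (exp (A T - A s + E) - 1)" unfolding sx .
  have "0 \<le> (2 + norm x) * (exp (A T - A s + E) - 1)" using * norm_ge_zero order_trans by blast
  then have "0 \<le> exp (A T - A s + E) - 1" using norm_ge_zero[of x] unfolding zero_le_mult_iff by linarith
  then have "(2 + norm x) * (exp (A T - A s + E) - 1) \<le> (2 + X) * (exp (A T - A s + E) - 1)"
    using assms(3) by (intro mult_right_mono) auto
  then show ?thesis using * norm_triangle_sub[of "\<gamma> t'" x] assms(3) unfolding eq sx by linarith
qed

text \<open>
  The growth bound makes the paths almost equicontinuous, so a subsequence that converges at rational
  times converges everywhere. For the integral inequality the integrand along the sequence is replaced by its
  maximum with the limiting integrand of a fixed radius \<open>\<delta>'\<close>. This only increases the integral, and by \<open>H_mono\<close>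
  the maximum is eventually equal to the limiting integrand; dominated convergence applies.
\<close>

lemma approx_compactness:
  fixes \<gamma> :: "nat \<Rightarrow> real \<Rightarrow> 'a"
  assumes \<gamma>: "\<And>n. \<gamma> n \<in> approx (e n) (\<delta> n) (\<Xi> n) s (x n)"
    and e: "e \<longlonglongrightarrow> 0" and d: "\<delta> \<longlonglongrightarrow> 0" "\<And>n. \<delta> n > 0"
    and \<Xi>: "\<And>\<xi>. \<xi> \<in> D \<Longrightarrow> \<forall>\<^sub>F n in sequentially. \<xi> \<in> \<Xi> n"
    and x: "x \<longlonglongrightarrow> x0" and sT: "s \<le> T"
  obtains r \<eta> where "strict_mono (r :: nat \<Rightarrow> nat)" "\<eta> \<in> sol s x0" "\<And>t. (\<lambda>n. \<gamma> (r n) t) \<longlonglongrightarrow> \<eta> t"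
proof -
  obtain X where X: "\<And>n. norm (x n) \<le> X" using convergent_imp_Bseq[OF convergentI[OF x]] by (auto simp: Bseq_def)
  obtain E where E: "\<And>n. norm (e n) \<le> E" using convergent_imp_Bseq[OF convergentI[OF e]] by (auto simp: Bseq_def)
  obtain \<Delta> where \<Delta>: "\<And>n. norm (\<delta> n) \<le> \<Delta>" using convergent_imp_Bseq[OF convergentI[OF d(1)]] by (auto simp: Bseq_def)
  define R where "R = X + (2 + X) * (exp (A T - A s + E) - 1)"
  have R: "norm (\<gamma> n t) \<le> R" for n t
    unfolding R_def using E[of n] by (intro approx_bounded[OF \<gamma> sT X]) (simp add: abs_le_iff)
  obtain r where r: "strict_mono (r :: nat \<Rightarrow> nat)" and conv_rat: "\<And>q. q \<in> \<rat> \<Longrightarrow> \<exists>l. (\<lambda>n. \<gamma> (r n) q) \<longlonglongrightarrow> l"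
    using function_convergent_subsequence[OF countable_rat, of \<gamma> R] R by blast
  define g where "g n = \<gamma> (r n)" for n
  have g: "g n \<in> approx (e (r n)) (\<delta> (r n)) (\<Xi> (r n)) s (x (r n))" for n
    unfolding g_def by (rule \<gamma>)
  have er: "(\<lambda>n. e (r n)) \<longlonglongrightarrow> 0" and dr: "(\<lambda>n. \<delta> (r n)) \<longlonglongrightarrow> 0" and xr: "(\<lambda>n. x (r n)) \<longlonglongrightarrow> x0"
    using LIMSEQ_subseq_LIMSEQ[OF e r] LIMSEQ_subseq_LIMSEQ[OF d(1) r] LIMSEQ_subseq_LIMSEQ[OF x r]
    by (simp_all add: o_def)
  have gR: "norm (g n t) \<le> R" for n t unfolding g_def by (rule R)
  have incr: "norm (g n q - g n p) \<le> (2 + R) * \<bar>exp (A q - A p + e (r n)) - 1\<bar>" if "p \<le> q" for n p q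
  proof -
    have "norm (g n q - g n p) \<le> (2 + norm (g n p)) * (exp (A q - A p + e (r n)) - 1)"
      by (rule approxD(5)[OF g that])
    also have "\<dots> \<le> (2 + norm (g n p)) * \<bar>exp (A q - A p + e (r n)) - 1\<bar>"
      by (intro mult_left_mono) auto
    also have "\<dots> \<le> (2 + R) * \<bar>exp (A q - A p + e (r n)) - 1\<bar>"
      using gR by (intro mult_right_mono) auto
    finally show ?thesis .
  qed
  have "\<exists>l. (\<lambda>n. g n t) \<longlonglongrightarrow> l" for t
  proof -
    have "Cauchy (\<lambda>n. g n t)"
    proof (rule metric_CauchyI)
      fix \<epsilon> :: real assume \<epsilon>: "\<epsilon> > 0"
      have "isCont (\<lambda>p. (2 + R) * \<bar>exp (A t - A p) - 1\<bar>) t"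
        using A_continuous by (intro continuous_intros) (auto simp: continuous_on_eq_continuous_at)
      then have "((\<lambda>p. (2 + R) * \<bar>exp (A t - A p) - 1\<bar>) \<longlongrightarrow> 0) (at t)"
        unfolding isCont_def by simp
      then have "\<forall>\<^sub>F p in at t. (2 + R) * \<bar>exp (A t - A p) - 1\<bar> < \<epsilon> / 4"
        using \<epsilon> by (intro order_tendstoD(2)) auto
      then obtain h where h: "h > 0" "\<And>p. p \<noteq> t \<Longrightarrow> dist p t < h \<Longrightarrow> (2 + R) * \<bar>exp (A t - A p) - 1\<bar> < \<epsilon> / 4"
        unfolding eventually_at by auto
      obtain q where q: "q \<in> \<rat>" "t - h < q" "q < t"
        using Rats_dense_in_real[of "t - h" t] h(1) by auto
      have small: "(2 + R) * \<bar>exp (A t - A q) - 1\<bar> < \<epsilon> / 4"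
        using q by (intro h(2)) (auto simp: dist_real_def)
      have "(\<lambda>n. (2 + R) * \<bar>exp (A t - A q + e (r n)) - 1\<bar>) \<longlonglongrightarrow> (2 + R) * \<bar>exp (A t - A q + 0) - 1\<bar>"
        by (intro tendsto_intros er)
      then have "\<forall>\<^sub>F n in sequentially. (2 + R) * \<bar>exp (A t - A q + e (r n)) - 1\<bar> < \<epsilon> / 4"
        using small by (intro order_tendstoD(2)) auto
      then obtain N1 where N1: "\<And>n. n \<ge> N1 \<Longrightarrow> (2 + R) * \<bar>exp (A t - A q + e (r n)) - 1\<bar> < \<epsilon> / 4"
        unfolding eventually_sequentially by blast
      have "Cauchy (\<lambda>n. g n q)" using conv_rat[OF q(1)] LIMSEQ_imp_Cauchy unfolding g_def by blast
      then obtain N2 where N2: "\<And>m n. m \<ge> N2 \<Longrightarrow> n \<ge> N2 \<Longrightarrow> dist (g m q) (g n q) < \<epsilon> / 4"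
        using \<epsilon> metric_CauchyD[of "\<lambda>n. g n q" "\<epsilon> / 4"] by auto
      show "\<exists>M. \<forall>m\<ge>M. \<forall>n\<ge>M. dist (g m t) (g n t) < \<epsilon>"
      proof (intro exI[of _ "max N1 N2"] allI impI)
        fix m n assume mn: "m \<ge> max N1 N2" "n \<ge> max N1 N2"
        have 1: "dist (g k t) (g k q) < \<epsilon> / 4" if "k \<ge> N1" for k
          using incr[of q t k] q N1[OF that] by (simp add: dist_norm)
        have "dist (g m t) (g n t) \<le> dist (g m t) (g m q) + dist (g m q) (g n q) + dist (g n q) (g n t)"
          by (meson add_right_mono dist_triangle order_trans)
        then show "dist (g m t) (g n t) < \<epsilon>"
          using 1[of m] 1[of n] N2[of m n] mn \<epsilon> by (simp add: dist_commute)
      qed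
    qed
    then show ?thesis by (simp add: Cauchy_convergent_iff convergent_def)
  qed
  then obtain \<eta> where \<eta>: "\<And>t. (\<lambda>n. g n t) \<longlonglongrightarrow> \<eta> t" by metis
  have \<eta>m[measurable]: "\<eta> \<in> borel_measurable borel"
    by (rule borel_measurable_LIMSEQ_metric[of g]) (use approxD(1)[OF g] \<eta> in auto)
  have \<eta>R: "norm (\<eta> t) \<le> R" for t
    by (rule LIMSEQ_le_const2[OF tendsto_norm[OF \<eta>]]) (use gR in auto)
  have \<eta>\<Omega>: "\<eta> t \<in> \<Omega>" for t
    using closed_sequentially[OF closed _ \<eta>] approxD(4)[OF g] by blast
  have "\<eta> \<in> approx 0 \<delta>' D s x0" if \<delta>': "\<delta>' > 0" for \<delta>'
    unfolding approx_def
  proof (safe)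
    show "\<eta> t = x0" if "t \<le> s" for t
      using \<eta>[of t] xr approxD(2)[OF g that] by (simp add: LIMSEQ_unique)
    show "\<eta> t = \<eta> T" if "T \<le> t" for t
      using \<eta>[of t] \<eta>[of T] approxD(3)[OF g that] by (simp add: LIMSEQ_unique)
    show "norm (\<eta> q - \<eta> p) \<le> (2 + norm (\<eta> p)) * (exp (A q - A p + 0) - 1)" if "p \<le> q" for p q
    proof (rule LIMSEQ_le)
      show "(\<lambda>n. norm (g n q - g n p)) \<longlonglongrightarrow> norm (\<eta> q - \<eta> p)" by (intro tendsto_intros \<eta>)
      show "(\<lambda>n. (2 + norm (g n p)) * (exp (A q - A p + e (r n)) - 1))
           \<longlonglongrightarrow> (2 + norm (\<eta> p)) * (exp (A q - A p + 0) - 1)" by (intro tendsto_intros \<eta> er)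
    qed (use approxD(5)[OF g that] in auto)
    fix \<xi> p q assume \<xi>: "\<xi> \<in> D" and pq: "s \<le> p" "p \<le> q" "q \<le> T"
    let ?F = "\<lambda>t. H \<delta>' t (\<eta> t) \<xi>"
    let ?f = "\<lambda>n t. H (\<delta> (r n)) t (g n t) \<xi>"
    let ?w = "\<lambda>t. norm \<xi> * (c t * (1 + R + (\<Delta> + \<delta>')))"
    have Fint: "integrable lborel ?F" by (rule H_integrable[OF \<eta>m \<eta>\<Omega> \<delta>' \<eta>R])
    have fint: "integrable lborel (?f n)" for n
      by (rule H_integrable[OF approxD(1)[OF g] approxD(4)[OF g] d(2) gR])
    have Hw: "\<bar>H \<rho> t y \<xi>\<bar> \<le> ?w t" if "y \<in> \<Omega>" "norm y \<le> R" "\<rho> > 0" "\<rho> \<le> \<Delta> + \<delta>'" for \<rho> t y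
    proof -
      have "\<bar>H \<rho> t y \<xi>\<bar> \<le> norm \<xi> * (c t * (1 + norm y + \<rho>))" by (rule H_abs_le) fact+
      also have "\<dots> \<le> ?w t" using that c_nonneg by (intro mult_left_mono) auto
      finally show ?thesis .
    qed
    have D0: "\<delta> n \<le> \<Delta>" "0 \<le> \<Delta>" for n using \<Delta>[of n] d(2)[of n] by auto
    have mint: "integrable lborel (\<lambda>t. max (?f n t) (?F t))" for n using fint Fint by auto
    have lim: "(\<lambda>n. integral {p..q} (\<lambda>t. max (?f n t) (?F t))) \<longlonglongrightarrow> integral {p..q} ?F"
    proof (rule dominated_convergence(2)[where h = ?w])
      show "(\<lambda>t. max (?f n t) (?F t)) integrable_on {p..q}" for n
        by (rule integrable_on_Icc[OF mint])
      show "?w integrable_on {p..q}"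
        by (rule integrable_on_Icc) (use c_integrable in simp)
      show "norm (max (?f n t) (?F t)) \<le> ?w t" for n t
        using Hw[of "g n t" "\<delta> (r n)" t] Hw[of "\<eta> t" \<delta>' t] approxD(4)[OF g, of n t] gR[of n t] \<eta>\<Omega>[of t] \<eta>R[of t]
          D0(1)[of "r n"] D0(2) d(2)[of "r n"] \<delta>' by (auto simp: max_def)
      show "(\<lambda>n. max (?f n t) (?F t)) \<longlonglongrightarrow> ?F t" for t
      proof (rule tendsto_eventually)
        have "(\<lambda>n. dist (g n t) (\<eta> t) + \<delta> (r n)) \<longlonglongrightarrow> dist (\<eta> t) (\<eta> t) + 0"
          by (intro tendsto_intros \<eta> dr)
        then have "\<forall>\<^sub>F n in sequentially. dist (g n t) (\<eta> t) + \<delta> (r n) < \<delta>'"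
          using \<delta>' by (intro order_tendstoD(2)) auto
        then show "\<forall>\<^sub>F n in sequentially. max (?f n t) (?F t) = ?F t"
        proof eventually_elim
          case (elim n)
          have "?f n t \<le> ?F t"
            using elim by (intro H_mono[OF \<eta>\<Omega> approxD(4)[OF g] d(2) \<delta>']) auto
          then show ?case by simp
        qed
      qed
    qed
    show "\<xi> \<bullet> (\<eta> q - \<eta> p) \<le> integral {p..q} ?F + 0"
    proof (rule tendsto_le[OF sequentially_bot])
      show "(\<lambda>n. \<xi> \<bullet> (g n q - g n p)) \<longlonglongrightarrow> \<xi> \<bullet> (\<eta> q - \<eta> p)" by (intro tendsto_intros \<eta>)
      show "(\<lambda>n. integral {p..q} (\<lambda>t. max (?f n t) (?F t)) + e (r n)) \<longlonglongrightarrow> integral {p..q} ?F + 0"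
        by (intro tendsto_add lim er)
      have "\<forall>\<^sub>F n in sequentially. \<xi> \<in> \<Xi> (r n)"
        by (rule eventually_subseq[OF r \<Xi>[OF \<xi>]])
      then show "\<forall>\<^sub>F n in sequentially. \<xi> \<bullet> (g n q - g n p) \<le> integral {p..q} (\<lambda>t. max (?f n t) (?F t)) + e (r n)"
      proof eventually_elim
        case (elim n)
        have "\<xi> \<bullet> (g n q - g n p) \<le> integral {p..q} (?f n) + e (r n)"
          by (rule approxD(6)[OF g elim pq])
        also have "integral {p..q} (?f n) \<le> integral {p..q} (\<lambda>t. max (?f n t) (?F t))"
          by (intro integral_le integrable_on_Icc fint mint) auto
        finally show ?case by simp
      qed
    qed
  qed (use \<eta>m \<eta>\<Omega> in auto)
  then have "\<eta> \<in> sol s x0" by (auto simp: sol_def)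
  then show thesis using that[OF r] \<eta> unfolding g_def by blast
qed

section \<open>Regularity, restriction and concatenation of solutions\<close>

lemma sol_approx: "\<gamma> \<in> sol s x \<Longrightarrow> \<delta> > 0 \<Longrightarrow> \<gamma> \<in> approx 0 \<delta> D s x"
  by (simp add: sol_def)

lemma solD:
  assumes "\<gamma> \<in> sol s x"
  shows "\<gamma> \<in> borel_measurable borel" "\<And>t. t \<le> s \<Longrightarrow> \<gamma> t = x" "\<And>t. T \<le> t \<Longrightarrow> \<gamma> t = \<gamma> T" "\<And>t. \<gamma> t \<in> \<Omega>"
    "\<And>p q. p \<le> q \<Longrightarrow> norm (\<gamma> q - \<gamma> p) \<le> (2 + norm (\<gamma> p)) * (exp (A q - A p) - 1)"
    "\<And>\<delta> \<xi> p q. \<delta> > 0 \<Longrightarrow> \<xi> \<in> D \<Longrightarrow> s \<le> p \<Longrightarrow> p \<le> q \<Longrightarrow> q \<le> T \<Longrightarrow>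
        \<xi> \<bullet> (\<gamma> q - \<gamma> p) \<le> integral {p..q} (\<lambda>t. H \<delta> t (\<gamma> t) \<xi>)"
proof -
  note a = approxD[OF sol_approx[OF assms zero_less_one]]
  show "\<gamma> \<in> borel_measurable borel" by (rule a(1))
  show "\<And>t. t \<le> s \<Longrightarrow> \<gamma> t = x" by (rule a(2))
  show "\<And>t. T \<le> t \<Longrightarrow> \<gamma> t = \<gamma> T" by (rule a(3))
  show "\<And>t. \<gamma> t \<in> \<Omega>" by (rule a(4))
  show "\<And>p q. p \<le> q \<Longrightarrow> norm (\<gamma> q - \<gamma> p) \<le> (2 + norm (\<gamma> p)) * (exp (A q - A p) - 1)"
    using a(5) unfolding add_0_right .
  show "\<And>\<delta> \<xi> p q. \<delta> > 0 \<Longrightarrow> \<xi> \<in> D \<Longrightarrow> s \<le> p \<Longrightarrow> p \<le> q \<Longrightarrow> q \<le> T \<Longrightarrow>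
        \<xi> \<bullet> (\<gamma> q - \<gamma> p) \<le> integral {p..q} (\<lambda>t. H \<delta> t (\<gamma> t) \<xi>)"
    using approxD(6)[OF sol_approx[OF assms]] unfolding add_0_right .
qed

lemma solI:
  assumes "\<gamma> \<in> borel_measurable borel" "\<And>t. t \<le> s \<Longrightarrow> \<gamma> t = x" "\<And>t. T \<le> t \<Longrightarrow> \<gamma> t = \<gamma> T" "\<And>t. \<gamma> t \<in> \<Omega>"
    "\<And>p q. p \<le> q \<Longrightarrow> norm (\<gamma> q - \<gamma> p) \<le> (2 + norm (\<gamma> p)) * (exp (A q - A p) - 1)"
    "\<And>\<delta> \<xi> p q. \<delta> > 0 \<Longrightarrow> \<xi> \<in> D \<Longrightarrow> s \<le> p \<Longrightarrow> p \<le> q \<Longrightarrow> q \<le> T \<Longrightarrow>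
        \<xi> \<bullet> (\<gamma> q - \<gamma> p) \<le> integral {p..q} (\<lambda>t. H \<delta> t (\<gamma> t) \<xi>)"
  shows "\<gamma> \<in> sol s x"
  unfolding sol_def
proof
  fix \<delta> :: real assume "\<delta> \<in> {0<..}"
  then show "\<gamma> \<in> approx 0 \<delta> D s x"
    unfolding approx_def add_0_right greaterThan_iff using assms by (intro CollectI conjI) blast+
qed

lemma sol_bounded:
  assumes "\<gamma> \<in> sol s x" "s \<le> T"
  obtains R where "\<And>t. norm (\<gamma> t) \<le> R"
  by (rule that[OF approx_bounded[OF sol_approx[OF assms(1) zero_less_one] assms(2) order_refl order_refl]])

lemma sol_dominated_increments:
  assumes \<gamma>: "\<gamma> \<in> sol s x" and sT: "s \<le> T"
  obtains m where "integrable lborel m" "\<And>p q. p \<le> q \<Longrightarrow> norm (\<gamma> q - \<gamma> p) \<le> integral {p..q} m"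
proof -
  obtain R where R: "\<And>t. norm (\<gamma> t) \<le> R" by (rule sol_bounded[OF \<gamma> sT]) (rule that)
  have R0: "0 \<le> R" using R[of 0] norm_ge_zero order_trans by blast
  define K where "K = (2 + R) * exp (A T - A s)"
  have K: "0 \<le> K" using R0 by (simp add: K_def)
  define m where "m t = (if t \<in> {s..T} then K * (c t + 1) else 0)" for t
  have mi: "integrable lborel m"
  proof -
    have "integrable lborel (indicat_real {s..T})"
      by (rule integrable_real_indicator) (auto simp: emeasure_lborel_Icc_eq)
    then have "integrable lborel (\<lambda>t. indicator {s..T} t *\<^sub>R (K * c t) + K * indicator {s..T} t)"
      using c_integrable by (intro Bochner_Integration.integrable_add integrable_mult_indicator) auto
    moreover have "(\<lambda>t. indicator {s..T} t *\<^sub>R (K * c t) + K * indicator {s..T} t) = m"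
      by (auto simp: m_def indicator_def fun_eq_iff algebra_simps)
    ultimately show ?thesis by simp
  qed
  have "norm (\<gamma> q - \<gamma> p) \<le> integral {p..q} m" if pq: "p \<le> q" for p q
  proof -
    have eq: "integral {p..q} m = integral {max p s..min q T} (\<lambda>t. K * (c t + 1))"
      unfolding m_def by (subst integral_restrict_Int) (auto simp: Int_atLeastAtMost Int_commute)
    have nn: "0 \<le> integral {max p s..min q T} (\<lambda>t. K * (c t + 1))"
      by (intro integral_nonneg Henstock_Kurzweil_Integration.integrable_on_mult_right c1_integrable_on)
        (use K c_nonneg in auto)
    show ?thesis
    proof (cases "q \<le> s \<or> T \<le> p")
      case True
      then have "\<gamma> q = \<gamma> p" using pq solD(2,3)[OF \<gamma>, of p] solD(2,3)[OF \<gamma>, of q] by auto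
      then show ?thesis using eq nn by simp
    next
      case False
      define p' where "p' = max p s"
      define q' where "q' = min q T"
      have pq': "p' \<le> q'" "s \<le> p'" "q' \<le> T" using False pq sT by (auto simp: p'_def q'_def)
      have p: "\<gamma> p = \<gamma> p'" using solD(2)[OF \<gamma>, of p] solD(2)[OF \<gamma>, of s] by (auto simp: p'_def max_def)
      have q: "\<gamma> q = \<gamma> q'" using solD(3)[OF \<gamma>, of q] by (auto simp: q'_def min_def)
      have A1: "0 \<le> A q' - A p'" "A q' - A p' \<le> A T - A s"
        using A_mono[OF pq'(1)] A_mono[OF pq'(2)] A_mono[OF pq'(3)] by auto
      define u where "u = A q' - A p'"
      have "exp (- u) \<ge> 1 - u" using exp_ge_add_one_self[of "- u"] by simp
      then have "exp u * (1 - u) \<le> exp u * exp (- u)" by (intro mult_left_mono) auto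
      then have "exp u - 1 \<le> u * exp u" by (simp add: exp_minus algebra_simps)
      also have "\<dots> \<le> u * exp (A T - A s)" using A1 by (intro mult_left_mono) (auto simp: u_def)
      finally have eu: "exp u - 1 \<le> u * exp (A T - A s)" .
      have "norm (\<gamma> q' - \<gamma> p') \<le> (2 + norm (\<gamma> p')) * (exp u - 1)"
        unfolding u_def by (rule solD(5)[OF \<gamma> pq'(1)])
      also have "\<dots> \<le> (2 + R) * (exp u - 1)" using R A1 by (intro mult_right_mono) (auto simp: u_def)
      also have "\<dots> \<le> (2 + R) * (u * exp (A T - A s))" using eu R0 by (intro mult_left_mono) auto
      also have "\<dots> = K * u" by (simp add: K_def)
      also have "\<dots> = integral {p'..q'} (\<lambda>t. K * (c t + 1))" by (simp add: u_def A_diff[OF pq'(1)])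
      finally show ?thesis using eq p q by (simp add: p'_def q'_def)
    qed
  qed
  then show thesis using that mi by blast
qed

lemma sol_continuous:
  assumes "\<gamma> \<in> sol s x" "s \<le> T"
  shows "continuous_on UNIV \<gamma>"
  by (rule sol_dominated_increments[OF assms]) (rule continuous_of_dominated_increments)

lemma sol_abs_continuous:
  assumes "\<gamma> \<in> sol s x" "s \<le> T"
  shows "abs_continuous_on_interval p q \<gamma>"
  by (rule sol_dominated_increments[OF assms]) (rule abs_continuous_of_dominated_increments)

text \<open>
  Outside a null set of times the path is differentiable and the countably many integrands have a Lebesgue
  point, which gives the inequality for directions in \<open>D\<close>. Density of \<open>D\<close> and the Lipschitz dependence of \<open>H\<close> on the
  direction extend it to all unit vectors.
\<close>

lemma sol_derivative:
  assumes \<gamma>: "\<gamma> \<in> sol s x" and sT: "s \<le> T"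
  shows "AE t in lborel. s < t \<and> t < T \<longrightarrow>
    (\<exists>v. (\<gamma> has_vector_derivative v) (at t) \<and> (\<forall>\<delta>>0. \<forall>\<xi>\<in>sphere 0 1. \<xi> \<bullet> v \<le> H \<delta> t (\<gamma> t) \<xi>))"
proof -
  obtain m where m: "integrable lborel m" "\<And>p q. p \<le> q \<Longrightarrow> norm (\<gamma> q - \<gamma> p) \<le> integral {p..q} m"
    by (rule sol_dominated_increments[OF \<gamma> sT]) (rule that)
  obtain R where R: "\<And>t. norm (\<gamma> t) \<le> R" by (rule sol_bounded[OF \<gamma> sT]) (rule that)
  define f where "f n \<xi> t = H (mesh n) t (\<gamma> t) \<xi>" for n \<xi> t
  have fi: "integrable lborel (f n \<xi>)" for n \<xi>
    unfolding f_def by (rule H_integrable[OF solD(1,4)[OF \<gamma>] mesh_pos R])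
  have AE1: "AE t in lborel. \<forall>n. \<forall>\<xi>\<in>D. Lebesgue_point (f n \<xi>) t"
    unfolding AE_all_countable
    by (intro allI AE_ball_countable' D(1) Lebesgue_differentiation fi)
  have AE2: "AE t in lborel. \<exists>v. (\<gamma> has_vector_derivative v) (at t)"
    by (rule differentiable_AE_of_dominated_increments[OF m])
  show ?thesis
    using AE1 AE2
  proof eventually_elim
    case (elim t)
    show ?case
    proof
      assume t: "s < t \<and> t < T"
      obtain v where v: "(\<gamma> has_vector_derivative v) (at t)" using elim(2) by blast
      have inD: "\<xi> \<bullet> v \<le> f n \<xi> t" if \<xi>: "\<xi> \<in> D" for \<xi> n
      proof (rule upper_derivative_bound[where F = "\<lambda>u. \<xi> \<bullet> \<gamma> u" and q = T and f = "f n \<xi>" and t = t])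
        show "((\<lambda>u. \<xi> \<bullet> \<gamma> u) has_real_derivative \<xi> \<bullet> v) (at t)"
          using v unfolding has_real_derivative_iff_has_vector_derivative has_vector_derivative_def
          by (auto intro!: derivative_eq_intros simp: fun_eq_iff)
        show "\<xi> \<bullet> \<gamma> u - \<xi> \<bullet> \<gamma> t \<le> integral {t..u} (f n \<xi>)" if "t \<le> u" "u \<le> T" for u
          using solD(6)[OF \<gamma> mesh_pos \<xi>, of t u n] that t unfolding f_def[abs_def] by (simp add: inner_diff_right)
      qed (use t elim(1) \<xi> in auto)
      have "\<xi> \<bullet> v \<le> H \<delta> t (\<gamma> t) \<xi>" if \<delta>: "\<delta> > 0" and \<xi>: "\<xi> \<in> sphere 0 1" for \<delta> \<xi>
      proof (rule field_le_epsilon)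
        fix e :: real assume e: "e > 0"
        obtain n where n: "mesh n < \<delta>" by (rule mesh_less[OF \<delta>])
        define B where "B = c t * (1 + norm (\<gamma> t) + \<delta>) + norm v"
        have B: "0 \<le> B" using c_nonneg \<delta> by (auto simp: B_def)
        have "\<xi> \<in> closure D" using \<xi> D(3) by auto
        then obtain \<xi>' where \<xi>': "\<xi>' \<in> D" "dist \<xi>' \<xi> < e / (B + 1)"
          using e B by (metis add_nonneg_pos closure_approachable divide_pos_pos zero_less_one)
        have n1: "norm (\<xi>' - \<xi>) * B \<le> e"
        proof -
          have "norm (\<xi>' - \<xi>) * B \<le> (e / (B + 1)) * B" using \<xi>' B by (intro mult_right_mono) (auto simp: dist_norm)
          also have "\<dots> \<le> e" using e B by (simp add: field_simps)
          finally show ?thesis .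
        qed
        have "\<xi> \<bullet> v = \<xi>' \<bullet> v - (\<xi>' - \<xi>) \<bullet> v" by (simp add: inner_diff_left)
        also have "\<dots> \<le> H (mesh n) t (\<gamma> t) \<xi>' + norm (\<xi>' - \<xi>) * norm v"
          using inD[OF \<xi>'(1), of n] Cauchy_Schwarz_ineq2[of "\<xi>' - \<xi>" v] by (auto simp: f_def abs_le_iff)
        also have "H (mesh n) t (\<gamma> t) \<xi>' \<le> H \<delta> t (\<gamma> t) \<xi>'"
          using n by (intro H_mono solD(4)[OF \<gamma>] mesh_pos \<delta>) auto
        also have "H \<delta> t (\<gamma> t) \<xi>' \<le> H \<delta> t (\<gamma> t) \<xi> + norm (\<xi>' - \<xi>) * (c t * (1 + norm (\<gamma> t) + \<delta>))"
          by (rule H_Lipschitz[OF solD(4)[OF \<gamma>] \<delta>])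
        finally show "\<xi> \<bullet> v \<le> H \<delta> t (\<gamma> t) \<xi> + e" using n1 by (simp add: B_def algebra_simps)
      qed
      then show "\<exists>v. (\<gamma> has_vector_derivative v) (at t) \<and> (\<forall>\<delta>>0. \<forall>\<xi>\<in>sphere 0 1. \<xi> \<bullet> v \<le> H \<delta> t (\<gamma> t) \<xi>)"
        using v by blast
    qed
  qed
qed

lemma sol_restrict:
  assumes \<gamma>: "\<gamma> \<in> sol r x" and rs: "r \<le> s" "s \<le> T"
  shows "(\<lambda>t. \<gamma> (max t s)) \<in> sol s (\<gamma> s)"
proof (rule solI)
  show "(\<lambda>t. \<gamma> (max t s)) \<in> borel_measurable borel"
    using solD(1)[OF \<gamma>] by measurable
  show "\<gamma> (max t s) = \<gamma> (max T s)" if "T \<le> t" for t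
  proof -
    have "max t s = t" "max T s = T" using that rs by auto
    then show ?thesis using solD(3)[OF \<gamma> that] by simp
  qed
  show "norm (\<gamma> (max q s) - \<gamma> (max p s)) \<le> (2 + norm (\<gamma> (max p s))) * (exp (A q - A p) - 1)" if "p \<le> q" for p q
  proof -
    have "norm (\<gamma> (max q s) - \<gamma> (max p s)) \<le> (2 + norm (\<gamma> (max p s))) * (exp (A (max q s) - A (max p s)) - 1)"
      using that by (intro solD(5)[OF \<gamma>]) auto
    also have "\<dots> \<le> (2 + norm (\<gamma> (max p s))) * (exp (A q - A p) - 1)"
      using that A_mono[of p q] A_mono[of p s] A_mono[of s q] by (intro mult_left_mono) (auto simp: max_def)
    finally show ?thesis .
  qed
  fix \<delta> p q :: real and \<xi> :: 'a assume *: "0 < \<delta>" "\<xi> \<in> D" "s \<le> p" "p \<le> q" "q \<le> T"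
  have "integral {p..q} (\<lambda>t. H \<delta> t (\<gamma> (max t s)) \<xi>) = integral {p..q} (\<lambda>t. H \<delta> t (\<gamma> t) \<xi>)"
    using * by (intro integral_cong) (simp add: max_absorb1)
  then show "\<xi> \<bullet> (\<gamma> (max q s) - \<gamma> (max p s)) \<le> integral {p..q} (\<lambda>t. H \<delta> t (\<gamma> (max t s)) \<xi>)"
    using solD(6)[OF \<gamma> *(1,2), of p q] * rs by (simp add: max_absorb1)
qed (use solD[OF \<gamma>] in \<open>auto simp: max_def\<close>)

lemma sol_concat:
  assumes \<gamma>: "\<gamma> \<in> sol r x" and \<eta>: "\<eta> \<in> sol s (\<gamma> s)" and rs: "r \<le> s" "s \<le> T"
  shows "(\<lambda>t. if t \<le> s then \<gamma> t else \<eta> t) \<in> sol r x" (is "?\<zeta> \<in> _")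
proof (rule solI)
  have [measurable]: "\<gamma> \<in> borel_measurable borel" "\<eta> \<in> borel_measurable borel" using solD(1) \<gamma> \<eta> by auto
  show "?\<zeta> \<in> borel_measurable borel" by simp
  have \<eta>s: "\<eta> s = \<gamma> s" using solD(2)[OF \<eta>] by simp
  have \<zeta>\<eta>: "?\<zeta> t = \<eta> t" if "s \<le> t" for t using that \<eta>s by (cases "t = s") auto
  show "?\<zeta> t = ?\<zeta> T" if "T \<le> t" for t
    using \<zeta>\<eta>[of t] \<zeta>\<eta>[of T] that rs solD(3)[OF \<eta>, of t] by simp
  show "norm (?\<zeta> q - ?\<zeta> p) \<le> (2 + norm (?\<zeta> p)) * (exp (A q - A p) - 1)" if pq: "p \<le> q" for p q
  proof (cases "q \<le> s \<or> s \<le> p")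
    case True
    then show ?thesis
    proof
      assume "q \<le> s" then show ?thesis using solD(5)[OF \<gamma> pq] pq by simp
    next
      assume "s \<le> p" then show ?thesis using solD(5)[OF \<eta> pq] pq \<zeta>\<eta>[of p] \<zeta>\<eta>[of q] by simp
    qed
  next
    case False
    define E1 where "E1 = exp (A s - A p)"
    define E2 where "E2 = exp (A q - A s)"
    have E: "E1 \<ge> 1" "1 \<le> E2" "exp (A q - A p) = E1 * E2"
      using A_mono[of p s] A_mono[of s q] False by (auto simp: E1_def E2_def exp_add[symmetric])
    have 1: "norm (\<gamma> s - \<gamma> p) \<le> (2 + norm (\<gamma> p)) * (E1 - 1)"
      unfolding E1_def using False by (intro solD(5)[OF \<gamma>]) auto
    have 2: "norm (\<eta> q - \<eta> s) \<le> (2 + norm (\<eta> s)) * (E2 - 1)"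
      unfolding E2_def using False by (intro solD(5)[OF \<eta>]) auto
    have "norm (\<eta> q - \<gamma> p) \<le> (2 + norm (\<gamma> p)) * (E1 * E2 - 1)"
      using 1 2 E(2) unfolding \<eta>s by (rule growth_compose)
    then show ?thesis using False E by simp
  qed
  fix \<delta> p q :: real and \<xi> :: 'a assume *: "0 < \<delta>" "\<xi> \<in> D" "r \<le> p" "p \<le> q" "q \<le> T"
  let ?f = "\<lambda>t. H \<delta> t (?\<zeta> t) \<xi>"
  have left: "\<xi> \<bullet> (?\<zeta> v - ?\<zeta> u) \<le> integral {u..v} ?f" if "r \<le> u" "u \<le> v" "v \<le> s" for u v
  proof -
    have "integral {u..v} ?f = integral {u..v} (\<lambda>t. H \<delta> t (\<gamma> t) \<xi>)" using that by (intro integral_cong) auto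
    then show ?thesis using solD(6)[OF \<gamma> *(1,2), of u v] that rs by simp
  qed
  have right: "\<xi> \<bullet> (?\<zeta> v - ?\<zeta> u) \<le> integral {u..v} ?f" if "s \<le> u" "u \<le> v" "v \<le> T" for u v
  proof -
    have "integral {u..v} ?f = integral {u..v} (\<lambda>t. H \<delta> t (\<eta> t) \<xi>)"
    proof (rule integral_cong)
      fix t assume "t \<in> {u..v}"
      then have "?\<zeta> t = \<eta> t" using that by (intro \<zeta>\<eta>) auto
      then show "?f t = H \<delta> t (\<eta> t) \<xi>" by simp
    qed
    then show ?thesis using solD(6)[OF \<eta> *(1,2), of u v] that \<zeta>\<eta>[of u] \<zeta>\<eta>[of v] by simp
  qed
  obtain R1 where R1: "\<And>t. norm (\<gamma> t) \<le> R1" by (rule sol_bounded[OF \<gamma> order_trans[OF rs]]) (rule that)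
  obtain R2 where R2: "\<And>t. norm (\<eta> t) \<le> R2" by (rule sol_bounded[OF \<eta> rs(2)]) (rule that)
  have fi: "integrable lborel ?f"
    by (rule H_integrable[where R = "max R1 R2"])
      (use R1 R2 solD(4)[OF \<gamma>] solD(4)[OF \<eta>] *(1) in \<open>auto simp: le_max_iff_disj\<close>)
  show "\<xi> \<bullet> (?\<zeta> q - ?\<zeta> p) \<le> integral {p..q} ?f"
  proof (cases "q \<le> s \<or> s \<le> p")
    case True then show ?thesis using left[of p q] right[of p q] * by blast
  next
    case False
    have "integral {p..s} ?f + integral {s..q} ?f = integral {p..q} ?f"
      using False by (intro Henstock_Kurzweil_Integration.integral_combine integrable_on_Icc[OF fi]) auto
    moreover have "\<xi> \<bullet> (?\<zeta> s - ?\<zeta> p) \<le> integral {p..s} ?f" using False * by (intro left) auto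
    moreover have "\<xi> \<bullet> (?\<zeta> q - ?\<zeta> s) \<le> integral {s..q} ?f" using False * by (intro right) auto
    moreover have "\<xi> \<bullet> (?\<zeta> q - ?\<zeta> p) = \<xi> \<bullet> (?\<zeta> q - ?\<zeta> s) + \<xi> \<bullet> (?\<zeta> s - ?\<zeta> p)"
      by (simp only: inner_diff_right)
    ultimately show ?thesis by linarith
  qed
qed (use solD[OF \<gamma>] solD[OF \<eta>] rs in auto)

end

section \<open>A single Euler step\<close>

locale tangential_viability_problem = viability_problem +
  assumes tangential: "AE t in lborel. \<forall>x\<in>frontier \<Omega>. \<exists>v\<in>tangent_cone \<Omega> x.
     \<forall>\<delta>>0. \<forall>\<xi>\<in>sphere 0 1. \<xi> \<bullet> v \<le> H \<delta> t x \<xi>"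
begin

text \<open>
  The last conjunct is membership in the tangent cone in a form without division.
\<close>

definition tangent_velocity :: "real \<Rightarrow> real \<Rightarrow> 'a \<Rightarrow> 'a \<Rightarrow> bool" where
  "tangent_velocity \<delta> t x v \<longleftrightarrow> norm v \<le> c t * (1 + norm x + \<delta>) \<and> (\<forall>\<xi>\<in>D. \<xi> \<bullet> v \<le> H \<delta> t x \<xi>) \<and>
     (\<forall>e>0. \<exists>\<^sub>F \<kappa> in at_right 0. infdist (x + \<kappa> *\<^sub>R v) \<Omega> \<le> e * \<kappa>)"

text \<open>
  Testing with the direction of \<open>v\<close> itself bounds its norm by the growth bound of the field.
\<close>

lemma tangent_velocity_frontier:
  assumes x: "x \<in> \<Omega>" and \<delta>: "\<delta> > 0" and v: "v \<in> tangent_cone \<Omega> x"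
    and H: "\<And>\<xi>. \<xi> \<in> sphere 0 1 \<Longrightarrow> \<xi> \<bullet> v \<le> H \<delta> t x \<xi>"
  shows "tangent_velocity \<delta> t x v"
  unfolding tangent_velocity_def
proof (intro conjI ballI allI impI)
  have c0: "0 \<le> c t * (1 + norm x + \<delta>)" using c_nonneg \<delta> by auto
  show "norm v \<le> c t * (1 + norm x + \<delta>)"
  proof (cases "v = 0")
    case False
    have u: "sgn v \<in> sphere 0 1" using False by (simp add: norm_sgn)
    have "norm v = sgn v \<bullet> v" using False by (simp add: sgn_div_norm dot_square_norm power2_eq_square)
    also have "\<dots> \<le> H \<delta> t x (sgn v)" by (rule H[OF u])
    also have "\<dots> \<le> norm (sgn v) * (c t * (1 + norm x + \<delta>))" using H_abs_le[OF x \<delta>, of t "sgn v"] by (simp add: abs_le_iff)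
    finally show ?thesis using False by (simp add: norm_sgn)
  qed (use c0 in simp)
  show "\<xi> \<bullet> v \<le> H \<delta> t x \<xi>" if "\<xi> \<in> D" for \<xi> using H that D(2) by blast
  fix e :: real assume e: "e > 0"
  show "\<exists>\<^sub>F \<kappa> in at_right 0. infdist (x + \<kappa> *\<^sub>R v) \<Omega> \<le> e * \<kappa>"
  proof (rule ccontr)
    assume "\<not> (\<exists>\<^sub>F \<kappa> in at_right 0. infdist (x + \<kappa> *\<^sub>R v) \<Omega> \<le> e * \<kappa>)"
    then have "\<forall>\<^sub>F \<kappa> in at_right 0. e * \<kappa> < infdist (x + \<kappa> *\<^sub>R v) \<Omega>"
      by (simp add: not_frequently not_le)
    moreover have "\<forall>\<^sub>F \<kappa>::real in at_right 0. 0 < \<kappa>" by (rule eventually_at_right_less)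
    ultimately have "\<forall>\<^sub>F \<kappa> in at_right 0. ereal e \<le> ereal (inverse \<kappa> * infdist (x + \<kappa> *\<^sub>R v) \<Omega>)"
      by eventually_elim (auto simp: field_simps)
    then have "ereal e \<le> Liminf (at_right 0) (\<lambda>r. ereal (inverse r * infdist (x + r *\<^sub>R v) \<Omega>))"
      by (rule Liminf_bounded)
    then show False using v e by (simp add: tangent_cone_def)
  qed
qed

text \<open>
  In the interior every vector is tangent, so a value \<open>b t y\<close> of the field will do: almost every \<open>y\<close> in the ball
  satisfies the countably many inequalities with directions in \<open>D\<close>.
\<close>

lemma tangent_velocity_interior:
  assumes x: "x \<in> interior \<Omega>" and \<delta>: "\<delta> > 0"
  shows "\<exists>v. tangent_velocity \<delta> t x v"
proof -
  have x\<Omega>: "x \<in> \<Omega>" using x interior_subset by blast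
  have AE1: "AE y in lborel. \<forall>\<xi>\<in>D. y \<in> ball x \<delta> \<inter> \<Omega> \<longrightarrow> \<xi> \<bullet> b t y \<le> H \<delta> t x \<xi>"
    by (intro AE_ball_countable' D(1) H_ess_le x\<Omega> \<delta>)
  have "\<exists>y. y \<in> ball x \<delta> \<inter> \<Omega> \<and> (\<forall>\<xi>\<in>D. \<xi> \<bullet> b t y \<le> H \<delta> t x \<xi>)"
  proof (rule ccontr)
    assume no: "\<not> ?thesis"
    have "AE y in lborel. y \<notin> ball x \<delta> \<inter> \<Omega>"
      using AE1 by eventually_elim (use no in blast)
    then show False using not_AE_notin[OF ball_borel thick[OF x\<Omega> \<delta>]] by blast
  qed
  then obtain y where y: "y \<in> ball x \<delta> \<inter> \<Omega>" "\<And>\<xi>. \<xi> \<in> D \<Longrightarrow> \<xi> \<bullet> b t y \<le> H \<delta> t x \<xi>" by blast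
  define v where "v = b t y"
  have "norm v \<le> c t * (1 + norm x + \<delta>)" unfolding v_def by (rule norm_b_on_ball[OF y(1)])
  moreover have "\<exists>\<^sub>F \<kappa> in at_right 0. infdist (x + \<kappa> *\<^sub>R v) \<Omega> \<le> e * \<kappa>" if "e > 0" for e
  proof (rule eventually_frequently)
    have "((\<lambda>\<kappa>::real. x + \<kappa> *\<^sub>R v) \<longlongrightarrow> x + 0 *\<^sub>R v) (at_right 0)" by (intro tendsto_intros)
    then have "\<forall>\<^sub>F \<kappa> in at_right 0. x + \<kappa> *\<^sub>R v \<in> interior \<Omega>"
      using topological_tendstoD[of _ "x + 0 *\<^sub>R v" "at_right 0" "interior \<Omega>"] x by simp
    moreover have "\<forall>\<^sub>F \<kappa>::real in at_right 0. 0 < \<kappa>" by (rule eventually_at_right_less)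
    ultimately show "\<forall>\<^sub>F \<kappa> in at_right 0. infdist (x + \<kappa> *\<^sub>R v) \<Omega> \<le> e * \<kappa>"
    proof eventually_elim
      case (elim \<kappa>)
      then have "infdist (x + \<kappa> *\<^sub>R v) \<Omega> = 0" using interior_subset infdist_zero by blast
      then show ?case using elim that by simp
    qed
  qed auto
  ultimately show ?thesis using y unfolding tangent_velocity_def v_def by blast
qed

text \<open>
  Countably many centres \<open>z\<close> suffice because a ball at a nearby \<open>z\<close> fits between two balls
  at any given point of \<open>\<Omega>\<close>. The exceptional null set of times is therefore independent of the position.
\<close>

definition good_time :: "'a set \<Rightarrow> real \<Rightarrow> bool" where
  "good_time Z t \<longleftrightarrow> (\<forall>x\<in>\<Omega>. \<forall>\<delta>>0. \<exists>v. tangent_velocity \<delta> t x v) \<and> Lebesgue_point c t \<and>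
     (\<forall>z\<in>Z. \<forall>\<xi>\<in>D. \<forall>n. Lebesgue_point (\<lambda>\<tau>. H (mesh n) \<tau> z \<xi>) t)"

lemma AE_good_time:
  assumes Z: "countable Z" "Z \<subseteq> \<Omega>"
  shows "AE t in lborel. good_time Z t"
proof -
  have 1: "AE t in lborel. Lebesgue_point c t"
    by (rule Lebesgue_differentiation[OF c_integrable])
  have 2: "AE t in lborel. \<forall>z\<in>Z. \<forall>\<xi>\<in>D. \<forall>n. Lebesgue_point (\<lambda>\<tau>. H (mesh n) \<tau> z \<xi>) t"
    unfolding AE_all_countable
  proof (intro AE_ball_countable' Z(1) D(1) allI)
    fix z \<xi> assume z: "z \<in> Z"
    have "z \<in> \<Omega>" using z Z(2) by blast
    then show "AE t in lborel. \<forall>n. Lebesgue_point (\<lambda>\<tau>. H (mesh n) \<tau> z \<xi>) t"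
      unfolding AE_all_countable
      by (intro allI Lebesgue_differentiation H_const_integrable mesh_pos)
  qed
  have 3: "AE t in lborel. \<forall>x\<in>\<Omega>. \<forall>\<delta>>0. \<exists>v. tangent_velocity \<delta> t x v"
    using tangential
  proof eventually_elim
    case (elim t)
    show ?case
    proof (intro ballI allI impI)
      fix x and \<delta> :: real assume x: "x \<in> \<Omega>" and \<delta>: "\<delta> > 0"
      show "\<exists>v. tangent_velocity \<delta> t x v"
      proof (cases "x \<in> interior \<Omega>")
        case True then show ?thesis using tangent_velocity_interior \<delta> by blast
      next
        case False
        then have "x \<in> frontier \<Omega>" using x closure_subset by (auto simp: frontier_def)
        then show ?thesis using elim tangent_velocity_frontier[OF x \<delta>] \<delta> by blast
      qed
    qed
  qed
  show ?thesis using 1 2 3 by eventually_elim (simp add: good_time_def)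
qed

text \<open>
  One Euler step of length \<open>\<kappa>\<close> from \<open>x\<close> at time \<open>t\<close>. The integral of \<open>err\<close> is the allowed defect in the
  directions \<open>\<Xi>\<close>; being an integral, it adds up along a chain of steps.
\<close>

definition step :: "real \<Rightarrow> 'a set \<Rightarrow> (real \<Rightarrow> real) \<Rightarrow> real \<Rightarrow> real \<Rightarrow> 'a \<Rightarrow> 'a \<Rightarrow> bool" where
  "step \<delta> \<Xi> err \<kappa> t x x' \<longleftrightarrow> x' \<in> \<Omega> \<and> norm (x' - x) \<le> (2 + norm x) * (A (t + \<kappa>) - A t) \<and>
     (\<forall>\<xi>\<in>\<Xi>. \<xi> \<bullet> (x' - x) \<le> integral {t..t + \<kappa>} (\<lambda>\<tau>. H \<delta> \<tau> x \<xi>) + integral {t..t + \<kappa>} err)"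

lemma A_window: "0 \<le> \<kappa> \<Longrightarrow> A (t + \<kappa>) - A t = integral {t..t + \<kappa>} c + \<kappa>"
  using A_diff[of t "t + \<kappa>"] integral_add[OF integrable_on_Icc[OF c_integrable, of t "t + \<kappa>"], of "\<lambda>_. 1"]
  by (simp add: integrable_const_ivl)

text \<open>
  A tangent velocity \<open>v\<close> at \<open>(t0, x0)\<close> and a point \<open>x'\<close> of \<open>\<Omega>\<close> close to \<open>x0 + \<kappa> v\<close> are chosen once. The same \<open>x'\<close>
  and \<open>\<kappa>\<close> then serve all starting points near \<open>(t0, x0)\<close>, because integrals over a window of
  length \<open>\<kappa>\<close> depend continuously on where the window starts. Three nested balls relate the essential suprema:
  the ball of radius \<open>\<rho> / 2\<close> at \<open>x0\<close>, that of radius \<open>\<rho>\<close> at \<open>z\<close>, for which \<open>t0\<close> is a Lebesgue point,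
  and that of radius \<open>\<delta>\<close> at \<open>x\<close>.
\<close>

lemma good_time_step:
  assumes good: "good_time Z t0" and Z: "Z \<subseteq> \<Omega>" "\<Omega> \<subseteq> closure Z"
    and x0: "x0 \<in> \<Omega>" and \<delta>: "0 < \<delta>" "\<delta> \<le> 1" and \<epsilon>: "0 < \<epsilon>" "\<epsilon> \<le> 1" and \<eta>: "\<eta> > 0"
    and \<Xi>: "finite \<Xi>" "\<Xi> \<subseteq> D"
    and err: "\<And>t. \<epsilon> \<le> err t" "\<And>p q. err integrable_on {p..q}"
  shows "\<exists>\<kappa> r. 0 < \<kappa> \<and> \<kappa> \<le> \<eta> \<and> 0 < r \<and>
    (\<forall>t x. \<bar>t - t0\<bar> < r \<longrightarrow> x \<in> \<Omega> \<longrightarrow> dist x x0 < r \<longrightarrow> (\<exists>x'. step \<delta> \<Xi> err \<kappa> t x x'))"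
proof -
  obtain n where n: "mesh n < \<delta> / 2" using mesh_less[of "\<delta> / 2"] \<delta> by auto
  define \<rho> where "\<rho> = mesh n"
  have \<rho>: "0 < \<rho>" "2 * \<rho> \<le> \<delta>" "\<rho> \<le> 1" using n mesh_pos[of n] \<delta> by (auto simp: \<rho>_def)
  obtain z where z: "z \<in> Z" "dist z x0 < \<rho> / 2"
    using x0 Z(2) \<rho>(1) by (meson closure_approachable half_gt_zero subsetD)
  have z\<Omega>: "z \<in> \<Omega>" using z Z by blast
  obtain v where v: "tangent_velocity (\<rho> / 2) t0 x0 v"
    using good x0 \<rho>(1) unfolding good_time_def by (meson half_gt_zero)
  define e where "e = \<epsilon> / 8"
  have e: "e > 0" "4 * e \<le> 1" "4 * e \<le> \<epsilon>" using \<epsilon> by (auto simp: e_def)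
  let ?h = "\<lambda>\<xi> \<tau>. H \<rho> \<tau> z \<xi>"
  have hi: "integrable lborel (?h \<xi>)" for \<xi> by (rule H_const_integrable[OF z\<Omega> \<rho>(1)])
  have LPh: "Lebesgue_point (?h \<xi>) t0" if "\<xi> \<in> \<Xi>" for \<xi>
    using good z(1) that \<Xi>(2) unfolding good_time_def \<rho>_def by blast
  have LPc: "Lebesgue_point c t0" using good unfolding good_time_def by blast
  have ev: "\<forall>\<^sub>F \<kappa> in at_right 0. 0 < \<kappa> \<and> \<kappa> \<le> \<eta> \<and> \<bar>integral {t0..t0 + \<kappa>} c - c t0 * \<kappa>\<bar> \<le> e * \<kappa> \<and>
      (\<forall>\<xi>\<in>\<Xi>. \<bar>integral {t0..t0 + \<kappa>} (?h \<xi>) - ?h \<xi> t0 * \<kappa>\<bar> \<le> e * \<kappa>)"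
  proof (intro eventually_conj)
    show "\<forall>\<^sub>F \<kappa>::real in at_right 0. 0 < \<kappa>" by (rule eventually_at_right_less)
    show "\<forall>\<^sub>F \<kappa> in at_right 0. \<kappa> \<le> \<eta>" unfolding eventually_at_right_field using \<eta> by (intro exI[of _ \<eta>]) auto
    show "\<forall>\<^sub>F \<kappa> in at_right 0. \<bar>integral {t0..t0 + \<kappa>} c - c t0 * \<kappa>\<bar> \<le> e * \<kappa>"
      by (rule Lebesgue_point_window[OF LPc e(1)])
    show "\<forall>\<^sub>F \<kappa> in at_right 0. \<forall>\<xi>\<in>\<Xi>. \<bar>integral {t0..t0 + \<kappa>} (?h \<xi>) - ?h \<xi> t0 * \<kappa>\<bar> \<le> e * \<kappa>"
      using LPh by (intro eventually_ball_finite \<Xi>(1) ballI Lebesgue_point_window e(1))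
  qed
  have fr: "\<exists>\<^sub>F \<kappa> in at_right 0. infdist (x0 + \<kappa> *\<^sub>R v) \<Omega> \<le> e * \<kappa>"
    using v e(1) unfolding tangent_velocity_def by blast
  obtain \<kappa> where \<kappa>: "0 < \<kappa>" "\<kappa> \<le> \<eta>" "\<bar>integral {t0..t0 + \<kappa>} c - c t0 * \<kappa>\<bar> \<le> e * \<kappa>"
      "\<And>\<xi>. \<xi> \<in> \<Xi> \<Longrightarrow> \<bar>integral {t0..t0 + \<kappa>} (?h \<xi>) - ?h \<xi> t0 * \<kappa>\<bar> \<le> e * \<kappa>"
      "infdist (x0 + \<kappa> *\<^sub>R v) \<Omega> \<le> e * \<kappa>"
    using frequently_ex[OF frequently_eventually_conj[OF fr ev]] by blast
  have e\<kappa>: "e * \<kappa> > 0" using e \<kappa> by simp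
  obtain x' where x': "x' \<in> \<Omega>" "dist (x0 + \<kappa> *\<^sub>R v) x' \<le> e * \<kappa>"
    using infdist_attains_inf[OF closed, of "x0 + \<kappa> *\<^sub>R v"] x0 \<kappa>(5) by (metis empty_iff)
  have near: "\<forall>\<^sub>F t in nhds t0. \<bar>integral {t..t + \<kappa>} f - integral {t0..t0 + \<kappa>} f\<bar> < e * \<kappa>"
    if "integrable lborel f" for f
  proof -
    have "isCont (\<lambda>t. integral {t..t + \<kappa>} f) t0"
      using window_integral_continuous[OF that, of \<kappa>] \<kappa>(1) by (simp add: continuous_on_eq_continuous_at)
    then have "((\<lambda>t. integral {t..t + \<kappa>} f) \<longlongrightarrow> integral {t0..t0 + \<kappa>} f) (nhds t0)"
      unfolding isCont_def by (rule iffD1[OF tendsto_at_iff_tendsto_nhds[of "\<lambda>t. integral {t..t + \<kappa>} f" t0]])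
    from tendstoD[OF this e\<kappa>] show ?thesis unfolding dist_real_def .
  qed
  have "\<forall>\<^sub>F t in nhds t0. \<bar>integral {t..t + \<kappa>} c - integral {t0..t0 + \<kappa>} c\<bar> < e * \<kappa> \<and>
     (\<forall>\<xi>\<in>\<Xi>. \<bar>integral {t..t + \<kappa>} (?h \<xi>) - integral {t0..t0 + \<kappa>} (?h \<xi>)\<bar> < e * \<kappa>)"
    by (intro eventually_conj eventually_ball_finite \<Xi>(1) ballI near hi c_integrable)
  then obtain r0 where r0: "r0 > 0" "\<And>t. dist t t0 < r0 \<Longrightarrow> \<bar>integral {t..t + \<kappa>} c - integral {t0..t0 + \<kappa>} c\<bar> < e * \<kappa>"
     "\<And>t \<xi>. dist t t0 < r0 \<Longrightarrow> \<xi> \<in> \<Xi> \<Longrightarrow> \<bar>integral {t..t + \<kappa>} (?h \<xi>) - integral {t0..t0 + \<kappa>} (?h \<xi>)\<bar> < e * \<kappa>"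
    unfolding eventually_nhds_metric by blast
  define r where "r = min r0 (min (\<rho> / 2) (e * \<kappa>))"
  have r: "r > 0" "r \<le> r0" "r \<le> \<rho> / 2" "r \<le> e * \<kappa>" using r0(1) \<rho>(1) e\<kappa> by (auto simp: r_def)
  have "step \<delta> \<Xi> err \<kappa> t x x'" if t: "\<bar>t - t0\<bar> < r" and x: "x \<in> \<Omega>" "dist x x0 < r" for t x
  proof -
    have tr: "dist t t0 < r0" using t r by (simp add: dist_real_def)
    define w where "w = x' - x - \<kappa> *\<^sub>R v"
    have w: "norm w \<le> 2 * e * \<kappa>"
    proof -
      have "w = (x0 - x) - ((x0 + \<kappa> *\<^sub>R v) - x')" by (simp add: w_def)
      then have "norm w \<le> norm (x0 - x) + norm ((x0 + \<kappa> *\<^sub>R v) - x')" by (metis norm_triangle_ineq4)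
      then show ?thesis using x(2) x'(2) r(4) by (simp add: dist_norm norm_minus_commute)
    qed
    have xx: "x' - x = \<kappa> *\<^sub>R v + w" by (simp add: w_def)
    have nx0: "norm x0 \<le> norm x + \<rho> / 2"
      using x(2) r(3) norm_triangle_sub[of x0 x] by (simp add: dist_norm norm_minus_commute)
    have "norm v \<le> c t0 * (1 + norm x0 + \<rho> / 2)" using v unfolding tangent_velocity_def by blast
    also have "\<dots> \<le> c t0 * (2 + norm x)" using nx0 \<rho>(3) by (intro mult_left_mono c_nonneg) linarith
    finally have nv: "\<kappa> * norm v \<le> (2 + norm x) * (c t0 * \<kappa>)"
      using \<kappa>(1) mult_left_mono[of "norm v" _ \<kappa>] by (simp add: mult.commute mult.left_commute)
    have "c t0 * \<kappa> \<le> integral {t..t + \<kappa>} c + 2 * e * \<kappa>"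
      using \<kappa>(3) r0(2)[OF tr] unfolding abs_le_iff abs_less_iff by linarith
    then have nv2: "\<kappa> * norm v \<le> (2 + norm x) * (integral {t..t + \<kappa>} c + 2 * e * \<kappa>)"
      by (intro order_trans[OF nv] mult_left_mono) auto
    have "norm (x' - x) \<le> \<kappa> * norm v + norm w"
      unfolding xx using norm_triangle_ineq[of "\<kappa> *\<^sub>R v" w] \<kappa>(1) by simp
    also have "\<dots> \<le> (2 + norm x) * (integral {t..t + \<kappa>} c + 2 * e * \<kappa>) + (2 + norm x) * (2 * e * \<kappa>)"
    proof -
      have "1 * (2 * e * \<kappa>) \<le> (2 + norm x) * (2 * e * \<kappa>)" using e(1) \<kappa>(1) by (intro mult_right_mono) auto
      then show ?thesis using nv2 w by linarith
    qed
    also have "\<dots> = (2 + norm x) * (integral {t..t + \<kappa>} c + 4 * e * \<kappa>)" by (simp add: algebra_simps)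
    also have "\<dots> \<le> (2 + norm x) * (A (t + \<kappa>) - A t)"
    proof -
      have "4 * e * \<kappa> \<le> 1 * \<kappa>" using e(2) \<kappa>(1) by (intro mult_right_mono) auto
      then show ?thesis using A_window[of \<kappa> t] \<kappa>(1) by (intro mult_left_mono) auto
    qed
    finally have nbound: "norm (x' - x) \<le> (2 + norm x) * (A (t + \<kappa>) - A t)" .
    have "\<xi> \<bullet> (x' - x) \<le> integral {t..t + \<kappa>} (\<lambda>\<tau>. H \<delta> \<tau> x \<xi>) + integral {t..t + \<kappa>} err" if \<xi>: "\<xi> \<in> \<Xi>" for \<xi>
    proof -
      have \<xi>1: "norm \<xi> = 1" "\<xi> \<in> D" using \<xi> \<Xi>(2) D(2) by auto
      have 1: "\<xi> \<bullet> w \<le> 2 * e * \<kappa>"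
        using norm_cauchy_schwarz[of \<xi> w] w \<xi>1(1) by simp
      have "\<xi> \<bullet> v \<le> H (\<rho> / 2) t0 x0 \<xi>" using v \<xi>1(2) unfolding tangent_velocity_def by blast
      also have "\<dots> \<le> ?h \<xi> t0"
        using z(2) \<rho>(1) by (intro H_mono z\<Omega> x0) (auto simp: dist_commute)
      finally have 2: "\<kappa> * (\<xi> \<bullet> v) \<le> ?h \<xi> t0 * \<kappa>" using \<kappa>(1) mult_left_mono[of "\<xi> \<bullet> v" "?h \<xi> t0" \<kappa>] by (simp add: mult.commute)
      have "integral {t..t + \<kappa>} (?h \<xi>) \<le> integral {t..t + \<kappa>} (\<lambda>\<tau>. H \<delta> \<tau> x \<xi>)"
      proof (rule integral_le)
        show "?h \<xi> \<tau> \<le> H \<delta> \<tau> x \<xi>" for \<tau>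
        proof (rule H_mono[OF x(1) z\<Omega> \<rho>(1) \<delta>(1)])
          show "dist z x + \<rho> \<le> \<delta>"
            using z(2) x(2) r(3) \<rho>(2) dist_triangle[of z x x0] dist_commute[of x0 x] by linarith
        qed
      qed (intro integrable_on_Icc hi H_const_integrable x(1) \<delta>(1))+
      moreover have "4 * e * \<kappa> \<le> integral {t..t + \<kappa>} err"
      proof -
        have "integral {t..t + \<kappa>} (\<lambda>_. \<epsilon>) \<le> integral {t..t + \<kappa>} err"
          by (rule integral_le) (use err in auto)
        moreover have "4 * e * \<kappa> \<le> \<epsilon> * \<kappa>" using e(3) \<kappa>(1) by (intro mult_right_mono) auto
        moreover have "integral {t..t + \<kappa>} (\<lambda>_. \<epsilon>) = \<epsilon> * \<kappa>" using \<kappa>(1) by simp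
        ultimately show ?thesis by linarith
      qed
      moreover have "\<xi> \<bullet> (x' - x) = \<kappa> * (\<xi> \<bullet> v) + \<xi> \<bullet> w" unfolding xx by (simp add: inner_add_right)
      moreover have "?h \<xi> t0 * \<kappa> \<le> integral {t..t + \<kappa>} (?h \<xi>) + 2 * e * \<kappa>"
        using \<kappa>(4)[OF \<xi>] r0(3)[OF tr \<xi>] unfolding abs_le_iff abs_less_iff by linarith
      ultimately show ?thesis using 1 2 by linarith
    qed
    then show ?thesis using nbound x'(1) by (simp add: step_def)
  qed
  then show ?thesis using \<kappa>(1,2) r(1) by blast
qed

text \<open>
  Near a bad time the step does not move. The field could have moved the point by at most
  \<open>(2 + R) c\<close> per unit time, and \<open>err\<close> is at least that large on \<open>U\<close>.
\<close>

lemma bad_time_step: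
  assumes t0: "t0 \<in> U" "open U" and \<delta>: "0 < \<delta>" "\<delta> \<le> 1" and \<eta>: "\<eta> > 0" and \<Xi>: "\<Xi> \<subseteq> D"
    and err: "\<And>t. 0 \<le> err t" "\<And>t. t \<in> U \<Longrightarrow> (2 + R) * c t \<le> err t" "\<And>p q. err integrable_on {p..q}"
  shows "\<exists>\<kappa> r. 0 < \<kappa> \<and> \<kappa> \<le> \<eta> \<and> 0 < r \<and>
    (\<forall>t x. \<bar>t - t0\<bar> < r \<longrightarrow> x \<in> \<Omega> \<longrightarrow> norm x \<le> R \<longrightarrow> (\<exists>x'. step \<delta> \<Xi> err \<kappa> t x x'))"
proof -
  obtain h where h: "h > 0" "ball t0 h \<subseteq> U" using t0 openE by blast
  define \<kappa> where "\<kappa> = min \<eta> (h / 2)"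
  have \<kappa>: "0 < \<kappa>" "\<kappa> \<le> \<eta>" "\<kappa> \<le> h / 2" using h \<eta> by (auto simp: \<kappa>_def)
  have "step \<delta> \<Xi> err \<kappa> t x x" if t: "\<bar>t - t0\<bar> < h / 2" and x: "x \<in> \<Omega>" "norm x \<le> R" for t x
    unfolding step_def
  proof (intro conjI ballI x(1))
    show "norm (x - x) \<le> (2 + norm x) * (A (t + \<kappa>) - A t)"
      using A_mono[of t "t + \<kappa>"] \<kappa>(1) by simp
    fix \<xi> assume "\<xi> \<in> \<Xi>"
    then have \<xi>: "norm \<xi> = 1" using \<Xi> D(2) by auto
    have Hi: "(\<lambda>\<tau>. H \<delta> \<tau> x \<xi>) integrable_on {t..t + \<kappa>}"
      by (intro integrable_on_Icc H_const_integrable x(1) \<delta>(1))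
    have "0 \<le> integral {t..t + \<kappa>} (\<lambda>\<tau>. H \<delta> \<tau> x \<xi> + err \<tau>)"
    proof (rule integral_nonneg)
      show "(\<lambda>\<tau>. H \<delta> \<tau> x \<xi> + err \<tau>) integrable_on {t..t + \<kappa>}"
        using Hi err(3) by (rule Henstock_Kurzweil_Integration.integrable_add)
      fix \<tau> assume "\<tau> \<in> {t..t + \<kappa>}"
      then have "\<tau> \<in> U" using t \<kappa>(3) h(2) by (auto simp: dist_real_def subset_eq abs_if split: if_splits)
      then have "(2 + R) * c \<tau> \<le> err \<tau>" by (rule err(2))
      moreover have "\<bar>H \<delta> \<tau> x \<xi>\<bar> \<le> c \<tau> * (1 + norm x + \<delta>)" using H_abs_le[OF x(1) \<delta>(1), of \<tau> \<xi>] \<xi> by simp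
      moreover have "c \<tau> * (1 + norm x + \<delta>) \<le> c \<tau> * (2 + R)" using x(2) \<delta>(2) by (intro mult_left_mono c_nonneg) linarith
      ultimately show "0 \<le> H \<delta> \<tau> x \<xi> + err \<tau>" by (simp add: mult.commute abs_le_iff)
    qed
    then show "\<xi> \<bullet> (x - x) \<le> integral {t..t + \<kappa>} (\<lambda>\<tau>. H \<delta> \<tau> x \<xi>) + integral {t..t + \<kappa>} err"
      using integral_add[OF Hi err(3)] by simp
  qed
  then show ?thesis using \<kappa>(1,2) h(1) by (intro exI[of _ \<kappa>] exI[of _ "h / 2"]) auto
qed

lemma uniform_step:
  assumes Z: "Z \<subseteq> \<Omega>" "\<Omega> \<subseteq> closure Z" and U: "open U" "\<And>t. \<not> good_time Z t \<Longrightarrow> t \<in> U"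
    and \<delta>: "0 < \<delta>" "\<delta> \<le> 1" and \<epsilon>: "0 < \<epsilon>" "\<epsilon> \<le> 1" and \<eta>: "\<eta> > 0" and \<Xi>: "finite \<Xi>" "\<Xi> \<subseteq> D"
    and err: "\<And>t. \<epsilon> \<le> err t" "\<And>t. t \<in> U \<Longrightarrow> (2 + R) * c t \<le> err t" "\<And>p q. err integrable_on {p..q}"
  obtains l where "l > 0" "\<And>t x. s \<le> t \<Longrightarrow> t \<le> T \<Longrightarrow> x \<in> \<Omega> \<Longrightarrow> norm x \<le> R \<Longrightarrow>
     \<exists>\<kappa> x'. l \<le> \<kappa> \<and> \<kappa> \<le> \<eta> \<and> step \<delta> \<Xi> err \<kappa> t x x'"
proof -
  define K where "K = {s..T} \<times> (\<Omega> \<inter> cball 0 R)"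
  have K: "compact K" unfolding K_def using closed by (intro compact_Times closed_Int_compact) auto
  have "\<exists>\<kappa> r. 0 < \<kappa> \<and> \<kappa> \<le> \<eta> \<and> 0 < r \<and> (\<forall>t x. \<bar>t - fst p\<bar> < r \<longrightarrow> x \<in> \<Omega> \<longrightarrow> norm x \<le> R \<longrightarrow> dist x (snd p) < r \<longrightarrow>
      (\<exists>x'. step \<delta> \<Xi> err \<kappa> t x x'))" if p: "p \<in> K" for p
  proof (cases "good_time Z (fst p)")
    case True
    have "snd p \<in> \<Omega>" using p by (auto simp: K_def)
    from good_time_step[OF True Z this \<delta> \<epsilon> \<eta> \<Xi> err(1,3)] show ?thesis by blast
  next
    case False
    have err0: "0 \<le> err t" for t using err(1)[of t] \<epsilon>(1) by linarith
    from bad_time_step[OF U(2)[OF False] U(1) \<delta> \<eta> \<Xi>(2) err0 err(2,3)] show ?thesis by blast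
  qed
  then obtain \<Lambda> \<rho> where \<Lambda>: "\<And>p. p \<in> K \<Longrightarrow> 0 < \<Lambda> p \<and> \<Lambda> p \<le> \<eta> \<and> 0 < \<rho> p \<and>
     (\<forall>t x. \<bar>t - fst p\<bar> < \<rho> p \<longrightarrow> x \<in> \<Omega> \<longrightarrow> norm x \<le> R \<longrightarrow> dist x (snd p) < \<rho> p \<longrightarrow> (\<exists>x'. step \<delta> \<Xi> err (\<Lambda> p) t x x'))"
    by metis
  define N where "N p = ball (fst p) (\<rho> p) \<times> ball (snd p) (\<rho> p)" for p :: "real \<times> 'a"
  have "K \<subseteq> (\<Union>p\<in>K. N p)" using \<Lambda> by (force simp: N_def)
  then obtain C where C: "C \<subseteq> K" "finite C" "K \<subseteq> (\<Union>p\<in>C. N p)"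
    using compactE_image[OF K, of K N] by (auto simp: N_def open_Times)
  define l where "l = Min (insert \<eta> (\<Lambda> ` C))"
  have l: "l > 0" "\<And>p. p \<in> C \<Longrightarrow> l \<le> \<Lambda> p" using C \<Lambda> \<eta> by (auto simp: l_def)
  show thesis
  proof (rule that[OF l(1)])
    fix t x assume tx: "s \<le> t" "t \<le> T" "x \<in> \<Omega>" "norm x \<le> R"
    then have "(t, x) \<in> K" by (auto simp: K_def)
    then obtain p where p: "p \<in> C" "(t, x) \<in> N p" using C(3) by blast
    then have "p \<in> K" using C(1) by blast
    note \<Lambda>p = \<Lambda>[OF this]
    have "\<bar>t - fst p\<bar> < \<rho> p" "dist x (snd p) < \<rho> p" using p(2) by (auto simp: N_def dist_real_def dist_commute abs_minus_commute)
    then obtain x' where "step \<delta> \<Xi> err (\<Lambda> p) t x x'" using \<Lambda>p tx by blast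
    then show "\<exists>\<kappa> x'. l \<le> \<kappa> \<and> \<kappa> \<le> \<eta> \<and> step \<delta> \<Xi> err \<kappa> t x x'" using l(2)[OF p(1)] \<Lambda>p by blast
  qed
qed

section \<open>Euler polygons and existence of solutions\<close>

lemma step_growth:
  assumes "norm (x' - x) \<le> (2 + norm x) * (A t' - A t)"
  shows "norm (x' - x) \<le> (2 + norm x) * (exp (A t' - A t) - 1)"
proof -
  have "A t' - A t \<le> exp (A t' - A t) - 1" using exp_ge_add_one_self[of "A t' - A t"] by linarith
  then show ?thesis by (intro order_trans[OF assms] mult_left_mono) auto
qed

text \<open>
  The growth bound keeps the chain in the ball of radius \<open>R\<close> up to time \<open>T\<close>, so steps are available there.
  After time \<open>T\<close> the chain just waits, which makes it infinite without further case distinctions.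
\<close>

lemma euler_chain:
  assumes x0: "x0 \<in> \<Omega>" and l: "0 < l" "l \<le> \<eta>" and sT: "s \<le> T"
    and R: "R = (2 + norm x0) * exp (A T - A s)"
    and st: "\<And>t x. s \<le> t \<Longrightarrow> t \<le> T \<Longrightarrow> x \<in> \<Omega> \<Longrightarrow> norm x \<le> R \<Longrightarrow>
     \<exists>\<kappa> x'. l \<le> \<kappa> \<and> \<kappa> \<le> \<eta> \<and> step \<delta> \<Xi> err \<kappa> t x x'"
  obtains \<tau> :: "nat \<Rightarrow> real" and y :: "nat \<Rightarrow> 'a" where "\<tau> 0 = s" "y 0 = x0"
    "\<And>n. \<tau> n + l \<le> \<tau> (Suc n)" "\<And>n. \<tau> (Suc n) \<le> \<tau> n + \<eta>" "\<And>n. y n \<in> \<Omega>"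
    "\<And>n. norm (y (Suc n) - y n) \<le> (2 + norm (y n)) * (exp (A (\<tau> (Suc n)) - A (\<tau> n)) - 1)"
    "\<And>n. \<tau> n \<le> T \<Longrightarrow> norm (y n) \<le> R"
    "\<And>n \<xi>. \<tau> n \<le> T \<Longrightarrow> \<xi> \<in> \<Xi> \<Longrightarrow> \<xi> \<bullet> (y (Suc n) - y n) \<le>
        integral {\<tau> n..\<tau> (Suc n)} (\<lambda>t. H \<delta> t (y n) \<xi>) + integral {\<tau> n..\<tau> (Suc n)} err"
proof -
  define P where "P n p \<longleftrightarrow> (n = 0 \<longrightarrow> p = (s, x0)) \<and> s \<le> fst p \<and> snd p \<in> \<Omega> \<and>
     2 + norm (snd p) \<le> (2 + norm x0) * exp (A (fst p) - A s)" for n :: nat and p :: "real \<times> 'a"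
  define Q where "Q p p' \<longleftrightarrow> fst p + l \<le> fst p' \<and> fst p' \<le> fst p + \<eta> \<and>
     norm (snd p' - snd p) \<le> (2 + norm (snd p)) * (exp (A (fst p') - A (fst p)) - 1) \<and>
     (fst p \<le> T \<longrightarrow> (\<forall>\<xi>\<in>\<Xi>. \<xi> \<bullet> (snd p' - snd p) \<le>
        integral {fst p..fst p'} (\<lambda>t. H \<delta> t (snd p) \<xi>) + integral {fst p..fst p'} err))" for p p' :: "real \<times> 'a"
  have bd: "norm (snd p) \<le> R" if "P n p" "fst p \<le> T" for n p
  proof -
    have "exp (A (fst p) - A s) \<le> exp (A T - A s)" using A_mono[OF that(2)] by simp
    then have "(2 + norm x0) * exp (A (fst p) - A s) \<le> R" unfolding R by (intro mult_left_mono) auto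
    then show ?thesis using that(1) unfolding P_def by linarith
  qed
  have "\<exists>f. \<forall>n. P n (f n) \<and> Q (f n) (f (Suc n))"
  proof (rule dependent_nat_choice)
    show "\<exists>p. P 0 p" using x0 by (intro exI[of _ "(s, x0)"]) (simp add: P_def)
    fix p n assume p: "P n p"
    then have ps: "s \<le> fst p" "snd p \<in> \<Omega>" by (auto simp: P_def)
    show "\<exists>p'. P (Suc n) p' \<and> Q p p'"
    proof (cases "fst p \<le> T")
      case True
      obtain \<kappa> x' where k: "l \<le> \<kappa>" "\<kappa> \<le> \<eta>" and S: "step \<delta> \<Xi> err \<kappa> (fst p) (snd p) x'"
        using st[OF ps(1) True ps(2) bd[OF p True]] by blast
      have g: "norm (x' - snd p) \<le> (2 + norm (snd p)) * (exp (A (fst p + \<kappa>) - A (fst p)) - 1)"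
        using S unfolding step_def by (intro step_growth) blast
      have "2 + norm x' \<le> (2 + norm (snd p)) * exp (A (fst p + \<kappa>) - A (fst p))"
        using g norm_triangle_sub[of x' "snd p"] by (simp add: algebra_simps)
      also have "\<dots> \<le> ((2 + norm x0) * exp (A (fst p) - A s)) * exp (A (fst p + \<kappa>) - A (fst p))"
        using p unfolding P_def by (intro mult_right_mono) auto
      also have "\<dots> = (2 + norm x0) * exp (A (fst p + \<kappa>) - A s)"
        by (simp add: exp_add[symmetric] mult.assoc)
      finally have "P (Suc n) (fst p + \<kappa>, x')"
        using S ps k l unfolding P_def step_def by auto
      moreover have "Q p (fst p + \<kappa>, x')" using g S k unfolding Q_def step_def by auto
      ultimately show ?thesis by blast
    next
      case False
      have "exp (A (fst p) - A s) \<le> exp (A (fst p + \<eta>) - A s)" using A_mono[of "fst p" "fst p + \<eta>"] l by simp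
      then have "(2 + norm x0) * exp (A (fst p) - A s) \<le> (2 + norm x0) * exp (A (fst p + \<eta>) - A s)"
        by (intro mult_left_mono) auto
      then have "P (Suc n) (fst p + \<eta>, snd p)" using p l unfolding P_def by auto
      moreover have "Q p (fst p + \<eta>, snd p)"
        using False l A_mono[of "fst p" "fst p + \<eta>"] unfolding Q_def by auto
      ultimately show ?thesis by blast
    qed
  qed
  then obtain f where f: "\<And>n. P n (f n)" "\<And>n. Q (f n) (f (Suc n))" by blast
  show thesis
  proof (rule that[of "\<lambda>n. fst (f n)" "\<lambda>n. snd (f n)"])
    show "fst (f 0) = s" "snd (f 0) = x0" using f(1)[of 0] by (auto simp: P_def)
    show "snd (f n) \<in> \<Omega>" for n using f(1)[of n] by (auto simp: P_def)
    show "norm (snd (f n)) \<le> R" if "fst (f n) \<le> T" for n by (rule bd[OF f(1) that])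
  qed (use f(2) in \<open>auto simp: Q_def\<close>)
qed

lemma A_clip:
  assumes "p \<le> q" "s \<le> T"
  shows "A (max s (min q T)) - A (max s (min p T)) \<le> A q - A p"
proof -
  note m = A_mono[of p q] A_mono[of p s] A_mono[of s q] A_mono[of p T] A_mono[of T q] A_mono[of s T]
  consider "q \<le> s" | "T \<le> p" | "s \<le> q" "p \<le> T" by linarith
  then show ?thesis
  proof cases
    case 1
    then have "max s (min q T) = s" "max s (min p T) = s" using assms by auto
    then show ?thesis using m(1) assms by simp
  next
    case 2
    then have "max s (min q T) = T" "max s (min p T) = T" using assms by auto
    then show ?thesis using m(1) assms by simp
  next
    case 3
    then have "A (max s (min q T)) \<le> A q" using assms by (intro A_mono) auto
    moreover have "A p \<le> A (max s (min p T))" using 3 assms by (intro A_mono) auto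
    ultimately show ?thesis by linarith
  qed
qed

text \<open>
  The piecewise constant path through the nodes of a chain. The inequalities hold exactly between
  nodes by telescoping. For general times \<open>p \<le> q\<close> they are applied between the last nodes before \<open>p\<close> and before \<open>q\<close>,
  and the two short intervals cut off or added contribute at most \<open>e / 4\<close> each.
\<close>

lemma euler_path:
  assumes \<tau>0: "\<tau> 0 = s" and y0: "y 0 = x0" and l: "0 < l" and sT: "s \<le> T"
    and \<delta>: "0 < \<delta>" "\<delta> \<le> 1" and \<Xi>: "\<Xi> \<subseteq> D"
    and \<tau>l: "\<And>n::nat. \<tau> n + l \<le> \<tau> (Suc n)" and \<tau>\<eta>: "\<And>n. \<tau> (Suc n) \<le> \<tau> n + \<eta>" and y\<Omega>: "\<And>n. y n \<in> \<Omega>"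
    and gr: "\<And>n. norm (y (Suc n) - y n) \<le> (2 + norm (y n)) * (exp (A (\<tau> (Suc n)) - A (\<tau> n)) - 1)"
    and yR: "\<And>n. \<tau> n \<le> T \<Longrightarrow> norm (y n) \<le> R"
    and dir: "\<And>n \<xi>. \<tau> n \<le> T \<Longrightarrow> \<xi> \<in> \<Xi> \<Longrightarrow> \<xi> \<bullet> (y (Suc n) - y n) \<le>
        integral {\<tau> n..\<tau> (Suc n)} (\<lambda>t. H \<delta> t (y n) \<xi>) + integral {\<tau> n..\<tau> (Suc n)} err"
    and err: "\<And>t. 0 \<le> err t" "\<And>p q. err integrable_on {p..q}" "integral {s..T} err \<le> e / 2"
    and \<eta>A: "\<And>u v. s \<le> u \<Longrightarrow> u \<le> v \<Longrightarrow> v \<le> T \<Longrightarrow> v - u \<le> \<eta> \<Longrightarrow> A v - A u \<le> e"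
    and \<eta>w: "\<And>u v. s \<le> u \<Longrightarrow> u \<le> v \<Longrightarrow> v \<le> T \<Longrightarrow> v - u \<le> \<eta> \<Longrightarrow>
                integral {u..v} (\<lambda>t. (2 + R) * c t + err t) \<le> e / 4"
  shows "approx e \<delta> \<Xi> s x0 \<noteq> {}"
proof -
  have \<tau>mono: "\<tau> m \<le> \<tau> n" if "m \<le> n" for m n
    using that by (rule lift_Suc_mono_le[rotated]) (use \<tau>l l in \<open>smt (verit)\<close>)
  have \<tau>s: "s \<le> \<tau> n" for n using \<tau>mono[of 0 n] \<tau>0 by simp
  have \<tau>n: "s + real n * l \<le> \<tau> n" for n
  proof (induction n)
    case (Suc n) then show ?case using \<tau>l[of n] by (simp add: algebra_simps)
  qed (simp add: \<tau>0)
  define cl where "cl t = max s (min t T)" for t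
  have cl: "s \<le> cl t" "cl t \<le> T" for t using sT by (auto simp: cl_def)
  define N where "N t = (LEAST n. cl t < \<tau> (Suc n))" for t
  have N1: "cl t < \<tau> (Suc (N t))" for t
  proof -
    obtain n where "(cl t - s) / l < real n" using reals_Archimedean2 by blast
    then have "cl t < s + real (Suc n) * l" using l by (simp add: field_simps)
    then have "cl t < \<tau> (Suc n)" using \<tau>n[of "Suc n"] by linarith
    then show ?thesis unfolding N_def by (rule LeastI)
  qed
  have N2: "\<tau> (N t) \<le> cl t" for t
  proof (cases "N t")
    case 0 then show ?thesis using \<tau>0 cl by simp
  next
    case (Suc m)
    then have "\<not> cl t < \<tau> (Suc m)" using not_less_Least[of m "\<lambda>n. cl t < \<tau> (Suc n)"] unfolding N_def by simp
    then show ?thesis using Suc by simp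
  qed
  have N3: "N t = n" if "\<tau> n \<le> t" "t < \<tau> (Suc n)" "t \<le> T" for t n
    unfolding N_def
  proof (rule Least_equality)
    have ct: "cl t = t" using that \<tau>s[of n] by (auto simp: cl_def)
    show "cl t < \<tau> (Suc n)" using ct that by simp
    show "n \<le> m" if "cl t < \<tau> (Suc m)" for m
    proof (rule ccontr)
      assume "\<not> n \<le> m"
      then have "\<tau> (Suc m) \<le> \<tau> n" by (intro \<tau>mono) auto
      then show False using that ct \<open>\<tau> n \<le> t\<close> by simp
    qed
  qed
  have Nmono: "N p \<le> N q" if "p \<le> q" for p q
  proof -
    have "cl p \<le> cl q" using that by (auto simp: cl_def)
    then show ?thesis using N1[of q] unfolding N_def[of p] by (intro Least_le) simp
  qed
  define \<gamma> where "\<gamma> t = y (N t)" for t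
  have \<gamma>m: "\<gamma> \<in> borel_measurable borel"
  proof -
    have [measurable]: "cl \<in> borel_measurable borel" unfolding cl_def by measurable
    have "N \<in> measurable borel (count_space UNIV)" unfolding N_def by measurable
    then show ?thesis unfolding \<gamma>_def by (rule measurable_compose) simp
  qed
  have \<gamma>\<Omega>: "\<gamma> t \<in> \<Omega>" for t unfolding \<gamma>_def by (rule y\<Omega>)
  have \<gamma>R: "norm (\<gamma> t) \<le> R" for t
    unfolding \<gamma>_def using N2[of t] cl(2)[of t] by (intro yR) simp
  have Hint: "(\<lambda>t. H \<delta> t (\<gamma> t) \<xi>) integrable_on {p..q}" for \<xi> p q
    by (intro integrable_on_Icc H_integrable[OF \<gamma>m \<gamma>\<Omega> \<delta>(1) \<gamma>R])
  define g where "g \<xi> t = H \<delta> t (\<gamma> t) \<xi> + err t" for \<xi> t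
  have gint: "g \<xi> integrable_on {p..q}" for \<xi> p q
    unfolding g_def by (intro Henstock_Kurzweil_Integration.integrable_add Hint err(2))
  have node: "\<xi> \<bullet> (y j - y i) \<le> integral {\<tau> i..\<tau> j} (g \<xi>)" if "i \<le> j" "\<tau> j \<le> T" "\<xi> \<in> \<Xi>" for i j \<xi>
    using that(1,2)
  proof (induction j rule: dec_induct)
    case (step j)
    have jT: "\<tau> j \<le> T" using \<tau>mono[of j "Suc j"] step by simp
    have yi: "(\<lambda>t. H \<delta> t (y j) \<xi>) integrable_on {\<tau> j..\<tau> (Suc j)}"
      by (intro integrable_on_Icc H_const_integrable y\<Omega> \<delta>(1))
    have "\<xi> \<bullet> (y (Suc j) - y j) \<le> integral {\<tau> j..\<tau> (Suc j)} (\<lambda>t. H \<delta> t (y j) \<xi> + err t)"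
      using dir[OF jT that(3)] integral_add[OF yi err(2)] by simp
    (* At the right end point the path has already jumped to the next node. *)
    also have "\<dots> = integral {\<tau> j..\<tau> (Suc j)} (g \<xi>)"
    proof (rule integral_spike)
      show "negligible {\<tau> (Suc j)}" by simp
      fix t assume "t \<in> {\<tau> j..\<tau> (Suc j)} - {\<tau> (Suc j)}"
      then have "N t = j" using step by (intro N3) auto
      then show "g \<xi> t = H \<delta> t (y j) \<xi> + err t" by (simp add: g_def \<gamma>_def)
    qed
    finally have "\<xi> \<bullet> (y (Suc j) - y j) \<le> integral {\<tau> j..\<tau> (Suc j)} (g \<xi>)" .
    moreover have "integral {\<tau> i..\<tau> j} (g \<xi>) + integral {\<tau> j..\<tau> (Suc j)} (g \<xi>) = integral {\<tau> i..\<tau> (Suc j)} (g \<xi>)"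
      using step by (intro Henstock_Kurzweil_Integration.integral_combine gint \<tau>mono) auto
    moreover have "\<xi> \<bullet> (y (Suc j) - y i) = \<xi> \<bullet> (y (Suc j) - y j) + \<xi> \<bullet> (y j - y i)" by (simp add: inner_diff_right)
    ultimately show ?case using step.IH[OF jT] by linarith
  qed simp
  have gnode: "norm (y j - y i) \<le> (2 + norm (y i)) * (exp (A (\<tau> j) - A (\<tau> i)) - 1)" if "i \<le> j" for i j
    using that
  proof (induction j rule: dec_induct)
    case (step j)
    have "norm (y (Suc j) - y i) \<le> (2 + norm (y i)) * (exp (A (\<tau> j) - A (\<tau> i)) * exp (A (\<tau> (Suc j)) - A (\<tau> j)) - 1)"
      using step.IH gr A_mono[OF \<tau>mono[of j "Suc j"]] by (intro growth_compose) auto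
    then show ?case by (simp add: exp_add[symmetric])
  qed simp
  have small: "\<bar>integral {\<tau> (N t)..cl t} (g \<xi>)\<bar> \<le> e / 4" if "\<xi> \<in> \<Xi>" for t \<xi>
  proof -
    have \<xi>: "norm \<xi> = 1" using that \<Xi> D(2) by auto
    have ci: "(\<lambda>t. (2 + R) * c t + err t) integrable_on {p..q}" for p q
      by (intro Henstock_Kurzweil_Integration.integrable_add err(2) Henstock_Kurzweil_Integration.integrable_on_mult_right
        integrable_on_Icc c_integrable)
    have "norm (integral {\<tau> (N t)..cl t} (g \<xi>)) \<le> integral {\<tau> (N t)..cl t} (\<lambda>t. (2 + R) * c t + err t)"
    proof (rule integral_norm_bound_integral[OF gint ci])
      fix u
      have "\<bar>H \<delta> u (\<gamma> u) \<xi>\<bar> \<le> c u * (1 + norm (\<gamma> u) + \<delta>)" using H_abs_le[OF \<gamma>\<Omega> \<delta>(1), of u u \<xi>] \<xi> by simp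
      also have "\<dots> \<le> c u * (2 + R)" using \<gamma>R[of u] \<delta>(2) by (intro mult_left_mono c_nonneg) linarith
      finally show "norm (g \<xi> u) \<le> (2 + R) * c u + err u" using err(1)[of u] by (simp add: g_def mult.commute)
    qed
    also have "\<dots> \<le> e / 4"
      using \<tau>s[of "N t"] N2[of t] cl(2)[of t] N1[of t] \<tau>\<eta>[of "N t"] by (intro \<eta>w) auto
    finally show ?thesis by simp
  qed
  have "\<gamma> \<in> approx e \<delta> \<Xi> s x0"
    unfolding approx_def
  proof (intro CollectI conjI allI impI ballI)
    show "\<gamma> t = x0" if "t \<le> s" for t
    proof -
      have "N t = N s" using that by (simp add: N_def cl_def)
      also have "\<dots> = 0" using \<tau>0 \<tau>l[of 0] l sT by (intro N3) auto
      finally show ?thesis by (simp add: \<gamma>_def y0)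
    qed
    show "\<gamma> t = \<gamma> T" if "T \<le> t" for t
      using that sT by (simp add: \<gamma>_def N_def cl_def)
    show "norm (\<gamma> q - \<gamma> p) \<le> (2 + norm (\<gamma> p)) * (exp (A q - A p + e) - 1)" if pq: "p \<le> q" for p q
    proof -
      have "norm (\<gamma> q - \<gamma> p) \<le> (2 + norm (\<gamma> p)) * (exp (A (\<tau> (N q)) - A (\<tau> (N p))) - 1)"
        unfolding \<gamma>_def by (rule gnode[OF Nmono[OF pq]])
      also have "\<dots> \<le> (2 + norm (\<gamma> p)) * (exp (A q - A p + e) - 1)"
      proof -
        have "A (\<tau> (N q)) \<le> A (cl q)" by (rule A_mono[OF N2])
        moreover have "A (cl p) - A (\<tau> (N p)) \<le> e"
          using \<tau>s[of "N p"] N2[of p] cl(2)[of p] N1[of p] \<tau>\<eta>[of "N p"] by (intro \<eta>A) auto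
        moreover have "A (cl q) - A (cl p) \<le> A q - A p" unfolding cl_def by (rule A_clip[OF pq sT])
        ultimately have "A (\<tau> (N q)) - A (\<tau> (N p)) \<le> A q - A p + e" by linarith
        then show ?thesis by (intro mult_left_mono) auto
      qed
      finally show ?thesis .
    qed
    fix \<xi> p q assume \<xi>: "\<xi> \<in> \<Xi>" and pq: "s \<le> p" "p \<le> q" "q \<le> T"
    have clp: "cl p = p" "cl q = q" using pq by (auto simp: cl_def)
    let ?i = "\<tau> (N p)" and ?j = "\<tau> (N q)"
    have ij: "?i \<le> p" "?j \<le> q" "?i \<le> ?j" using N2[of p] N2[of q] clp \<tau>mono[OF Nmono[OF pq(2)]] by auto
    have "\<xi> \<bullet> (\<gamma> q - \<gamma> p) \<le> integral {?i..?j} (g \<xi>)"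
      unfolding \<gamma>_def using ij pq by (intro node Nmono \<xi>) auto
    moreover have "integral {?i..p} (g \<xi>) + integral {p..q} (g \<xi>) = integral {?i..q} (g \<xi>)"
      using ij pq by (intro Henstock_Kurzweil_Integration.integral_combine gint) auto
    moreover have "integral {?i..?j} (g \<xi>) + integral {?j..q} (g \<xi>) = integral {?i..q} (g \<xi>)"
      using ij pq by (intro Henstock_Kurzweil_Integration.integral_combine gint) auto
    moreover have "\<bar>integral {?i..p} (g \<xi>)\<bar> \<le> e / 4" "\<bar>integral {?j..q} (g \<xi>)\<bar> \<le> e / 4"
      using small[OF \<xi>, of p] small[OF \<xi>, of q] clp by auto
    moreover have "integral {p..q} (g \<xi>) = integral {p..q} (\<lambda>t. H \<delta> t (\<gamma> t) \<xi>) + integral {p..q} err"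
      unfolding g_def by (rule integral_add[OF Hint err(2)])
    moreover have "integral {p..q} err \<le> e / 2"
      using integral_subset_le[of "{p..q}" "{s..T}" err] pq err by fastforce
    ultimately show "\<xi> \<bullet> (\<gamma> q - \<gamma> p) \<le> integral {p..q} (\<lambda>t. H \<delta> t (\<gamma> t) \<xi>) + e"
      unfolding abs_le_iff by linarith
  qed (use \<gamma>m \<gamma>\<Omega> in auto)
  then show ?thesis by blast
qed

lemma cover_bad_times:
  assumes "AE t in lborel. good t" and "\<epsilon> > 0"
  obtains U where "open U" "\<And>t. \<not> good t \<Longrightarrow> t \<in> U" "(LINT t:U|lborel. c t) \<le> \<epsilon>"
proof -
  obtain d where d: "d > 0" "\<And>S. S \<in> sets lborel \<Longrightarrow> emeasure lborel S \<le> ennreal d \<Longrightarrow> (LINT x:S|lborel. \<bar>c x\<bar>) < \<epsilon>"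
    using integral_small_on_small_sets[OF c_integrable assms(2)] by auto
  obtain N where N: "{t \<in> space lborel. \<not> good t} \<subseteq> N" "emeasure lborel N = 0" "N \<in> sets lborel"
    by (rule AE_E[OF assms(1)])
  obtain U where U: "open U" "N \<subseteq> U" "emeasure lborel (U - N) < ennreal d"
    using outer_regular_lborel[of N d] N(3) d(1) by auto
  have "emeasure lborel U \<le> emeasure lborel (N \<union> (U - N))" using U N(3) by (intro emeasure_mono) auto
  also have "\<dots> \<le> emeasure lborel N + emeasure lborel (U - N)" using U N(3) by (intro emeasure_subadditive) auto
  also have "\<dots> \<le> ennreal d" using U(3) N(2) by simp
  finally have "(LINT x:U|lborel. \<bar>c x\<bar>) < \<epsilon>" using U(1) by (intro d(2)) auto
  then show thesis using that[OF U(1)] N(1) U(2) c_nonneg by auto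
qed

text \<open>
  The error budget \<open>e\<close> is split as follows: \<open>e / 4\<close> for the constant part \<open>\<epsilon>\<close> of \<open>err\<close>, \<open>e / 4\<close> for
  the neighbourhood \<open>U\<close> of the bad times, and twice \<open>e / 4\<close> for the times between nodes, which is
  achieved by a small maximal step length \<open>\<eta>\<close>.
\<close>

theorem euler_approximation:
  assumes x0: "x0 \<in> \<Omega>" and sT: "s \<le> T" and \<delta>: "0 < \<delta>" "\<delta> \<le> 1" and e: "0 < e" and \<Xi>: "finite \<Xi>" "\<Xi> \<subseteq> D"
  shows "approx e \<delta> \<Xi> s x0 \<noteq> {}"
proof -
  define R where "R = (2 + norm x0) * exp (A T - A s)"
  have R: "0 \<le> R" by (simp add: R_def)
  define \<epsilon> where "\<epsilon> = min 1 (e / (4 * (T - s + 1)))"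
  have \<epsilon>: "0 < \<epsilon>" "\<epsilon> \<le> 1" using e sT by (auto simp: \<epsilon>_def)
  have \<epsilon>T: "\<epsilon> * (T - s) \<le> e / 4"
  proof -
    have "\<epsilon> * (T - s) \<le> (e / (4 * (T - s + 1))) * (T - s)" using sT by (intro mult_right_mono) (auto simp: \<epsilon>_def)
    also have "\<dots> \<le> e / 4" using e sT by (simp add: field_simps)
    finally show ?thesis .
  qed
  obtain Z where Z: "countable Z" "Z \<subseteq> \<Omega>" "\<Omega> \<subseteq> closure Z" by (rule separable)
  obtain U where U: "open U" "\<And>t. \<not> good_time Z t \<Longrightarrow> t \<in> U" "(LINT t:U|lborel. c t) \<le> e / (4 * (2 + R))"
    using cover_bad_times[OF AE_good_time[OF Z(1,2)], of "e / (4 * (2 + R))"] e R by auto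
  define err where "err t = \<epsilon> + (2 + R) * (indicator U t * c t)" for t
  have ci: "integrable lborel (\<lambda>t. indicator U t * c t)"
    using integrable_mult_indicator[of U lborel c] U(1) c_integrable by simp
  have erri: "err integrable_on {p..q}" for p q
    unfolding err_def
    by (intro Henstock_Kurzweil_Integration.integrable_add Henstock_Kurzweil_Integration.integrable_on_mult_right
        integrable_const_ivl integrable_on_Icc[OF ci])
  have err1: "\<epsilon> \<le> err t" for t using R c_nonneg[of t] by (simp add: err_def)
  have err2: "(2 + R) * c t \<le> err t" if "t \<in> U" for t using that \<epsilon> by (simp add: err_def)
  have errT: "integral {s..T} err \<le> e / 2"
  proof -
    have "integral {s..T} (\<lambda>t. indicator U t * c t) \<le> (LINT t:U|lborel. c t)"
    proof -
      have "integral {s..T} (\<lambda>t. indicator U t * c t) = (LINT t:{s..T}|lborel. indicator U t * c t)"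
        using LINT_Icc_eq_integral[OF ci] by simp
      also have "\<dots> \<le> (LINT t:U|lborel. c t)"
        unfolding set_lebesgue_integral_def
      proof (rule integral_mono)
        show "integrable lborel (\<lambda>t. indicat_real {s..T} t *\<^sub>R (indicator U t * c t))"
          using ci by (intro integrable_mult_indicator) auto
      qed (use ci c_nonneg in \<open>auto simp: indicator_def\<close>)
      finally show ?thesis .
    qed
    then have "(2 + R) * integral {s..T} (\<lambda>t. indicator U t * c t) \<le> (2 + R) * (e / (4 * (2 + R)))"
      using U(3) R by (intro mult_left_mono) auto
    also have "\<dots> = e / 4" using R by (simp add: field_simps)
    finally have "(2 + R) * integral {s..T} (\<lambda>t. indicator U t * c t) \<le> e / 4" .
    moreover have "integral {s..T} err = \<epsilon> * (T - s) + (2 + R) * integral {s..T} (\<lambda>t. indicator U t * c t)"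
      unfolding err_def using sT
      by (subst integral_add[OF integrable_const_ivl Henstock_Kurzweil_Integration.integrable_on_mult_right[OF
        integrable_on_Icc[OF ci]]]) (simp add: mult.commute)
    ultimately show ?thesis using \<epsilon>T by linarith
  qed
  (* L (c + 1) dominates (2 + R) c + err, which is at most 2 (2 + R) c + 1. *)
  define L where "L = 5 + 2 * R"
  have L: "L \<ge> 5" using R by (simp add: L_def)
  have "uniformly_continuous_on {s..T} A"
    using A_continuous by (intro compact_uniformly_continuous) (auto intro: continuous_on_subset)
  moreover have "e / (4 * L) > 0" using e L by simp
  ultimately obtain d where d: "d > 0" "\<And>u v. u \<in> {s..T} \<Longrightarrow> v \<in> {s..T} \<Longrightarrow> dist v u < d \<Longrightarrow> dist (A v) (A u) < e / (4 * L)"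
    unfolding uniformly_continuous_on_def by metis
  define \<eta> where "\<eta> = d / 2"
  have \<eta>: "\<eta> > 0" using d by (simp add: \<eta>_def)
  have A\<eta>: "A v - A u \<le> e / (4 * L)" if "s \<le> u" "u \<le> v" "v \<le> T" "v - u \<le> \<eta>" for u v
    using d(2)[of u v] that d(1) by (auto simp: dist_real_def \<eta>_def)
  have A\<eta>1: "A v - A u \<le> e" if "s \<le> u" "u \<le> v" "v \<le> T" "v - u \<le> \<eta>" for u v
  proof -
    have "e / (4 * L) \<le> e" using e L by (simp add: field_simps)
    then show ?thesis using A\<eta>[OF that] by linarith
  qed
  have A\<eta>2: "integral {u..v} (\<lambda>t. (2 + R) * c t + err t) \<le> e / 4" if uv: "s \<le> u" "u \<le> v" "v \<le> T" "v - u \<le> \<eta>" for u v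
  proof -
    have "integral {u..v} (\<lambda>t. (2 + R) * c t + err t) \<le> integral {u..v} (\<lambda>t. L * (c t + 1))"
    proof (rule integral_le)
      show "(\<lambda>t. (2 + R) * c t + err t) integrable_on {u..v}"
        by (intro Henstock_Kurzweil_Integration.integrable_add erri Henstock_Kurzweil_Integration.integrable_on_mult_right
          integrable_on_Icc c_integrable)
      show "(\<lambda>t. L * (c t + 1)) integrable_on {u..v}"
        by (intro Henstock_Kurzweil_Integration.integrable_on_mult_right c1_integrable_on)
      fix t
      have "(2 + R) * (indicator U t * c t) \<le> (2 + R) * c t"
        using R c_nonneg[of t] by (intro mult_left_mono) (auto simp: indicator_def)
      then have "(2 + R) * c t + err t \<le> 2 * ((2 + R) * c t) + 1" using \<epsilon>(2) unfolding err_def by linarith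
      also have "\<dots> \<le> L * (c t + 1)" using R c_nonneg[of t] by (simp add: L_def algebra_simps)
      finally show "(2 + R) * c t + err t \<le> L * (c t + 1)" .
    qed
    also have "\<dots> = L * (A v - A u)" by (simp add: A_diff[OF uv(2)])
    also have "\<dots> \<le> L * (e / (4 * L))" using A\<eta>[OF uv] L by (intro mult_left_mono) auto
    also have "\<dots> = e / 4" using L by simp
    finally show ?thesis .
  qed
  obtain l where l: "l > 0" and st: "\<And>t x. s \<le> t \<Longrightarrow> t \<le> T \<Longrightarrow> x \<in> \<Omega> \<Longrightarrow> norm x \<le> R \<Longrightarrow>
     \<exists>\<kappa> x'. l \<le> \<kappa> \<and> \<kappa> \<le> \<eta> \<and> step \<delta> \<Xi> err \<kappa> t x x'"
    using uniform_step[where R = R and s = s, OF Z(2,3) U(1,2) \<delta> \<epsilon> \<eta> \<Xi> err1 err2 erri] by blast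
  have "norm x0 \<le> R"
  proof -
    have "(2 + norm x0) * 1 \<le> R" unfolding R_def using A_mono[OF sT] by (intro mult_left_mono) auto
    then show ?thesis by simp
  qed
  then have l\<eta>: "l \<le> \<eta>" using st[OF order_refl sT x0] by force
  obtain \<tau> y where ch: "\<tau> 0 = s" "y 0 = x0"
    "\<And>n. \<tau> n + l \<le> \<tau> (Suc n)" "\<And>n. \<tau> (Suc n) \<le> \<tau> n + \<eta>" "\<And>n. y n \<in> \<Omega>"
    "\<And>n. norm (y (Suc n) - y n) \<le> (2 + norm (y n)) * (exp (A (\<tau> (Suc n)) - A (\<tau> n)) - 1)"
    "\<And>n. \<tau> n \<le> T \<Longrightarrow> norm (y n) \<le> R"
    "\<And>n \<xi>. \<tau> n \<le> T \<Longrightarrow> \<xi> \<in> \<Xi> \<Longrightarrow> \<xi> \<bullet> (y (Suc n) - y n) \<le>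
        integral {\<tau> n..\<tau> (Suc n)} (\<lambda>t. H \<delta> t (y n) \<xi>) + integral {\<tau> n..\<tau> (Suc n)} err"
    by (rule euler_chain[OF x0 l l\<eta> sT R_def]; (rule st; assumption | rule that; assumption))
  have err0: "0 \<le> err t" for t using err1[of t] \<epsilon> by linarith
  show ?thesis
    by (rule euler_path[where \<tau> = \<tau> and y = y and l = l and \<eta> = \<eta> and R = R and err = err])
      (fact ch l sT \<delta> \<Xi> err0 erri errT A\<eta>1 A\<eta>2)+
qed

theorem sol_nonempty:
  assumes x0: "x0 \<in> \<Omega>" and sT: "s \<le> T"
  shows "sol s x0 \<noteq> {}"
proof -
  have Dne: "D \<noteq> {}"
  proof
    assume "D = {}"
    moreover obtain u :: 'a where "norm u = 1" using norm_Basis by (metis SOME_Basis)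
    ultimately show False using D(3) by auto
  qed
  define \<Xi> where "\<Xi> n = from_nat_into D ` {..n}" for n :: nat
  have \<Xi>: "finite (\<Xi> n)" "\<Xi> n \<subseteq> D" for n using from_nat_into[OF Dne] by (auto simp: \<Xi>_def)
  have "\<exists>\<gamma>. \<gamma> \<in> approx (mesh n) (mesh n) (\<Xi> n) s x0" for n
    using euler_approximation[OF x0 sT mesh_pos _ mesh_pos \<Xi>, of n n n] by (auto simp: mesh_def)
  then obtain \<gamma> where \<gamma>: "\<And>n. \<gamma> n \<in> approx (mesh n) (mesh n) (\<Xi> n) s x0" by metis
  have ev: "\<forall>\<^sub>F n in sequentially. \<xi> \<in> \<Xi> n" if \<xi>: "\<xi> \<in> D" for \<xi>
  proof -
    obtain k where "from_nat_into D k = \<xi>" using from_nat_into_surj[OF D(1) \<xi>] by blast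
    then show ?thesis
      by (intro eventually_mono[OF eventually_ge_at_top[of k]]) (auto simp: \<Xi>_def)
  qed
  obtain r \<eta> where "\<eta> \<in> sol s x0"
    using approx_compactness[OF \<gamma> mesh_tendsto mesh_tendsto mesh_pos ev tendsto_const sT] by blast
  then show ?thesis by blast
qed

end

section \<open>Lexicographic maximization over compact sets of paths\<close>

text \<open>
  Sequential compactness and continuity for pointwise convergence of paths.
\<close>

definition path_compact :: "(real \<Rightarrow> 'b::topological_space) set \<Rightarrow> bool" where
  "path_compact S \<longleftrightarrow> (\<forall>\<gamma>::nat \<Rightarrow> real \<Rightarrow> 'b. (\<forall>n. \<gamma> n \<in> S) \<longrightarrow>
     (\<exists>r \<eta>. strict_mono (r::nat \<Rightarrow> nat) \<and> \<eta> \<in> S \<and> (\<forall>t. (\<lambda>n. \<gamma> (r n) t) \<longlonglongrightarrow> \<eta> t)))"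

definition path_continuous :: "((real \<Rightarrow> 'b::topological_space) \<Rightarrow> real) \<Rightarrow> bool" where
  "path_continuous \<phi> \<longleftrightarrow> (\<forall>\<gamma>::nat \<Rightarrow> real \<Rightarrow> 'b. \<forall>\<eta>. (\<forall>t. (\<lambda>n. \<gamma> n t) \<longlonglongrightarrow> \<eta> t) \<longrightarrow> (\<lambda>n. \<phi> (\<gamma> n)) \<longlonglongrightarrow> \<phi> \<eta>)"

lemma path_compactD:
  assumes "path_compact S" "\<And>n. \<gamma> n \<in> S"
  shows "\<exists>r \<eta>. strict_mono (r::nat \<Rightarrow> nat) \<and> \<eta> \<in> S \<and> (\<forall>t. (\<lambda>n. \<gamma> (r n) t) \<longlonglongrightarrow> \<eta> t)"
  using assms unfolding path_compact_def by blast

lemma path_continuousD: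
  "path_continuous \<phi> \<Longrightarrow> (\<And>t. (\<lambda>n. \<gamma> n t) \<longlonglongrightarrow> \<eta> t) \<Longrightarrow> (\<lambda>n. \<phi> (\<gamma> n)) \<longlonglongrightarrow> \<phi> \<eta>"
  by (simp add: path_continuous_def)

lemma compact_image_of_path_compact:
  assumes S: "path_compact S" and \<phi>: "path_continuous \<phi>"
  shows "compact (\<phi> ` S)"
  unfolding compact_eq_seq_compact_metric seq_compact_def
proof (intro allI impI)
  fix f :: "nat \<Rightarrow> real" assume "\<forall>n. f n \<in> \<phi> ` S"
  then have "\<forall>n. \<exists>\<gamma>. \<gamma> \<in> S \<and> f n = \<phi> \<gamma>" by blast
  then obtain \<gamma> where \<gamma>: "\<And>n. \<gamma> n \<in> S" "\<And>n. f n = \<phi> (\<gamma> n)" by metis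
  obtain r \<eta> where r: "strict_mono (r::nat \<Rightarrow> nat)" "\<eta> \<in> S" "\<And>t. (\<lambda>n. \<gamma> (r n) t) \<longlonglongrightarrow> \<eta> t"
    using path_compactD[of S \<gamma>, OF S \<gamma>(1)] by blast
  have "(\<lambda>n. \<phi> (\<gamma> (r n))) \<longlonglongrightarrow> \<phi> \<eta>" by (rule path_continuousD[OF \<phi> r(3)])
  then show "\<exists>l\<in>\<phi> ` S. \<exists>r. strict_mono r \<and> (f \<circ> r) \<longlonglongrightarrow> l"
    using r(1,2) by (auto simp: o_def \<gamma>(2))
qed

definition path_max :: "((real \<Rightarrow> 'b::topological_space) \<Rightarrow> real) \<Rightarrow> (real \<Rightarrow> 'b) set \<Rightarrow> real" where
  "path_max \<phi> S = Sup (\<phi> ` S)"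

lemma path_max_attained:
  assumes S: "path_compact S" "S \<noteq> {}" and \<phi>: "path_continuous \<phi>"
  obtains \<gamma> where "\<gamma> \<in> S" "\<phi> \<gamma> = path_max \<phi> S" "\<And>\<eta>. \<eta> \<in> S \<Longrightarrow> \<phi> \<eta> \<le> path_max \<phi> S"
proof -
  obtain \<gamma> where \<gamma>: "\<gamma> \<in> S" "\<And>\<eta>. \<eta> \<in> S \<Longrightarrow> \<phi> \<eta> \<le> \<phi> \<gamma>"
    using compact_attains_sup[OF compact_image_of_path_compact[OF S(1) \<phi>]] S(2) by blast
  have "path_max \<phi> S = \<phi> \<gamma>" unfolding path_max_def using \<gamma> by (intro cSup_eq_maximum) auto
  then show thesis using \<gamma> by (intro that[of \<gamma>]) auto
qed

lemma path_max_ge: "path_compact S \<Longrightarrow> path_continuous \<phi> \<Longrightarrow> \<eta> \<in> S \<Longrightarrow> \<phi> \<eta> \<le> path_max \<phi> S"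
  by (metis empty_iff path_max_attained)

definition maximizers :: "((real \<Rightarrow> 'b::topological_space) \<Rightarrow> real) \<Rightarrow> (real \<Rightarrow> 'b) set \<Rightarrow> (real \<Rightarrow> 'b) set" where
  "maximizers \<phi> S = {\<gamma> \<in> S. \<forall>\<eta>\<in>S. \<phi> \<eta> \<le> \<phi> \<gamma>}"

lemma maximizers_eq:
  assumes "path_compact S" "path_continuous \<phi>"
  shows "maximizers \<phi> S = {\<gamma> \<in> S. \<phi> \<gamma> = path_max \<phi> S}"
proof (cases "S = {}")
  case False
  obtain \<gamma> where "\<gamma> \<in> S" "\<phi> \<gamma> = path_max \<phi> S" "\<And>\<eta>. \<eta> \<in> S \<Longrightarrow> \<phi> \<eta> \<le> path_max \<phi> S"
    by (rule path_max_attained[OF assms(1) False assms(2)]) (rule that)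
  then show ?thesis unfolding maximizers_def by (auto intro: antisym) (metis order_antisym)
qed (simp add: maximizers_def)

lemma maximizers_nonempty:
  assumes "path_compact S" "S \<noteq> {}" "path_continuous \<phi>"
  shows "maximizers \<phi> S \<noteq> {}"
proof -
  obtain \<gamma> where "\<gamma> \<in> S" "\<phi> \<gamma> = path_max \<phi> S" by (rule path_max_attained[OF assms])
  then show ?thesis unfolding maximizers_eq[OF assms(1,3)] by blast
qed

lemma maximizers_compact:
  assumes S: "path_compact S" and \<phi>: "path_continuous \<phi>"
  shows "path_compact (maximizers \<phi> S)"
  unfolding path_compact_def
proof (intro allI impI)
  fix \<gamma> :: "nat \<Rightarrow> real \<Rightarrow> 'a" assume \<gamma>: "\<forall>n. \<gamma> n \<in> maximizers \<phi> S"
  then have "\<And>n. \<gamma> n \<in> S" by (simp add: maximizers_def)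
  then obtain r \<eta> where r: "strict_mono (r::nat \<Rightarrow> nat)" "\<eta> \<in> S" "\<And>t. (\<lambda>n. \<gamma> (r n) t) \<longlonglongrightarrow> \<eta> t"
    using path_compactD[of S \<gamma>, OF S] by blast
  have "(\<lambda>n. \<phi> (\<gamma> (r n))) \<longlonglongrightarrow> \<phi> \<eta>" by (rule path_continuousD[OF \<phi> r(3)])
  moreover have "\<phi> (\<gamma> (r n)) = path_max \<phi> S" for n using \<gamma> unfolding maximizers_eq[OF S \<phi>] by blast
  ultimately have "\<phi> \<eta> = path_max \<phi> S" by (simp add: LIMSEQ_const_iff)
  then show "\<exists>r \<eta>. strict_mono (r::nat \<Rightarrow> nat) \<and> \<eta> \<in> maximizers \<phi> S \<and> (\<forall>t. (\<lambda>n. \<gamma> (r n) t) \<longlonglongrightarrow> \<eta> t)"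
    unfolding maximizers_eq[OF S \<phi>] using r by blast
qed

text \<open>
  Maximizing \<open>\<phi>\<close> over the maximizers of \<open>J\<close> is the limit of maximizing \<open>\<phi>\<close> with a growing penalty for
  not maximizing \<open>J\<close>. The penalized values decrease in \<open>n\<close> and stay above the constrained maximum. A cluster
  point \<open>\<eta>\<close> of the penalized maximizers maximizes \<open>J\<close>, since the penalty stays bounded, so the limit is at most \<open>\<phi> \<eta>\<close>.
\<close>

lemma penalized_maximum_tendsto:
  assumes S: "path_compact S" "S \<noteq> {}" and \<phi>: "path_continuous \<phi>" and J: "path_continuous J"
  shows "(\<lambda>n. path_max (\<lambda>\<gamma>. \<phi> \<gamma> + real n * J \<gamma>) S - real n * path_max J S) \<longlonglongrightarrow> path_max \<phi> (maximizers J S)"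
proof -
  define m where "m = path_max \<phi> (maximizers J S)"
  define a where "a n = path_max (\<lambda>\<gamma>. \<phi> \<gamma> + real n * J \<gamma>) S - real n * path_max J S" for n
  let ?\<psi> = "\<lambda>n \<gamma>. \<phi> \<gamma> + real n * J \<gamma>"
  have \<psi>: "path_continuous (?\<psi> n)" for n
    using \<phi> J unfolding path_continuous_def by (auto intro!: tendsto_intros)
  let ?M = "maximizers J S"
  have M: "path_compact ?M" "?M \<noteq> {}" using maximizers_compact[OF S(1) J] maximizers_nonempty[OF S J] by auto
  obtain g where g: "g \<in> ?M" "\<phi> g = m" unfolding m_def by (rule path_max_attained[OF M \<phi>])
  have gS: "g \<in> S" "J g = path_max J S" using g(1) unfolding maximizers_eq[OF S(1) J] by auto
  have low: "m \<le> a n" for n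
    using path_max_ge[OF S(1) \<psi> gS(1), of n] g(2) gS(2) by (simp add: a_def)
  have "\<exists>\<gamma>. \<gamma> \<in> S \<and> a n = \<phi> \<gamma> - real n * (path_max J S - J \<gamma>)" for n
  proof -
    obtain \<gamma> where "\<gamma> \<in> S" "?\<psi> n \<gamma> = path_max (?\<psi> n) S" by (rule path_max_attained[OF S \<psi>[of n]])
    then show ?thesis by (intro exI[of _ \<gamma>]) (simp add: algebra_simps a_def)
  qed
  then obtain \<gamma> where \<gamma>: "\<And>n. \<gamma> n \<in> S" "\<And>n. a n = \<phi> (\<gamma> n) - real n * (path_max J S - J (\<gamma> n))" by metis
  have Jle: "J (\<gamma> n) \<le> path_max J S" for n by (rule path_max_ge[OF S(1) J \<gamma>(1)])
  have dec: "a n \<le> a k" if "k \<le> n" for k n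
  proof -
    have "a n \<le> \<phi> (\<gamma> n) - real k * (path_max J S - J (\<gamma> n))"
      unfolding \<gamma>(2) using Jle[of n] that by (simp add: mult_right_mono)
    also have "\<dots> = ?\<psi> k (\<gamma> n) - real k * path_max J S" by (simp add: algebra_simps)
    also have "\<dots> \<le> a k" using path_max_ge[OF S(1) \<psi> \<gamma>(1)] by (simp add: a_def)
    finally show ?thesis .
  qed
  obtain r \<eta> where r: "strict_mono (r::nat \<Rightarrow> nat)" "\<eta> \<in> S" "\<And>t. (\<lambda>n. \<gamma> (r n) t) \<longlonglongrightarrow> \<eta> t"
    using path_compactD[of S \<gamma>, OF S(1) \<gamma>(1)] by blast
  have \<phi>r: "(\<lambda>n. \<phi> (\<gamma> (r n))) \<longlonglongrightarrow> \<phi> \<eta>" by (rule path_continuousD[OF \<phi> r(3)])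
  have Jr: "(\<lambda>n. J (\<gamma> (r n))) \<longlonglongrightarrow> J \<eta>" by (rule path_continuousD[OF J r(3)])
  have bound: "real n * (path_max J S - J (\<gamma> (r n))) \<le> \<phi> (\<gamma> (r n)) - m" for n
  proof -
    have "real n * (path_max J S - J (\<gamma> (r n))) \<le> real (r n) * (path_max J S - J (\<gamma> (r n)))"
      using seq_suble[OF r(1), of n] Jle[of "r n"] by (intro mult_right_mono) auto
    then show ?thesis using low[of "r n"] \<gamma>(2)[of "r n"] by linarith
  qed
  have "path_max J S - J \<eta> \<le> 0"
  proof (rule LIMSEQ_le)
    show "(\<lambda>n. path_max J S - J (\<gamma> (r (Suc n)))) \<longlonglongrightarrow> path_max J S - J \<eta>"
      using LIMSEQ_Suc[OF Jr] by (intro tendsto_intros)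
    have "(\<lambda>n. (\<phi> (\<gamma> (r (Suc n))) - m) * inverse (real (Suc n))) \<longlonglongrightarrow> (\<phi> \<eta> - m) * 0"
      by (intro tendsto_intros LIMSEQ_Suc[OF \<phi>r] LIMSEQ_inverse_real_of_nat)
    then show "(\<lambda>n. (\<phi> (\<gamma> (r (Suc n))) - m) * inverse (real (Suc n))) \<longlonglongrightarrow> 0" by simp
    show "\<exists>N. \<forall>n\<ge>N. path_max J S - J (\<gamma> (r (Suc n))) \<le> (\<phi> (\<gamma> (r (Suc n))) - m) * inverse (real (Suc n))"
    proof (intro exI[of _ 0] allI impI)
      fix n
      have "path_max J S - J (\<gamma> (r (Suc n))) \<le> (\<phi> (\<gamma> (r (Suc n))) - m) / real (Suc n)"
        using bound[of "Suc n"] by (subst pos_le_divide_eq) (simp_all only: of_nat_0_less_iff zero_less_Suc mult.commute)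
      then show "path_max J S - J (\<gamma> (r (Suc n))) \<le> (\<phi> (\<gamma> (r (Suc n))) - m) * inverse (real (Suc n))"
        by (simp only: divide_inverse)
    qed
  qed
  then have "J \<eta> = path_max J S" using path_max_ge[OF S(1) J r(2)] by simp
  then have "\<eta> \<in> ?M" using r(2) unfolding maximizers_eq[OF S(1) J] by simp
  then have \<eta>m: "\<phi> \<eta> \<le> m" unfolding m_def by (rule path_max_ge[OF M(1) \<phi>])
  have "a \<longlonglongrightarrow> m"
  proof (rule LIMSEQ_I)
    fix e :: real assume "e > 0"
    then have "\<forall>\<^sub>F n in sequentially. \<phi> (\<gamma> (r n)) < m + e" using \<eta>m by (intro order_tendstoD(2)[OF \<phi>r]) linarith
    then obtain n0 where n0: "\<phi> (\<gamma> (r n0)) < m + e" using eventually_happens'[OF sequentially_bot] by blast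
    have "a (r n0) \<le> \<phi> (\<gamma> (r n0))" unfolding \<gamma>(2) using Jle[of "r n0"] by simp
    then have "\<bar>a n - m\<bar> < e" if "r n0 \<le> n" for n
      using dec[OF that] low[of n] n0 by linarith
    then show "\<exists>n0. \<forall>n\<ge>n0. norm (a n - m) < e" unfolding real_norm_def by blast
  qed
  then show ?thesis unfolding a_def[abs_def] m_def .
qed

definition evaluation :: "nat \<Rightarrow> (real \<Rightarrow> 'b::euclidean_space) \<Rightarrow> real" where
  "evaluation k \<gamma> = (let p = from_nat_into (\<rat> \<times> Basis) k in \<gamma> (fst p) \<bullet> snd p)"

lemma evaluation_continuous: "path_continuous (evaluation k)"
  unfolding path_continuous_def evaluation_def Let_def by (auto intro!: tendsto_intros)

lemma evaluation_index:
  assumes "q \<in> \<rat>" "i \<in> (Basis :: 'b::euclidean_space set)"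
  obtains k where "\<And>\<gamma> :: real \<Rightarrow> 'b. evaluation k \<gamma> = \<gamma> q \<bullet> i"
proof -
  have cnt: "countable ((\<rat> :: real set) \<times> (Basis :: 'b set))"
    by (intro countable_SIGMA countable_rat countable_finite finite_Basis)
  have "(q, i) \<in> \<rat> \<times> Basis" using assms by simp
  from from_nat_into_surj[OF cnt this] obtain k where k: "from_nat_into (\<rat> \<times> Basis) k = (q, i)" ..
  show thesis
  proof (rule that)
    show "evaluation k \<gamma> = \<gamma> q \<bullet> i" for \<gamma> :: "real \<Rightarrow> 'b"
      unfolding evaluation_def Let_def k by simp
  qed
qed

primrec lex_maximizers :: "(real \<Rightarrow> 'b::euclidean_space) set \<Rightarrow> nat \<Rightarrow> (real \<Rightarrow> 'b) set" where
  "lex_maximizers S 0 = S"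
| "lex_maximizers S (Suc k) = maximizers (evaluation k) (lex_maximizers S k)"

lemma lex_maximizers_compact: "path_compact S \<Longrightarrow> path_compact (lex_maximizers S k)"
  by (induction k) (auto intro: maximizers_compact evaluation_continuous)

lemma lex_maximizers_nonempty: "path_compact S \<Longrightarrow> S \<noteq> {} \<Longrightarrow> lex_maximizers S k \<noteq> {}"
  by (induction k) (auto dest!: maximizers_nonempty[OF lex_maximizers_compact _ evaluation_continuous])

lemma lex_maximizers_antimono: "j \<le> k \<Longrightarrow> lex_maximizers S k \<subseteq> lex_maximizers S j"
  by (induction k rule: dec_induct) (auto simp: maximizers_def)

text \<open>
  The sets of maximizers decrease and are compact, so a cluster point of a diagonal sequence
  lies in all of them.
\<close>

lemma lex_maximum_exists:
  assumes S: "path_compact S" "S \<noteq> {}"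
  shows "\<exists>\<eta>. \<forall>k. \<eta> \<in> lex_maximizers S k"
proof -
  have "\<forall>k. \<exists>\<gamma>. \<gamma> \<in> lex_maximizers S k" using lex_maximizers_nonempty[OF S] by blast
  then obtain \<gamma> where \<gamma>: "\<And>k. \<gamma> k \<in> lex_maximizers S k" by metis
  then have "\<And>k. \<gamma> k \<in> S" using lex_maximizers_antimono[of 0] by fastforce
  then obtain r \<eta> where r: "strict_mono (r::nat \<Rightarrow> nat)" "\<eta> \<in> S" "\<And>t. (\<lambda>n. \<gamma> (r n) t) \<longlonglongrightarrow> \<eta> t"
    using path_compactD[of S \<gamma>, OF S(1)] by blast
  have "\<eta> \<in> lex_maximizers S k" for k
  proof -
    have "\<gamma> (r (n + k)) \<in> lex_maximizers S k" for n
    proof -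
      have "k \<le> r (n + k)" using seq_suble[OF r(1), of "n + k"] by simp
      then show ?thesis using \<gamma> lex_maximizers_antimono by blast
    qed
    then obtain r' \<eta>' where r': "strict_mono (r'::nat \<Rightarrow> nat)" "\<eta>' \<in> lex_maximizers S k"
        "\<And>t. (\<lambda>n. \<gamma> (r (r' n + k)) t) \<longlonglongrightarrow> \<eta>' t"
      using path_compactD[OF lex_maximizers_compact[OF S(1)], of "\<lambda>n. \<gamma> (r (n + k))" k] by blast
    have "\<eta>' t = \<eta> t" for t
      using LIMSEQ_unique[OF r'(3)[of t]] LIMSEQ_subseq_LIMSEQ[OF LIMSEQ_ignore_initial_segment[OF r(3)[of t], of k] r'(1)]
      by (simp add: o_def)
    then show ?thesis using r'(2) by (metis ext)
  qed
  then show ?thesis by blast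
qed

lemma lex_maximum_unique:
  fixes \<gamma> \<eta> :: "real \<Rightarrow> 'b::euclidean_space"
  assumes "\<And>k. \<gamma> \<in> lex_maximizers S k" "\<And>k. \<eta> \<in> lex_maximizers S k"
    and c: "continuous_on UNIV \<gamma>" "continuous_on UNIV \<eta>"
  shows "\<gamma> = \<eta>"
proof -
  have ev: "evaluation k \<gamma> = evaluation k \<eta>" for k
    using assms(1,2)[of "Suc k"] by (auto simp: maximizers_def intro: antisym)
  have "\<gamma> q = \<eta> q" if q: "q \<in> \<rat>" for q
  proof (rule euclidean_eqI)
    fix i :: 'b assume "i \<in> Basis"
    then obtain k where "\<And>\<gamma> :: real \<Rightarrow> 'b. evaluation k \<gamma> = \<gamma> q \<bullet> i" using evaluation_index[OF q] by blast
    then show "\<gamma> q \<bullet> i = \<eta> q \<bullet> i" using ev[of k] by metis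
  qed
  then have "\<gamma> t - \<eta> t = 0" for t
    using continuous_constant_on_closure[of "\<rat>" "\<lambda>t. \<gamma> t - \<eta> t" 0 t] c
    by (auto simp: Rats_closure_real intro!: continuous_intros)
  then show ?thesis by (auto simp: fun_eq_iff)
qed

definition lex_maximum :: "(real \<Rightarrow> 'b::euclidean_space) set \<Rightarrow> real \<Rightarrow> 'b" where
  "lex_maximum S = (THE \<gamma>. \<forall>k. \<gamma> \<in> lex_maximizers S k)"

lemma lex_maximum_eqI:
  assumes "\<And>k. \<gamma> \<in> lex_maximizers S k" and "\<And>\<gamma>. \<gamma> \<in> S \<Longrightarrow> continuous_on UNIV \<gamma>"
  shows "lex_maximum S = \<gamma>"
  unfolding lex_maximum_def
proof (rule the_equality)
  show "\<forall>k. \<gamma> \<in> lex_maximizers S k" using assms(1) by blast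
  fix \<eta> assume \<eta>: "\<forall>k. \<eta> \<in> lex_maximizers S k"
  have "\<gamma> \<in> S" "\<eta> \<in> S" using assms(1)[of 0] spec[OF \<eta>, of 0] by simp_all
  then show "\<eta> = \<gamma>"
    by (intro lex_maximum_unique[of \<eta> S \<gamma>] spec[OF \<eta>] assms)
qed

lemma lex_maximum_in:
  assumes S: "path_compact S" "S \<noteq> {}" and c: "\<And>\<gamma>. \<gamma> \<in> S \<Longrightarrow> continuous_on UNIV \<gamma>"
  shows "lex_maximum S \<in> lex_maximizers S k"
proof -
  obtain \<eta> where \<eta>: "\<And>k. \<eta> \<in> lex_maximizers S k" using lex_maximum_exists[OF S] by blast
  then show ?thesis using lex_maximum_eqI[of \<eta> S] c by simp
qed

locale upper_semicontinuous_paths =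
  fixes \<Omega> :: "'a::euclidean_space set" and C :: "'a \<Rightarrow> (real \<Rightarrow> 'b::euclidean_space) set"
  assumes closed_domain: "closed \<Omega>"
    and nonempty: "\<And>x. x \<in> \<Omega> \<Longrightarrow> C x \<noteq> {}"
    and upper: "\<And>(x :: nat \<Rightarrow> 'a) x0 \<gamma>. (\<And>n. x n \<in> \<Omega>) \<Longrightarrow> x \<longlonglongrightarrow> x0 \<Longrightarrow> (\<And>n. \<gamma> n \<in> C (x n)) \<Longrightarrow>
      \<exists>r \<eta>. strict_mono (r::nat \<Rightarrow> nat) \<and> \<eta> \<in> C x0 \<and> (\<forall>t. (\<lambda>n. \<gamma> (r n) t) \<longlonglongrightarrow> \<eta> t)"
    and continuous_paths: "\<And>x \<gamma>. \<gamma> \<in> C x \<Longrightarrow> continuous_on UNIV \<gamma>"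
begin

lemma C_compact: assumes x: "x \<in> \<Omega>" shows "path_compact (C x)"
  unfolding path_compact_def
proof (intro allI impI)
  fix \<gamma> :: "nat \<Rightarrow> real \<Rightarrow> 'b" assume "\<forall>n. \<gamma> n \<in> C x"
  then show "\<exists>r \<eta>. strict_mono (r::nat \<Rightarrow> nat) \<and> \<eta> \<in> C x \<and> (\<forall>t. (\<lambda>n. \<gamma> (r n) t) \<longlonglongrightarrow> \<eta> t)"
    using upper[of "\<lambda>_. x" x \<gamma>] x by auto
qed

text \<open>
  For \<open>k = 0\<close> the maximum is upper semicontinuous in the starting point. The induction step expresses the next
  maximum through the current ones, for other functionals, by \<open>penalized_maximum_tendsto\<close>; hence the
  statement is about all continuous functionals at once.
\<close>

lemma path_max_measurable:
  assumes "path_continuous \<phi>"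
  shows "(\<lambda>x. path_max \<phi> (lex_maximizers (C x) k)) \<in> borel_measurable (restrict_space borel \<Omega>)"
  using assms
proof (induction k arbitrary: \<phi>)
  case 0
  have closed: "closed {x \<in> \<Omega>. a \<le> path_max \<phi> (C x)}" for a
    unfolding closed_sequential_limits
  proof (intro allI impI, elim conjE)
    fix x x0 assume x: "\<forall>n. x n \<in> {x \<in> \<Omega>. a \<le> path_max \<phi> (C x)}" and lim: "x \<longlonglongrightarrow> x0"
    have x\<Omega>: "\<And>n. x n \<in> \<Omega>" using x by blast
    have x0: "x0 \<in> \<Omega>" using closed_sequentially[OF closed_domain _ lim] x\<Omega> by blast
    have "\<forall>n. \<exists>\<gamma>. \<gamma> \<in> C (x n) \<and> a \<le> \<phi> \<gamma>"
    proof
      fix n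
      obtain \<gamma> where "\<gamma> \<in> C (x n)" "\<phi> \<gamma> = path_max \<phi> (C (x n))"
        by (rule path_max_attained[OF C_compact[OF x\<Omega>] nonempty[OF x\<Omega>] 0])
      then show "\<exists>\<gamma>. \<gamma> \<in> C (x n) \<and> a \<le> \<phi> \<gamma>" using x by auto
    qed
    then obtain \<gamma> where \<gamma>: "\<And>n. \<gamma> n \<in> C (x n)" "\<And>n. a \<le> \<phi> (\<gamma> n)" by metis
    obtain r \<eta> where r: "strict_mono (r::nat \<Rightarrow> nat)" "\<eta> \<in> C x0" "\<And>t. (\<lambda>n. \<gamma> (r n) t) \<longlonglongrightarrow> \<eta> t"
      using upper[OF x\<Omega> lim \<gamma>(1)] by blast
    have "a \<le> \<phi> \<eta>"
      by (rule LIMSEQ_le_const[OF path_continuousD[OF 0 r(3)]]) (use \<gamma>(2) in auto)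
    also have "\<dots> \<le> path_max \<phi> (C x0)" by (rule path_max_ge[OF C_compact[OF x0] 0 r(2)])
    finally show "x0 \<in> {x \<in> \<Omega>. a \<le> path_max \<phi> (C x)}" using x0 by simp
  qed
  show ?case
    unfolding borel_measurable_iff_ge
  proof
    fix a
    have "{x \<in> space (restrict_space borel \<Omega>). a \<le> path_max \<phi> (lex_maximizers (C x) 0)} = \<Omega> \<inter> {x \<in> \<Omega>. a \<le> path_max \<phi> (C x)}"
      by (auto simp: space_restrict_space)
    then show "{x \<in> space (restrict_space borel \<Omega>). a \<le> path_max \<phi> (lex_maximizers (C x) 0)} \<in> sets (restrict_space borel \<Omega>)"
      using closed[of a] by (auto simp: sets_restrict_space)
  qed
next
  case (Suc k)
  let ?J = "evaluation k :: (real \<Rightarrow> 'b) \<Rightarrow> real"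
  show ?case
  proof (rule borel_measurable_LIMSEQ_real)
    fix n :: nat
    have "path_continuous (\<lambda>\<gamma>. \<phi> \<gamma> + real n * ?J \<gamma>)"
      using Suc.prems evaluation_continuous[of k] unfolding path_continuous_def by (auto intro!: tendsto_intros)
    then show "(\<lambda>x. path_max (\<lambda>\<gamma>. \<phi> \<gamma> + real n * ?J \<gamma>) (lex_maximizers (C x) k)
        - real n * path_max ?J (lex_maximizers (C x) k)) \<in> borel_measurable (restrict_space borel \<Omega>)"
      by (intro borel_measurable_diff borel_measurable_times borel_measurable_const Suc.IH evaluation_continuous)
  next
    fix x assume "x \<in> space (restrict_space borel \<Omega>)"
    then have x: "x \<in> \<Omega>" by (simp add: space_restrict_space)
    show "(\<lambda>n. path_max (\<lambda>\<gamma>. \<phi> \<gamma> + real n * ?J \<gamma>) (lex_maximizers (C x) k)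
        - real n * path_max ?J (lex_maximizers (C x) k)) \<longlonglongrightarrow> path_max \<phi> (lex_maximizers (C x) (Suc k))"
      unfolding lex_maximizers.simps
      by (rule penalized_maximum_tendsto[OF lex_maximizers_compact[OF C_compact[OF x]]
         lex_maximizers_nonempty[OF C_compact[OF x] nonempty[OF x]] Suc.prems evaluation_continuous])
  qed
qed

lemma selection_in: "x \<in> \<Omega> \<Longrightarrow> lex_maximum (C x) \<in> lex_maximizers (C x) k"
  by (rule lex_maximum_in[OF C_compact nonempty continuous_paths])

lemma selection_eqI: "(\<And>k. \<gamma> \<in> lex_maximizers (C x) k) \<Longrightarrow> lex_maximum (C x) = \<gamma>"
  by (rule lex_maximum_eqI[OF _ continuous_paths])

lemma selection_measurable: "(\<lambda>x. lex_maximum (C x) t) \<in> borel_measurable (restrict_space borel \<Omega>)"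
proof -
  have rat: "(\<lambda>x. lex_maximum (C x) q) \<in> borel_measurable (restrict_space borel \<Omega>)" if q: "q \<in> \<rat>" for q
    unfolding borel_measurable_euclidean_space[of "\<lambda>x. lex_maximum (C x) q"]
  proof
    fix i :: 'b assume "i \<in> Basis"
    then obtain k where k: "\<And>\<gamma> :: real \<Rightarrow> 'b. evaluation k \<gamma> = \<gamma> q \<bullet> i" using evaluation_index[OF q] by blast
    have "lex_maximum (C x) q \<bullet> i = path_max (evaluation k) (lex_maximizers (C x) k)" if x: "x \<in> \<Omega>" for x
      using selection_in[OF x, of "Suc k"] k[of "lex_maximum (C x)"]
        maximizers_eq[OF lex_maximizers_compact[OF C_compact[OF x]] evaluation_continuous[of k], of k] by auto
    then show "(\<lambda>x. lex_maximum (C x) q \<bullet> i) \<in> borel_measurable (restrict_space borel \<Omega>)"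
      using path_max_measurable[OF evaluation_continuous[of k], of k]
      by (subst measurable_cong[where g = "\<lambda>x. path_max (evaluation k) (lex_maximizers (C x) k)"])
        (auto simp: space_restrict_space)
  qed
  have "t \<in> closure \<rat>" by (simp add: Rats_closure_real)
  then obtain q where q: "\<And>n. q n \<in> \<rat>" "q \<longlonglongrightarrow> t" unfolding closure_sequential by blast
  show ?thesis
  proof (rule borel_measurable_LIMSEQ_metric[OF rat[OF q(1)]])
    fix x assume "x \<in> space (restrict_space borel \<Omega>)"
    then have "x \<in> \<Omega>" by (simp add: space_restrict_space)
    then have "continuous_on UNIV (lex_maximum (C x))" using selection_in[of x 0] continuous_paths by simp
    then show "(\<lambda>n. lex_maximum (C x) (q n)) \<longlonglongrightarrow> lex_maximum (C x) t"
      using q(2) by (metis UNIV_I continuous_on_eq_continuous_at isCont_tendsto_compose open_UNIV)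
  qed
qed

end

section \<open>The selected flow\<close>

context tangential_viability_problem begin

lemma sol_upper_semicontinuous:
  assumes sT: "s \<le> T"
  shows "upper_semicontinuous_paths \<Omega> (sol s)"
proof
  show "closed \<Omega>" by (rule closed)
  show "sol s x \<noteq> {}" if "x \<in> \<Omega>" for x by (rule sol_nonempty[OF that sT])
  show "continuous_on UNIV \<gamma>" if "\<gamma> \<in> sol s x" for x \<gamma> by (rule sol_continuous[OF that sT])
  fix x :: "nat \<Rightarrow> 'a" and x0 \<gamma> assume lim: "x \<longlonglongrightarrow> x0" and \<gamma>: "\<And>n. \<gamma> n \<in> sol s (x n)"
  have a: "\<gamma> n \<in> approx 0 (mesh n) D s (x n)" for n by (rule sol_approx[OF \<gamma> mesh_pos])
  obtain r \<eta> where "strict_mono (r :: nat \<Rightarrow> nat)" "\<eta> \<in> sol s x0" "\<And>t. (\<lambda>n. \<gamma> (r n) t) \<longlonglongrightarrow> \<eta> t"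
    using approx_compactness[OF a tendsto_const mesh_tendsto mesh_pos _ lim sT] by auto
  then show "\<exists>r \<eta>. strict_mono (r::nat \<Rightarrow> nat) \<and> \<eta> \<in> sol s x0 \<and> (\<forall>t. (\<lambda>n. \<gamma> (r n) t) \<longlonglongrightarrow> \<eta> t)" by blast
qed

definition flow :: "real \<Rightarrow> 'a \<Rightarrow> real \<Rightarrow> 'a" where
  "flow s x = lex_maximum (sol s x)"

lemma flow_lex:
  assumes "s \<le> T" "x \<in> \<Omega>"
  shows "flow s x \<in> lex_maximizers (sol s x) k"
proof -
  interpret upper_semicontinuous_paths \<Omega> "sol s" by (rule sol_upper_semicontinuous[OF assms(1)])
  show ?thesis using selection_in[OF assms(2)] unfolding flow_def .
qed

lemma flow_sol: "s \<le> T \<Longrightarrow> x \<in> \<Omega> \<Longrightarrow> flow s x \<in> sol s x"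
  using flow_lex[of s x 0] by simp

lemma flow_measurable:
  assumes "s \<le> T"
  shows "(\<lambda>x. flow s x t) \<in> borel_measurable (restrict_space borel \<Omega>)"
proof -
  interpret upper_semicontinuous_paths \<Omega> "sol s" by (rule sol_upper_semicontinuous[OF assms(1)])
  show ?thesis using selection_measurable unfolding flow_def .
qed

text \<open>
  At stage \<open>k\<close> the next evaluation is at some time \<open>q\<close>. If \<open>q \<le> s\<close>, it has the same value for
  all paths that start at time \<open>s\<close> in \<open>\<gamma> s\<close>, and nothing is discarded. If \<open>q > s\<close>, the value of a competitor \<open>\<eta>\<close> is that of
  the glued path, which cannot beat \<open>\<gamma>\<close>. The second conjunct carries the gluing through the induction.
\<close>

lemma flow_restrict_lex:
  assumes x: "x \<in> \<Omega>" and rs: "r \<le> s" "s \<le> T"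
  defines "\<gamma> \<equiv> flow r x"
  shows "(\<lambda>t. \<gamma> (max t s)) \<in> lex_maximizers (sol s (\<gamma> s)) k \<and>
    (\<forall>\<eta> \<in> lex_maximizers (sol s (\<gamma> s)) k. (\<lambda>t. if t \<le> s then \<gamma> t else \<eta> t) \<in> lex_maximizers (sol r x) k)"
proof (induction k)
  case 0
  have "\<gamma> \<in> sol r x" unfolding \<gamma>_def using rs by (intro flow_sol x) simp
  then show ?case using sol_restrict[OF _ rs] sol_concat[OF _ _ rs] by simp
next
  case (Suc k)
  let ?R = "\<lambda>t. \<gamma> (max t s)" and ?Z = "\<lambda>\<eta> t. if t \<le> s then \<gamma> t else \<eta> t"
  obtain q i where ev: "\<And>\<zeta> :: real \<Rightarrow> 'a. evaluation k \<zeta> = \<zeta> q \<bullet> i" unfolding evaluation_def Let_def by blast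
  have \<gamma>max: "\<zeta> q \<bullet> i \<le> \<gamma> q \<bullet> i" if "\<zeta> \<in> lex_maximizers (sol r x) k" for \<zeta>
  proof -
    have "\<gamma> \<in> lex_maximizers (sol r x) (Suc k)" unfolding \<gamma>_def using rs by (intro flow_lex x) simp
    then show ?thesis using that by (simp add: maximizers_def ev)
  qed
  have \<eta>q: "\<eta> q = \<gamma> s" if "\<eta> \<in> lex_maximizers (sol s (\<gamma> s)) k" "q \<le> s" for \<eta>
  proof -
    have "\<eta> \<in> sol s (\<gamma> s)" using that(1) lex_maximizers_antimono[of 0 k] by auto
    then show ?thesis using solD(2) that(2) by blast
  qed
  have "?R \<in> lex_maximizers (sol s (\<gamma> s)) (Suc k)"
    unfolding lex_maximizers.simps maximizers_def ev
  proof (intro CollectI conjI ballI)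
    show "?R \<in> lex_maximizers (sol s (\<gamma> s)) k" using Suc by blast
    fix \<eta> assume \<eta>: "\<eta> \<in> lex_maximizers (sol s (\<gamma> s)) k"
    show "\<eta> q \<bullet> i \<le> ?R q \<bullet> i"
    proof (cases "q \<le> s")
      case True then show ?thesis using \<eta>q[OF \<eta>] by (simp add: max_absorb2)
    next
      case False then show ?thesis using \<gamma>max[of "?Z \<eta>"] Suc \<eta> by (auto simp: max_absorb1)
    qed
  qed
  moreover have "?Z \<eta> \<in> lex_maximizers (sol r x) (Suc k)" if \<eta>: "\<eta> \<in> lex_maximizers (sol s (\<gamma> s)) (Suc k)" for \<eta>
    unfolding lex_maximizers.simps maximizers_def ev
  proof (intro CollectI conjI ballI)
    have Rk: "?R \<in> lex_maximizers (sol s (\<gamma> s)) k" using Suc by blast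
    have \<eta>k: "\<eta> \<in> lex_maximizers (sol s (\<gamma> s)) k" and
      all: "\<forall>\<zeta>\<in>lex_maximizers (sol s (\<gamma> s)) k. \<zeta> q \<bullet> i \<le> \<eta> q \<bullet> i"
      using \<eta> by (simp_all add: maximizers_def ev)
    have \<eta>max: "?R q \<bullet> i \<le> \<eta> q \<bullet> i" by (rule bspec[OF all Rk])
    show "?Z \<eta> \<in> lex_maximizers (sol r x) k" using Suc \<eta>k by blast
    fix \<zeta> assume \<zeta>: "\<zeta> \<in> lex_maximizers (sol r x) k"
    show "\<zeta> q \<bullet> i \<le> ?Z \<eta> q \<bullet> i"
    proof (cases "q \<le> s")
      case True then show ?thesis using \<gamma>max[OF \<zeta>] by simp
    next
      case False then show ?thesis using \<gamma>max[OF \<zeta>] \<eta>max by (simp add: max_absorb1)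
    qed
  qed
  ultimately show ?case by blast
qed

theorem flow_semigroup:
  assumes x: "x \<in> \<Omega>" and rst: "r \<le> s" "s \<le> t" "t \<le> T"
  shows "flow r x t = flow s (flow r x s) t"
proof -
  have sT: "s \<le> T" using rst by simp
  interpret upper_semicontinuous_paths \<Omega> "sol s" by (rule sol_upper_semicontinuous[OF sT])
  have "lex_maximum (sol s (flow r x s)) = (\<lambda>t. flow r x (max t s))"
    using flow_restrict_lex[OF x rst(1) sT] by (intro selection_eqI) blast
  then show ?thesis using rst unfolding flow_def[of s] by (simp add: max_absorb1)
qed

end

section \<open>Reduction to a Borel field\<close>

lemma lebesgue_on_borel_representative:
  fixes f :: "'b::euclidean_space \<Rightarrow> 'c::euclidean_space"
  assumes f: "f \<in> borel_measurable (lebesgue_on S)" and S: "S \<in> sets borel"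
  obtains g where "g \<in> borel_measurable borel" "AE z in lborel. z \<in> S \<longrightarrow> g z = f z"
proof -
  define h where "h z = (if z \<in> S then f z else 0)" for z
  have "h \<in> borel_measurable lebesgue"
    unfolding h_def by (rule borel_measurable_if_I[OF f]) (use S in simp)
  then have "\<forall>i\<in>Basis. \<exists>g\<in>borel_measurable lborel. AE z in lborel. h z \<bullet> i = g z"
    by (intro ballI completion_ex_borel_measurable_real) simp
  then obtain g where g: "\<And>i. i \<in> Basis \<Longrightarrow> g i \<in> borel_measurable lborel"
    "\<And>i. i \<in> Basis \<Longrightarrow> AE z in lborel. h z \<bullet> i = g i z" by metis
  show thesis
  proof (rule that)
    show "(\<lambda>z. \<Sum>i\<in>Basis. g i z *\<^sub>R i) \<in> borel_measurable borel"
      using g(1) by (intro borel_measurable_sum borel_measurable_scaleR) auto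
    have "AE z in lborel. \<forall>i\<in>Basis. h z \<bullet> i = g i z" using g(2) by (intro AE_finite_allI) auto
    then show "AE z in lborel. z \<in> S \<longrightarrow> (\<Sum>i\<in>Basis. g i z *\<^sub>R i) = f z"
    proof eventually_elim
      case (elim z)
      then have "(\<Sum>i\<in>Basis. g i z *\<^sub>R i) = (\<Sum>i\<in>Basis. (h z \<bullet> i) *\<^sub>R i)" by (intro sum.cong) auto
      also have "\<dots> = h z" by (rule euclidean_representation)
      finally have "(\<Sum>i\<in>Basis. g i z *\<^sub>R i) = h z" .
      then show ?case by (simp add: h_def)
    qed
  qed
qed

lemma integrable_borel_majorant:
  fixes c :: "real \<Rightarrow> real"
  assumes c: "integrable (lebesgue_on {p..q}) c"
  obtains c' where "integrable lborel c'" "\<And>t. 0 \<le> c' t" "\<And>t. t \<notin> {p..q} \<Longrightarrow> c' t = 0"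
    "AE t in lborel. t \<in> {p..q} \<longrightarrow> c t \<le> c' t"
proof -
  obtain g where g: "g \<in> borel_measurable borel" "AE t in lborel. t \<in> {p..q} \<longrightarrow> g t = c t"
    by (rule lebesgue_on_borel_representative[OF borel_measurable_integrable[OF c]]) auto
  define c' where "c' t = \<bar>indicator {p..q} t *\<^sub>R g t\<bar>" for t
  have [measurable]: "g \<in> borel_measurable borel" by (rule g(1))
  have gm: "(\<lambda>t. indicator {p..q} t *\<^sub>R g t) \<in> borel_measurable lborel" by measurable
  have ci: "integrable lebesgue (\<lambda>t. indicator {p..q} t *\<^sub>R c t)"
    using c by (subst (asm) integrable_restrict_space) auto
  have "integrable lebesgue (\<lambda>t. indicator {p..q} t *\<^sub>R g t)"
  proof (subst integrable_cong_AE)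
    show "(\<lambda>t. indicator {p..q} t *\<^sub>R g t) \<in> borel_measurable lebesgue" using gm by (rule measurable_completion)
    show "(\<lambda>t. indicator {p..q} t *\<^sub>R c t) \<in> borel_measurable lebesgue" using ci by (rule borel_measurable_integrable)
    show "AE t in lebesgue. indicator {p..q} t *\<^sub>R g t = indicator {p..q} t *\<^sub>R c t"
      using g(2) by (intro AE_completion) (auto elim!: eventually_mono simp: indicator_def)
  qed (rule ci)
  then have "integrable lborel (\<lambda>t. indicator {p..q} t *\<^sub>R g t)" using integrable_completion[OF gm] by simp
  then have "integrable lborel c'" unfolding c'_def[abs_def] by (rule Bochner_Integration.integrable_abs)
  moreover have "AE t in lborel. t \<in> {p..q} \<longrightarrow> c t \<le> c' t"
    using g(2) by eventually_elim (auto simp: c'_def)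
  ultimately show thesis by (intro that[of c']) (auto simp: c'_def)
qed

lemma filippov_h_delta_le_ess_le:
  assumes "ess_le (ball x \<delta> \<inter> \<Omega>) (\<lambda>y. \<xi> \<bullet> b t y) a"
  shows "filippov_h_delta b \<Omega> \<delta> t x \<xi> \<le> ereal a"
proof -
  have "AE y in lebesgue. y \<in> ball x \<delta> \<inter> \<Omega> \<longrightarrow> \<xi> \<bullet> b t y \<le> a"
    using assms unfolding ess_le_def by (rule AE_completion)
  then obtain N where N: "N \<in> null_sets lebesgue" "{y \<in> space lebesgue. \<not> (y \<in> ball x \<delta> \<inter> \<Omega> \<longrightarrow> \<xi> \<bullet> b t y \<le> a)} \<subseteq> N"
    by (auto simp: eventually_ae_filter)
  have "filippov_h_delta b \<Omega> \<delta> t x \<xi> \<le> (SUP y \<in> (ball x \<delta> \<inter> \<Omega>) - N. ereal (\<xi> \<bullet> b t y))"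
    unfolding filippov_h_delta_def by (rule INF_lower[OF N(1)])
  also have "\<dots> \<le> ereal a" using N(2) by (intro SUP_least) auto
  finally show ?thesis .
qed

lemma ess_le_of_filippov_bound:
  assumes "N \<in> null_sets lebesgue" "(SUP y \<in> (ball x \<delta> \<inter> \<Omega>) - N. ereal (\<xi> \<bullet> b t y)) \<le> ereal a"
  shows "ess_le (ball x \<delta> \<inter> \<Omega>) (\<lambda>y. \<xi> \<bullet> b t y) a"
proof -
  have "\<xi> \<bullet> b t y \<le> a" if "y \<in> ball x \<delta> \<inter> \<Omega>" "y \<notin> N" for y
  proof -
    have "ereal (\<xi> \<bullet> b t y) \<le> (SUP y \<in> (ball x \<delta> \<inter> \<Omega>) - N. ereal (\<xi> \<bullet> b t y))"
      using that by (intro SUP_upper) auto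
    then show ?thesis using assms(2) by (metis ereal_less_eq(3) order_trans)
  qed
  then have "AE y in lebesgue. y \<in> ball x \<delta> \<inter> \<Omega> \<longrightarrow> \<xi> \<bullet> b t y \<le> a"
    using AE_not_in[OF assms(1)] by (auto elim!: eventually_mono)
  then show ?thesis unfolding ess_le_def by (simp only: AE_completion_iff)
qed

text \<open>
  Changing the field on a null set of positions is invisible, so the Filippov functions of the original field \<open>b'\<close>
  can be computed from the Borel field \<open>b\<close>.
\<close>

lemma (in viability_problem) filippov_h_delta_eq_H:
  assumes x: "x \<in> \<Omega>" "\<delta> > 0" and ae: "AE y in lborel. y \<in> \<Omega> \<longrightarrow> b' t y = b t y"
  shows "filippov_h_delta b' \<Omega> \<delta> t x \<xi> = ereal (H \<delta> t x \<xi>)"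
proof -
  have ess: "ess_le (ball x \<delta> \<inter> \<Omega>) (\<lambda>y. \<xi> \<bullet> b' t y) a \<longleftrightarrow> H \<delta> t x \<xi> \<le> a" for a
    unfolding H_le_iff[OF x] ess_le_def using ae
    by (intro eventually_cong[OF ae]) auto
  show ?thesis
  proof (rule antisym)
    show "filippov_h_delta b' \<Omega> \<delta> t x \<xi> \<le> ereal (H \<delta> t x \<xi>)"
      by (rule filippov_h_delta_le_ess_le) (simp add: ess)
    show "ereal (H \<delta> t x \<xi>) \<le> filippov_h_delta b' \<Omega> \<delta> t x \<xi>"
      unfolding filippov_h_delta_def
    proof (rule INF_greatest)
      fix N :: "'a set" assume N: "N \<in> null_sets lebesgue"
      show "ereal (H \<delta> t x \<xi>) \<le> (SUP y \<in> (ball x \<delta> \<inter> \<Omega>) - N. ereal (\<xi> \<bullet> b' t y))"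
      proof (rule ereal_le_real)
        fix a assume "(SUP y \<in> (ball x \<delta> \<inter> \<Omega>) - N. ereal (\<xi> \<bullet> b' t y)) \<le> ereal a"
        then have "ess_le (ball x \<delta> \<inter> \<Omega>) (\<lambda>y. \<xi> \<bullet> b' t y) a" by (rule ess_le_of_filippov_bound[OF N])
        then show "ereal (H \<delta> t x \<xi>) \<le> ereal a" by (simp add: ess)
      qed
    qed
  qed
qed

lemma filippov_h_le_delta:
  assumes "\<delta> > 0"
  shows "filippov_h b \<Omega> t x \<xi> \<le> filippov_h_delta b \<Omega> \<delta> t x \<xi>"
proof (rule tendsto_upperbound[OF filippov_h_delta_tendsto])
  show "\<forall>\<^sub>F \<rho> in at_right 0. filippov_h_delta b \<Omega> \<rho> t x \<xi> \<le> filippov_h_delta b \<Omega> \<delta> t x \<xi>"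
    unfolding eventually_at_right_field using assms
    by (intro exI[of _ \<delta>]) (auto intro: filippov_h_delta_mono)
qed simp

text \<open>
  If the intersection were null, it could itself be discarded, leaving a supremum over the empty set.
\<close>

lemma filippov_map_nonempty_imp_thick:
  assumes "filippov_map b \<Omega> t x \<noteq> {}" "\<delta> > 0" "closed \<Omega>"
  shows "emeasure lborel (ball x \<delta> \<inter> \<Omega>) \<noteq> 0"
proof
  assume z: "emeasure lborel (ball x \<delta> \<inter> \<Omega>) = 0"
  have "ball x \<delta> \<inter> \<Omega> \<in> null_sets lborel" using z assms(3) by (auto simp: null_sets_def)
  then have N: "ball x \<delta> \<inter> \<Omega> \<in> null_sets lebesgue" by (rule null_sets_completionI)
  obtain v where v: "v \<in> filippov_map b \<Omega> t x" using assms(1) by blast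
  define \<xi> :: 'a where "\<xi> = (SOME i. i \<in> Basis)"
  have "\<xi> \<in> sphere 0 1" using norm_Basis[OF SOME_Basis] by (simp add: \<xi>_def)
  then have "ereal (\<xi> \<bullet> v) \<le> filippov_h b \<Omega> t x \<xi>" using v by (auto simp: filippov_map_def)
  also have "\<dots> \<le> filippov_h_delta b \<Omega> \<delta> t x \<xi>" by (rule filippov_h_le_delta[OF assms(2)])
  also have "\<dots> \<le> (SUP y \<in> (ball x \<delta> \<inter> \<Omega>) - (ball x \<delta> \<inter> \<Omega>). ereal (\<xi> \<bullet> b t y))"
    unfolding filippov_h_delta_def by (rule INF_lower[OF N])
  also have "\<dots> = - \<infinity>" by (simp add: bot_ereal_def)
  finally show False by simp
qed

text \<open>
  The Borel field \<open>b'\<close> and the function \<open>c\<close> vanish outside \<open>[0, T]\<close>, so the tangency condition holds there with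
  velocity \<open>0\<close>, and the times of a null set, \<open>T\<close> among them, are harmless.
\<close>

theorem theorem3p12:
  fixes T :: real
    and \<Omega> :: "'a::euclidean_space set"
    and b :: "real \<Rightarrow> 'a \<Rightarrow> 'a"
  assumes "T > 0"
    and "closed \<Omega>"
    and "Linf_loc_on ({0..T} \<times> \<Omega>) (\<lambda>(t, x). b t x)"
    and "\<exists>c :: real \<Rightarrow> real. integrable (lebesgue_on {0..T}) c \<and>
           (\<forall>t\<in>{0..T}. \<forall>x\<in>\<Omega>. norm (b t x) \<le> c t * (1 + norm x))"
    and "\<forall>t\<in>{0..<T}. \<forall>x\<in>frontier \<Omega>. filippov_map b \<Omega> t x \<inter> tangent_cone \<Omega> x \<noteq> {}"
  shows "\<exists>X :: real \<Rightarrow> real \<Rightarrow> 'a \<Rightarrow> 'a.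
      (\<forall>t\<in>{0..T}. \<forall>s\<in>{0..T}. \<forall>x\<in>\<Omega>. X t s x \<in> \<Omega>) \<and>
      (\<forall>s t. 0 \<le> s \<longrightarrow> s \<le> t \<longrightarrow> t \<le> T \<longrightarrow> X t s \<in> borel_measurable (restrict_space borel \<Omega>)) \<and>
      (\<forall>s\<in>{0..T}. \<forall>x\<in>\<Omega>. filippov_solution b \<Omega> s T x (\<lambda>t. X t s x)) \<and>
      (\<forall>x\<in>\<Omega>. \<forall>r s t. 0 \<le> r \<longrightarrow> r \<le> s \<longrightarrow> s \<le> t \<longrightarrow> t \<le> T \<longrightarrow>
         X t r x = X t s (X s r x))"
proof -
  let ?S = "{0..T} \<times> \<Omega>"
  have S: "?S \<in> sets borel" using assms(2) by (intro borel_closed closed_Times) auto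
  obtain c0 where c0: "integrable (lebesgue_on {0..T}) c0"
      "\<And>t x. t \<in> {0..T} \<Longrightarrow> x \<in> \<Omega> \<Longrightarrow> norm (b t x) \<le> c0 t * (1 + norm x)"
    using assms(4) by blast
  obtain c where c: "integrable lborel c" "\<And>t. 0 \<le> c t" "\<And>t. t \<notin> {0..T} \<Longrightarrow> c t = 0"
      "AE t in lborel. t \<in> {0..T} \<longrightarrow> c0 t \<le> c t"
    by (rule integrable_borel_majorant[OF c0(1)]) (rule that)
  have bm: "(\<lambda>(t, x). b t x) \<in> borel_measurable (lebesgue_on ?S)" using assms(3) by (simp add: Linf_loc_on_def)
  obtain g :: "real \<times> 'a \<Rightarrow> 'a" where g: "g \<in> borel_measurable borel"
      "AE z in lborel. z \<in> ?S \<longrightarrow> g z = (\<lambda>(t, x). b t x) z"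
    by (rule lebesgue_on_borel_representative[OF bm S]) (rule that)
  define b' where "b' t y = (if norm (g (t, y)) \<le> c t * (1 + norm y) then g (t, y) else 0)" for t y
  have b'g: "norm (b' t y) \<le> c t * (1 + norm y)" for t y
    using c(2)[of t] by (simp add: b'_def)
  have b'm: "(\<lambda>p. b' (fst p) (snd p)) \<in> borel_measurable (borel \<Otimes>\<^sub>M borel)"
  proof -
    have [measurable]: "g \<in> borel_measurable (borel \<Otimes>\<^sub>M borel)" using g(1) by (simp add: borel_prod)
    have [measurable]: "c \<in> borel_measurable borel" using c(1) by auto
    show ?thesis unfolding b'_def prod.collapse by measurable
  qed
  have "AE z in lborel \<Otimes>\<^sub>M lborel. z \<in> ?S \<longrightarrow> g z = (\<lambda>(t, x). b t x) z"
    using g(2) unfolding lborel_prod .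
  then have "AE t in lborel. AE y in lborel. (t, y) \<in> ?S \<longrightarrow> g (t, y) = (\<lambda>(t, x). b t x) (t, y)"
    by (rule lborel_pair.AE_pair)
  then have bb': "AE t in lborel. t \<in> {0..T} \<longrightarrow> (AE y in lborel. y \<in> \<Omega> \<longrightarrow> b t y = b' t y)"
    using c(4)
  proof eventually_elim
    case (elim t)
    show ?case
    proof
      assume t: "t \<in> {0..T}"
      show "AE y in lborel. y \<in> \<Omega> \<longrightarrow> b t y = b' t y"
        using elim(1)
      proof eventually_elim
        case (elim y)
        show ?case
        proof
          assume y: "y \<in> \<Omega>"
          have "norm (b t y) \<le> c t * (1 + norm y)"
            using c0(2)[OF t y] \<open>t \<in> {0..T} \<longrightarrow> c0 t \<le> c t\<close> t mult_right_mono[of "c0 t" "c t" "1 + norm y"] by simp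
          then show "b t y = b' t y" using elim t y by (simp add: b'_def)
        qed
      qed
    qed
  qed
  have thick: "emeasure lborel (ball x \<delta> \<inter> \<Omega>) \<noteq> 0" if x: "x \<in> \<Omega>" and \<delta>: "\<delta> > 0" for x \<delta>
  proof (cases "x \<in> interior \<Omega>")
    case True
    then obtain e where e: "e > 0" "ball x e \<subseteq> \<Omega>" using mem_interior by blast
    have "ball x (min e \<delta>) \<subseteq> ball x \<delta> \<inter> \<Omega>" using e(2) by auto
    then have "emeasure lborel (ball x (min e \<delta>)) \<le> emeasure lborel (ball x \<delta> \<inter> \<Omega>)"
      using assms(2) by (intro emeasure_mono) auto
    moreover have "measure lborel (ball x (min e \<delta>)) > 0" using content_ball_pos[of "min e \<delta>" x] e \<delta> by simp
    ultimately show ?thesis by (auto simp: measure_def)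
  next
    case False
    then have "x \<in> frontier \<Omega>" using x closure_subset by (auto simp: frontier_def)
    then have "filippov_map b \<Omega> 0 x \<noteq> {}" using assms(1,5) by fastforce
    then show ?thesis using filippov_map_nonempty_imp_thick \<delta> assms(2) by blast
  qed
  obtain D :: "'a set" where D: "countable D" "D \<subseteq> sphere 0 1" "sphere 0 1 \<subseteq> closure D" by (rule separable)
  interpret V: viability_problem T \<Omega> b' c D
    by unfold_locales (fact assms(2) b'm c(1) c(2) b'g thick D)+
  have tang: "AE t in lborel. \<forall>x\<in>frontier \<Omega>. \<exists>v\<in>tangent_cone \<Omega> x.
     \<forall>\<delta>>0. \<forall>\<xi>\<in>sphere 0 1. \<xi> \<bullet> v \<le> V.H \<delta> t x \<xi>"
  proof -
    have "AE t in lborel. t \<noteq> T" by (rule AE_lborel_singleton)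
    then show ?thesis
      using bb'
    proof eventually_elim
      case (elim t)
      show ?case
      proof
        fix x assume x: "x \<in> frontier \<Omega>"
        then have x\<Omega>: "x \<in> \<Omega>" using assms(2) frontier_subset_closed by blast
        show "\<exists>v\<in>tangent_cone \<Omega> x. \<forall>\<delta>>0. \<forall>\<xi>\<in>sphere 0 1. \<xi> \<bullet> v \<le> V.H \<delta> t x \<xi>"
        proof (cases "t \<in> {0..T}")
          case True
          then have "t \<in> {0..<T}" using elim(1) by auto
          then obtain v where v: "v \<in> filippov_map b \<Omega> t x" "v \<in> tangent_cone \<Omega> x" using assms(5) x by blast
          have "\<xi> \<bullet> v \<le> V.H \<delta> t x \<xi>" if "\<delta> > 0" "\<xi> \<in> sphere 0 1" for \<delta> \<xi>
          proof -
            have "ereal (\<xi> \<bullet> v) \<le> filippov_h b \<Omega> t x \<xi>" using v(1) that(2) by (auto simp: filippov_map_def)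
            also have "\<dots> \<le> filippov_h_delta b \<Omega> \<delta> t x \<xi>" by (rule filippov_h_le_delta[OF that(1)])
            also have "\<dots> = ereal (V.H \<delta> t x \<xi>)"
              using elim(2) True by (intro V.filippov_h_delta_eq_H x\<Omega> that(1)) simp
            finally show ?thesis by simp
          qed
          then show ?thesis using v(2) by blast
        next
          case False
          have "0 \<in> tangent_cone \<Omega> x"
            using x\<Omega> by (simp add: tangent_cone_def Liminf_const)
          moreover have "V.H \<delta> t x \<xi> = 0" if "\<delta> > 0" for \<delta> \<xi>
            using V.H_abs_le[OF x\<Omega> that, of t \<xi>] c(3)[OF False] by simp
          ultimately show ?thesis by force
        qed
      qed
    qed
  qed
  interpret W: tangential_viability_problem T \<Omega> b' c D
    by unfold_locales (rule tang)
  have fil: "filippov_solution b \<Omega> s T x (\<lambda>t. W.flow s x t)" if s: "s \<in> {0..T}" and x: "x \<in> \<Omega>" for s x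
  proof -
    have sT: "s \<le> T" using s by simp
    note \<gamma> = W.flow_sol[OF sT x]
    have "AE t in lborel. t \<noteq> s \<and> t \<noteq> T" by (intro AE_conjI AE_lborel_singleton)
    then have "AE t in lborel. t \<in> {s..T} \<longrightarrow>
        (\<exists>v\<in>filippov_map b \<Omega> t (W.flow s x t). (W.flow s x has_vector_derivative v) (at t within {s..T}))"
      using V.sol_derivative[OF \<gamma> sT] bb'
    proof eventually_elim
      case (elim t)
      show ?case
      proof
        assume t: "t \<in> {s..T}"
        then obtain v where v: "(W.flow s x has_vector_derivative v) (at t)"
          "\<And>\<delta> \<xi>. \<delta> > 0 \<Longrightarrow> \<xi> \<in> sphere 0 1 \<Longrightarrow> \<xi> \<bullet> v \<le> V.H \<delta> t (W.flow s x t) \<xi>" using elim(1,2) by force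
        have ae: "AE y in lborel. y \<in> \<Omega> \<longrightarrow> b t y = b' t y" using elim(3) t s by simp
        have "v \<in> filippov_map b \<Omega> t (W.flow s x t)"
          unfolding filippov_map_def
        proof (intro INT_I CollectI)
          fix \<xi> :: 'a assume \<xi>: "\<xi> \<in> sphere 0 1"
          show "ereal (\<xi> \<bullet> v) \<le> filippov_h b \<Omega> t (W.flow s x t) \<xi>"
          proof (rule tendsto_lowerbound[OF filippov_h_delta_tendsto])
            have "\<forall>\<^sub>F \<delta>::real in at_right 0. 0 < \<delta>" by (rule eventually_at_right_less)
            then show "\<forall>\<^sub>F \<delta> in at_right 0. ereal (\<xi> \<bullet> v) \<le> filippov_h_delta b \<Omega> \<delta> t (W.flow s x t) \<xi>"
            proof eventually_elim
              case (elim \<delta>)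
              show ?case using v(2)[OF elim \<xi>] V.filippov_h_delta_eq_H[where b' = b and t = t, OF V.solD(4)[OF \<gamma>] elim ae] by simp
            qed
          qed simp
        qed
        then show "\<exists>v\<in>filippov_map b \<Omega> t (W.flow s x t). (W.flow s x has_vector_derivative v) (at t within {s..T})"
          using has_vector_derivative_at_within[OF v(1)] by blast
      qed
    qed
    then have "AE t in lebesgue_on {s..T}.
        \<exists>v\<in>filippov_map b \<Omega> t (W.flow s x t). (W.flow s x has_vector_derivative v) (at t within {s..T})"
      by (subst AE_restrict_space_iff) (auto intro: AE_completion)
    moreover have "W.flow s x ` {s..T} \<subseteq> \<Omega>" using V.solD(4)[OF \<gamma>] by blast
    moreover have "W.flow s x s = x" by (rule V.solD(2)[OF \<gamma> order_refl])
    ultimately show ?thesis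
      unfolding filippov_solution_def using V.sol_abs_continuous[OF \<gamma> sT] by blast
  qed
  show ?thesis
  proof (intro exI[of _ "\<lambda>t s x. W.flow s x t"] conjI ballI allI impI)
    show "W.flow s x t \<in> \<Omega>" if "s \<in> {0..T}" "x \<in> \<Omega>" for s x t
      using V.solD(4)[OF W.flow_sol] that by simp
    show "(\<lambda>x. W.flow s x t) \<in> borel_measurable (restrict_space borel \<Omega>)" if "s \<le> t" "t \<le> T" for s t
      using that by (intro W.flow_measurable) simp
    show "filippov_solution b \<Omega> s T x (\<lambda>t. W.flow s x t)" if "s \<in> {0..T}" "x \<in> \<Omega>" for s x
      by (rule fil[OF that])
    show "W.flow r x t = W.flow s (W.flow r x s) t" if "x \<in> \<Omega>" "r \<le> s" "s \<le> t" "t \<le> T" for x r s t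
      by (rule W.flow_semigroup[OF that])
  qed
qed

end
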